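(* Let $R$ be a commutative noetherian local ring with residue field $k$ that is not Gorenstein, and let $M$ be a finitely generated $R$-module. If there exists an exact sequence $0\to k\to M\to G\to 0$ of finitely generated $R$-modules such that $\operatorname{Ext}_R^{i}(G,R)=0$ for all $i\gg0$, then $M\in\operatorname{EP}(R)$.
   Context: $\operatorname{mod} R$ is the category of finitely generated $R$-modules. $\operatorname{EP}(R)$ is the class of all $M\in\operatorname{mod} R$ such that for every $X\in\operatorname{mod} R$: if $\operatorname{Ext}_R^i(X,M)=0$ for all $i\gg0$, then $X$ has finite projective dimension over $R$. *)

theory Defs
  imports "HOL-Algebra.Algebra"
begin

section \<open>Modules over a commutative ring\<close>

text \<open>The record type of modules extends that of rings. The fields \<open>mult\<close> and \<open>one\<close> play no
  role for modules and are left unspecified in the constructions below.\<close>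

definition mod_hom ::
    "('a, 'c) ring_scheme \<Rightarrow> ('a, 'm) module \<Rightarrow> ('a, 'n) module \<Rightarrow> ('m \<Rightarrow> 'n) set" where
  "mod_hom R M N = {f \<in> carrier M \<rightarrow> carrier N.
     (\<forall>x\<in>carrier M. \<forall>y\<in>carrier M. f (x \<oplus>\<^bsub>M\<^esub> y) = f x \<oplus>\<^bsub>N\<^esub> f y) \<and>
     (\<forall>r\<in>carrier R. \<forall>x\<in>carrier M. f (r \<odot>\<^bsub>M\<^esub> x) = r \<odot>\<^bsub>N\<^esub> f x)}"

definition fg_module :: "('a, 'c) ring_scheme \<Rightarrow> ('a, 'm) module \<Rightarrow> bool" where
  "fg_module R M \<longleftrightarrow> module R M \<and>
     (\<exists>S. finite S \<and> S \<subseteq> carrier M \<and>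
       (\<forall>x\<in>carrier M. \<exists>c\<in>S \<rightarrow> carrier R. x = (\<Oplus>\<^bsub>M\<^esub>s\<in>S. c s \<odot>\<^bsub>M\<^esub> s)))"

definition zero_module :: "('a, 'm) module \<Rightarrow> bool" where
  "zero_module M \<longleftrightarrow> carrier M = {\<zero>\<^bsub>M\<^esub>}"

definition short_exact :: "('a, 'c) ring_scheme \<Rightarrow> ('a, 'l) module \<Rightarrow> ('l \<Rightarrow> 'm) \<Rightarrow>
    ('a, 'm) module \<Rightarrow> ('m \<Rightarrow> 'n) \<Rightarrow> ('a, 'n) module \<Rightarrow> bool" where
  "short_exact R L f M g N \<longleftrightarrow> f \<in> mod_hom R L M \<and> g \<in> mod_hom R M N \<and>
     inj_on f (carrier L) \<and> f ` carrier L = a_kernel M N g \<and> g ` carrier M = carrier N"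

definition regular_module :: "('a, 'c) ring_scheme \<Rightarrow> ('a, 'a) module" where
  "regular_module R = \<lparr>carrier = carrier R, monoid.mult = undefined, one = undefined,
     ring.zero = \<zero>\<^bsub>R\<^esub>, add = (\<oplus>\<^bsub>R\<^esub>), smult = (\<otimes>\<^bsub>R\<^esub>)\<rparr>"

definition factor_module :: "('a, 'm) module \<Rightarrow> 'm set \<Rightarrow> ('a, 'm set) module" where
  "factor_module M S = \<lparr>carrier = a_rcosets\<^bsub>M\<^esub> S, monoid.mult = undefined, one = undefined,
     ring.zero = S, add = set_add M, smult = (\<lambda>r A. \<Union>x\<in>A. S +>\<^bsub>M\<^esub> (r \<odot>\<^bsub>M\<^esub> x))\<rparr>"

text \<open>Homomorphisms are represented by functions that are \<open>undefined\<close> off the carrier, so that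
  equality in the carrier of \<open>hom_module R M N\<close> is equality of homomorphisms.\<close>

definition hom_module ::
    "('a, 'c) ring_scheme \<Rightarrow> ('a, 'm) module \<Rightarrow> ('a, 'n) module \<Rightarrow> ('a, 'm \<Rightarrow> 'n) module" where
  "hom_module R M N = \<lparr>carrier = mod_hom R M N \<inter> extensional (carrier M),
     monoid.mult = undefined, one = undefined,
     ring.zero = (\<lambda>x\<in>carrier M. \<zero>\<^bsub>N\<^esub>),
     add = (\<lambda>f g. \<lambda>x\<in>carrier M. f x \<oplus>\<^bsub>N\<^esub> g x),
     smult = (\<lambda>r f. \<lambda>x\<in>carrier M. r \<odot>\<^bsub>N\<^esub> f x)\<rparr>"


section \<open>Projective and injective modules, resolutions\<close>

text \<open>HOL cannot quantify over types inside a definition, so modules bound inside one have a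
  carrier in the fixed type \<open>'a list set\<close>. Its cardinality \<open>\<kappa>\<close> is \<open>2\<close> to the power
  \<open>max |'a| \<aleph>\<^sub>0\<close>, so every module over a ring on \<open>'a\<close> with at most \<open>\<kappa>\<close> elements has an isomorphic
  copy there. This loses nothing:

  \<^item> For \<open>P\<close> in this universe the free module on the set \<open>P\<close> is also in it (up to isomorphism), so
    the lifting property below makes \<open>P\<close> a direct summand of a free module.

  \<^item> All ideals of \<open>R\<close> are in it, so the extension property below contains Baer's criterion.

  \<^item> A module with at most \<open>\<kappa>\<close> elements has a free resolution in it and, since \<open>\<kappa>\<close> to the power
    \<open>max |'a| \<aleph>\<^sub>0\<close> is again \<open>\<kappa>\<close>, an injective resolution in it. By dimension shifting, finiteness of
    the projective or injective dimension can be tested on these. Finitely generated modules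
    over \<open>R\<close>, in whatever type their carriers are, have at most \<open>\<kappa>\<close> elements.\<close>

type_synonym 'a univ = "'a list set"

definition projective_module :: "('a, 'c) ring_scheme \<Rightarrow> ('a, 'a univ) module \<Rightarrow> bool" where
  "projective_module R P \<longleftrightarrow> module R P \<and>
     (\<forall>(N :: ('a, 'a univ) module) (L :: ('a, 'a univ) module) f g.
        module R N \<and> module R L \<and> f \<in> mod_hom R N L \<and> f ` carrier N = carrier L \<and>
        g \<in> mod_hom R P L \<longrightarrow>
        (\<exists>h\<in>mod_hom R P N. \<forall>x\<in>carrier P. f (h x) = g x))"

definition injective_module :: "('a, 'c) ring_scheme \<Rightarrow> ('a, 'a univ) module \<Rightarrow> bool" where
  "injective_module R I \<longleftrightarrow> module R I \<and>
     (\<forall>(L :: ('a, 'a univ) module) (N :: ('a, 'a univ) module) f g.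
        module R L \<and> module R N \<and> f \<in> mod_hom R L N \<and> inj_on f (carrier L) \<and>
        g \<in> mod_hom R L I \<longrightarrow>
        (\<exists>h\<in>mod_hom R N I. \<forall>x\<in>carrier L. h (f x) = g x))"

text \<open>\<open>\<cdots> \<rightarrow> P 2 \<rightarrow> P 1 \<rightarrow> P 0 \<rightarrow> Y \<rightarrow> 0\<close> with \<open>d i : P (i + 1) \<rightarrow> P i\<close> and \<open>e : P 0 \<rightarrow> Y\<close>.\<close>

definition projective_resolution :: "('a, 'c) ring_scheme \<Rightarrow> ('a, 'y) module \<Rightarrow>
    (nat \<Rightarrow> ('a, 'a univ) module) \<Rightarrow> (nat \<Rightarrow> 'a univ \<Rightarrow> 'a univ) \<Rightarrow> ('a univ \<Rightarrow> 'y) \<Rightarrow> bool" where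
  "projective_resolution R Y P d e \<longleftrightarrow>
     (\<forall>i. projective_module R (P i)) \<and>
     (\<forall>i. d i \<in> mod_hom R (P (Suc i)) (P i)) \<and>
     e \<in> mod_hom R (P 0) Y \<and>
     e ` carrier (P 0) = carrier Y \<and>
     d 0 ` carrier (P (Suc 0)) = a_kernel (P 0) Y e \<and>
     (\<forall>i. d (Suc i) ` carrier (P (Suc (Suc i))) = a_kernel (P (Suc i)) (P i) (d i))"

text \<open>\<open>0 \<rightarrow> Y \<rightarrow> I 0 \<rightarrow> I 1 \<rightarrow> I 2 \<rightarrow> \<cdots>\<close> with \<open>e : Y \<rightarrow> I 0\<close> and \<open>d i : I i \<rightarrow> I (i + 1)\<close>.\<close>

definition injective_resolution :: "('a, 'c) ring_scheme \<Rightarrow> ('a, 'y) module \<Rightarrow>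
    (nat \<Rightarrow> ('a, 'a univ) module) \<Rightarrow> (nat \<Rightarrow> 'a univ \<Rightarrow> 'a univ) \<Rightarrow> ('y \<Rightarrow> 'a univ) \<Rightarrow> bool" where
  "injective_resolution R Y I d e \<longleftrightarrow>
     (\<forall>i. injective_module R (I i)) \<and>
     (\<forall>i. d i \<in> mod_hom R (I i) (I (Suc i))) \<and>
     e \<in> mod_hom R Y (I 0) \<and>
     inj_on e (carrier Y) \<and>
     e ` carrier Y = a_kernel (I 0) (I (Suc 0)) (d 0) \<and>
     (\<forall>i. d i ` carrier (I i) = a_kernel (I (Suc i)) (I (Suc (Suc i))) (d (Suc i)))"

definition finite_proj_dim :: "('a, 'c) ring_scheme \<Rightarrow> ('a, 'y) module \<Rightarrow> bool" where
  "finite_proj_dim R Y \<longleftrightarrow>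
     (\<exists>P d e n. projective_resolution R Y P d e \<and> (\<forall>i>n. zero_module (P i)))"

definition finite_inj_dim :: "('a, 'c) ring_scheme \<Rightarrow> ('a, 'y) module \<Rightarrow> bool" where
  "finite_inj_dim R Y \<longleftrightarrow>
     (\<exists>I d e n. injective_resolution R Y I d e \<and> (\<forall>i>n. zero_module (I i)))"


section \<open>Ext modules\<close>

text \<open>Cocycles and coboundaries of the complex \<open>Hom(P 0, M) \<rightarrow> Hom(P 1, M) \<rightarrow> \<cdots>\<close>.\<close>

definition ext_cocycles :: "('a, 'c) ring_scheme \<Rightarrow> (nat \<Rightarrow> ('a, 'p) module) \<Rightarrow>
    (nat \<Rightarrow> 'p \<Rightarrow> 'p) \<Rightarrow> ('a, 'm) module \<Rightarrow> nat \<Rightarrow> ('p \<Rightarrow> 'm) set" where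
  "ext_cocycles R P d M i =
     {f \<in> carrier (hom_module R (P i) M). \<forall>x\<in>carrier (P (Suc i)). f (d i x) = \<zero>\<^bsub>M\<^esub>}"

fun ext_coboundaries :: "('a, 'c) ring_scheme \<Rightarrow> (nat \<Rightarrow> ('a, 'p) module) \<Rightarrow>
    (nat \<Rightarrow> 'p \<Rightarrow> 'p) \<Rightarrow> ('a, 'm) module \<Rightarrow> nat \<Rightarrow> ('p \<Rightarrow> 'm) set" where
  "ext_coboundaries R P d M 0 = {\<zero>\<^bsub>hom_module R (P 0) M\<^esub>}"
| "ext_coboundaries R P d M (Suc i) =
     (\<lambda>f. \<lambda>x\<in>carrier (P (Suc i)). f (d i x)) ` carrier (hom_module R (P i) M)"

text \<open>\<open>Ext R i Y M\<close> is the \<open>i\<close>-th cohomology module of \<open>Hom(P, M)\<close> for a chosen projective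
  resolution \<open>P\<close> of \<open>Y\<close>. Up to isomorphism it does not depend on the choice. The definition is
  meaningful whenever \<open>Y\<close> has a resolution in the universe, hence for all finitely generated \<open>Y\<close>.\<close>

definition Ext :: "('a, 'c) ring_scheme \<Rightarrow> nat \<Rightarrow> ('a, 'y) module \<Rightarrow> ('a, 'm) module \<Rightarrow>
    ('a, ('a univ \<Rightarrow> 'm) set) module" where
  "Ext R i Y M =
     (let (P, d, e) = (SOME (P, d, e). projective_resolution R Y P d e)
      in factor_module ((hom_module R (P i) M)\<lparr>carrier := ext_cocycles R P d M i\<rparr>)
           (ext_coboundaries R P d M i))"

definition Ext_eventually_zero ::
    "('a, 'c) ring_scheme \<Rightarrow> ('a, 'y) module \<Rightarrow> ('a, 'm) module \<Rightarrow> bool" where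
  "Ext_eventually_zero R Y M \<longleftrightarrow> (\<exists>n. \<forall>i\<ge>n. zero_module (Ext R i Y M))"


section \<open>Local rings and the class EP\<close>

definition noetherian_local_ring :: "('a, 'c) ring_scheme \<Rightarrow> bool" where
  "noetherian_local_ring R \<longleftrightarrow> cring R \<and> noetherian_ring R \<and> (\<exists>!\<mm>. maximalideal \<mm> R)"

definition max_ideal :: "('a, 'c) ring_scheme \<Rightarrow> 'a set" where
  "max_ideal R = (THE \<mm>. maximalideal \<mm> R)"

text \<open>The \<open>R\<close>-module whose additive group is that of the residue field \<open>R Quot max_ideal R\<close>.\<close>

definition residue_field_module :: "('a, 'c) ring_scheme \<Rightarrow> ('a, 'a set) module" where
  "residue_field_module R = factor_module (regular_module R) (max_ideal R)"

definition gorenstein_local_ring :: "('a, 'c) ring_scheme \<Rightarrow> bool" where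
  "gorenstein_local_ring R \<longleftrightarrow> noetherian_local_ring R \<and> finite_inj_dim R (regular_module R)"

text \<open>The test modules \<open>Y\<close> have carriers in the type \<open>'y\<close>. A statement in which \<open>'y\<close> is a free
  type variable covers test modules of every type. The instance \<open>'y = 'a list set\<close> already
  contains every finitely generated module up to isomorphism.\<close>

definition EP :: "'y itself \<Rightarrow> ('a, 'c) ring_scheme \<Rightarrow> ('a, 'm) module set" where
  "EP _ R = {M. fg_module R M \<and>
     (\<forall>Y :: ('a, 'y) module. fg_module R Y \<and> Ext_eventually_zero R Y M \<longrightarrow> finite_proj_dim R Y)}"

end

theory Submission
  imports Defs "HOL-Library.Countable_Set"
begin

text \<open>Suppose \<open>Ext\<^sup>i(Y, M)\<close> vanishes for large \<open>i\<close> but the minimal free resolution \<open>F\<close> of \<open>Y\<close> is infinite, and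
  let \<open>Z\<^sub>i \<subseteq> Hom(F\<^sub>i, M)\<close> be the cocycles. For large \<open>i\<close> there are short exact sequences
  \<open>0 \<rightarrow> Z\<^sub>i \<rightarrow> Hom(F\<^sub>i, M) \<rightarrow> Z\<^sub>i\<^sub>+\<^sub>1 \<rightarrow> 0\<close>, and minimality gives \<open>Hom(F\<^sub>i, k) \<subseteq> Z\<^sub>i\<close>. Since \<open>Ext\<^sup>j(G, R) = 0\<close> for large
  \<open>j\<close>, the restriction \<open>Ext\<^sup>j(Hom(F\<^sub>i, M), R) \<rightarrow> Ext\<^sup>j(Hom(F\<^sub>i, k), R)\<close> is an isomorphism, so
  \<open>Ext\<^sup>j(Hom(F\<^sub>i, M), R) \<rightarrow> Ext\<^sup>j(Z\<^sub>i, R)\<close> is injective and the connecting maps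
  \<open>Ext\<^sup>j(Z\<^sub>i, R) \<rightarrow> Ext\<^sup>j\<^sup>+\<^sup>1(Z\<^sub>i\<^sub>+\<^sub>1, R)\<close> are surjective. In the resulting chain of surjections of noetherian
  modules the kernels stabilise, so \<open>Ext\<^sup>j\<^sup>+\<^sup>s(Hom(F\<^sub>i\<^sub>+\<^sub>s, M), R) = 0\<close> for large \<open>s\<close>. As \<open>F\<^sub>i\<^sub>+\<^sub>s \<noteq> 0\<close>, this gives
  \<open>Ext\<^sup>j(M, R) = 0\<close> and then \<open>Ext\<^sup>j(k, R) = 0\<close> for all large \<open>j\<close>. By noetherian induction over ideals and
  Nakayama's lemma \<open>Ext\<^sup>j(R/\<aa>, R) = 0\<close> for all ideals \<open>\<aa>\<close> with the same bound on \<open>j\<close>, so \<open>R\<close> is Gorenstein.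

  Ext is computed from an injective coresolution of the second argument, where long exact sequences
  need no choice of resolutions in the first.\<close>

text \<open>The modules Z_i live in function types that vary with Y and M, outside the universe in
  which resolutions are chosen. So the second argument is copied into the universe and coresolved
  there, while the first may have any type. The hypotheses on \<open>Ext\<close> enter only as
  eventual exactness of Hom(P, M) and Hom(P, R) for some projective resolution P, and
  \<open>hom_exact_iff_ext_zero\<close> translates this to coresolutions. It also shows that the
  exactness does not depend on P, so the minimal resolution of Y may replace the one chosen inside
  \<open>Ext\<close>.

  Ext modules over a coresolution are never formed. One noetherian module T is mapped by a linear
  relation onto the cohomology; composing with connecting maps keeps T fixed, and the chain
  condition is applied to kernels inside T. A connecting map raises the resolution index and the
  degree together, so vanishing at (i + s, j + s) runs through every large degree.

  The bound for R/\<aa> must not depend on \<aa>, since it becomes the length of an injective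
  resolution. The exact sequences of the induction only use degrees j and j + 1, which preserves
  it.\<close>

context cring
begin

section \<open>Module arithmetic and homomorphisms\<close>

lemma module_abelian_group: "module R M \<Longrightarrow> abelian_group M"
  and module_abelian_monoid: "module R M \<Longrightarrow> abelian_monoid M"
  by (simp_all add: module.axioms abelian_group.axioms)

lemma module_neg_zero: "module R M \<Longrightarrow> \<ominus>\<^bsub>M\<^esub> \<zero>\<^bsub>M\<^esub> = \<zero>\<^bsub>M\<^esub>"
  using abelian_group.a_inv_closed[OF module_abelian_group] abelian_group.l_neg[OF module_abelian_group]
    abelian_monoid.zero_closed[OF module_abelian_monoid] abelian_monoid.r_zero[OF module_abelian_monoid]
  by metis

text \<open>Conditional rules with explicit \<open>M\<close> rather than an interpretation, since
  most arguments below involve several modules at once. Negatives and differences are also expressed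
  through the scalar \<open>\<ominus> \<one>\<close>, so that they reduce to addition and scalar
  multiplication.\<close>

lemma
  assumes "module R M"
  shows module_zero_closed [simp]: "\<zero>\<^bsub>M\<^esub> \<in> carrier M"
    and module_add_closed [simp]:
      "\<And>x y. x \<in> carrier M \<Longrightarrow> y \<in> carrier M \<Longrightarrow> x \<oplus>\<^bsub>M\<^esub> y \<in> carrier M"
    and module_neg_closed [simp]: "\<And>x. x \<in> carrier M \<Longrightarrow> \<ominus>\<^bsub>M\<^esub> x \<in> carrier M"
    and module_minus_closed [simp]:
      "\<And>x y. x \<in> carrier M \<Longrightarrow> y \<in> carrier M \<Longrightarrow> x \<ominus>\<^bsub>M\<^esub> y \<in> carrier M"
    and module_smult_closed [simp]:
      "\<And>r x. r \<in> carrier R \<Longrightarrow> x \<in> carrier M \<Longrightarrow> r \<odot>\<^bsub>M\<^esub> x \<in> carrier M"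
    and module_zero_left [simp]: "\<And>x. x \<in> carrier M \<Longrightarrow> \<zero>\<^bsub>M\<^esub> \<oplus>\<^bsub>M\<^esub> x = x"
    and module_zero_right [simp]: "\<And>x. x \<in> carrier M \<Longrightarrow> x \<oplus>\<^bsub>M\<^esub> \<zero>\<^bsub>M\<^esub> = x"
    and module_one_smult [simp]: "\<And>x. x \<in> carrier M \<Longrightarrow> \<one> \<odot>\<^bsub>M\<^esub> x = x"
    and module_zero_smult [simp]: "\<And>x. x \<in> carrier M \<Longrightarrow> \<zero> \<odot>\<^bsub>M\<^esub> x = \<zero>\<^bsub>M\<^esub>"
    and module_smult_zero [simp]: "\<And>r. r \<in> carrier R \<Longrightarrow> r \<odot>\<^bsub>M\<^esub> \<zero>\<^bsub>M\<^esub> = \<zero>\<^bsub>M\<^esub>"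
    and module_add_neg [simp]: "\<And>x. x \<in> carrier M \<Longrightarrow> x \<oplus>\<^bsub>M\<^esub> \<ominus>\<^bsub>M\<^esub> x = \<zero>\<^bsub>M\<^esub>"
    and module_neg_add [simp]: "\<And>x. x \<in> carrier M \<Longrightarrow> \<ominus>\<^bsub>M\<^esub> x \<oplus>\<^bsub>M\<^esub> x = \<zero>\<^bsub>M\<^esub>"
    and module_minus_self [simp]: "\<And>x. x \<in> carrier M \<Longrightarrow> x \<ominus>\<^bsub>M\<^esub> x = \<zero>\<^bsub>M\<^esub>"
    and module_minus_zero [simp]: "\<And>x. x \<in> carrier M \<Longrightarrow> x \<ominus>\<^bsub>M\<^esub> \<zero>\<^bsub>M\<^esub> = x"
    and module_minus_eq_zero:
      "\<And>x y. x \<in> carrier M \<Longrightarrow> y \<in> carrier M \<Longrightarrow> x \<ominus>\<^bsub>M\<^esub> y = \<zero>\<^bsub>M\<^esub> \<longleftrightarrow> x = y"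
    and module_add_minus [simp]:
      "\<And>x y. x \<in> carrier M \<Longrightarrow> y \<in> carrier M \<Longrightarrow> y \<oplus>\<^bsub>M\<^esub> (x \<ominus>\<^bsub>M\<^esub> y) = x"
    and module_minus_add [simp]:
      "\<And>x y. x \<in> carrier M \<Longrightarrow> y \<in> carrier M \<Longrightarrow> (x \<ominus>\<^bsub>M\<^esub> y) \<oplus>\<^bsub>M\<^esub> y = x"
    and module_assoc:
      "\<And>x y z. x \<in> carrier M \<Longrightarrow> y \<in> carrier M \<Longrightarrow> z \<in> carrier M \<Longrightarrow>
        (x \<oplus>\<^bsub>M\<^esub> y) \<oplus>\<^bsub>M\<^esub> z = x \<oplus>\<^bsub>M\<^esub> (y \<oplus>\<^bsub>M\<^esub> z)"
    and module_comm: "\<And>x y. x \<in> carrier M \<Longrightarrow> y \<in> carrier M \<Longrightarrow> x \<oplus>\<^bsub>M\<^esub> y = y \<oplus>\<^bsub>M\<^esub> x"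
    and module_left_comm:
      "\<And>x y z. x \<in> carrier M \<Longrightarrow> y \<in> carrier M \<Longrightarrow> z \<in> carrier M \<Longrightarrow>
        x \<oplus>\<^bsub>M\<^esub> (y \<oplus>\<^bsub>M\<^esub> z) = y \<oplus>\<^bsub>M\<^esub> (x \<oplus>\<^bsub>M\<^esub> z)"
    and module_smult_add:
      "\<And>r x y. r \<in> carrier R \<Longrightarrow> x \<in> carrier M \<Longrightarrow> y \<in> carrier M \<Longrightarrow>
        r \<odot>\<^bsub>M\<^esub> (x \<oplus>\<^bsub>M\<^esub> y) = r \<odot>\<^bsub>M\<^esub> x \<oplus>\<^bsub>M\<^esub> r \<odot>\<^bsub>M\<^esub> y"
    and module_add_smult:
      "\<And>r s x. r \<in> carrier R \<Longrightarrow> s \<in> carrier R \<Longrightarrow> x \<in> carrier M \<Longrightarrow>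
        (r \<oplus> s) \<odot>\<^bsub>M\<^esub> x = r \<odot>\<^bsub>M\<^esub> x \<oplus>\<^bsub>M\<^esub> s \<odot>\<^bsub>M\<^esub> x"
    and module_mult_smult:
      "\<And>r s x. r \<in> carrier R \<Longrightarrow> s \<in> carrier R \<Longrightarrow> x \<in> carrier M \<Longrightarrow>
        (r \<otimes> s) \<odot>\<^bsub>M\<^esub> x = r \<odot>\<^bsub>M\<^esub> (s \<odot>\<^bsub>M\<^esub> x)"
    and module_neg_eq_smult: "\<And>x. x \<in> carrier M \<Longrightarrow> \<ominus>\<^bsub>M\<^esub> x = (\<ominus> \<one>) \<odot>\<^bsub>M\<^esub> x"
    and module_minus_eq_smult:
      "\<And>x y. x \<in> carrier M \<Longrightarrow> y \<in> carrier M \<Longrightarrow> x \<ominus>\<^bsub>M\<^esub> y = x \<oplus>\<^bsub>M\<^esub> (\<ominus> \<one>) \<odot>\<^bsub>M\<^esub> y"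
proof -
  interpret M: module R M by fact
  show "\<And>x. x \<in> carrier M \<Longrightarrow> \<ominus>\<^bsub>M\<^esub> x = (\<ominus> \<one>) \<odot>\<^bsub>M\<^esub> x"
    by (simp add: M.smult_l_minus)
  then show "\<And>x y. x \<in> carrier M \<Longrightarrow> y \<in> carrier M \<Longrightarrow> x \<ominus>\<^bsub>M\<^esub> y = x \<oplus>\<^bsub>M\<^esub> (\<ominus> \<one>) \<odot>\<^bsub>M\<^esub> y"
    by (simp add: a_minus_def)
  show "\<And>x y. x \<in> carrier M \<Longrightarrow> y \<in> carrier M \<Longrightarrow> y \<oplus>\<^bsub>M\<^esub> (x \<ominus>\<^bsub>M\<^esub> y) = x"
    by (simp add: a_minus_def M.M.a_lcomm M.M.r_neg)
  show "\<And>x y. x \<in> carrier M \<Longrightarrow> y \<in> carrier M \<Longrightarrow> (x \<ominus>\<^bsub>M\<^esub> y) \<oplus>\<^bsub>M\<^esub> y = x"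
    by (simp add: a_minus_def M.M.a_assoc M.M.l_neg)
  then show "\<And>x y. x \<in> carrier M \<Longrightarrow> y \<in> carrier M \<Longrightarrow> x \<ominus>\<^bsub>M\<^esub> y = \<zero>\<^bsub>M\<^esub> \<longleftrightarrow> x = y"
    by (metis M.M.l_zero M.M.r_neg a_minus_def)
qed (use assms in \<open>simp_all add: module.axioms abelian_group.axioms a_minus_def
    abelian_monoid.a_assoc[OF module_abelian_monoid] abelian_monoid.a_comm[OF module_abelian_monoid]
    abelian_monoid.a_lcomm[OF module_abelian_monoid] abelian_monoid.a_closed[OF module_abelian_monoid]
    abelian_monoid.zero_closed[OF module_abelian_monoid]  abelian_monoid.l_zero[OF module_abelian_monoid]
    abelian_monoid.r_zero[OF module_abelian_monoid] abelian_group.a_inv_closed[OF module_abelian_group]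
    abelian_group.l_neg[OF module_abelian_group] abelian_group.r_neg[OF module_abelian_group]
    module.smult_closed module.smult_one module.smult_l_null module.smult_r_null abelian_group.minus_minus
    module.smult_r_distr module.smult_l_distr module.smult_assoc1 module_neg_zero\<close>)

lemmas module_ac = module_assoc module_comm module_left_comm

lemma module_minus_cancel:
  assumes "module R M" "x \<in> carrier M" "y \<in> carrier M" "z \<in> carrier M"
  shows "(x \<oplus>\<^bsub>M\<^esub> y) \<ominus>\<^bsub>M\<^esub> z = x \<oplus>\<^bsub>M\<^esub> (y \<ominus>\<^bsub>M\<^esub> z)"
  using assms by (simp add: a_minus_def module_assoc)

lemma mod_homI:
  assumes "\<And>x. x \<in> carrier M \<Longrightarrow> f x \<in> carrier N"
    and "\<And>x y. x \<in> carrier M \<Longrightarrow> y \<in> carrier M \<Longrightarrow> f (x \<oplus>\<^bsub>M\<^esub> y) = f x \<oplus>\<^bsub>N\<^esub> f y"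
    and "\<And>r x. r \<in> carrier R \<Longrightarrow> x \<in> carrier M \<Longrightarrow> f (r \<odot>\<^bsub>M\<^esub> x) = r \<odot>\<^bsub>N\<^esub> f x"
  shows "f \<in> mod_hom R M N"
  using assms unfolding mod_hom_def by auto

lemma
  assumes "f \<in> mod_hom R M N"
  shows mod_hom_closed: "\<And>x. x \<in> carrier M \<Longrightarrow> f x \<in> carrier N"
    and mod_hom_add: "\<And>x y. x \<in> carrier M \<Longrightarrow> y \<in> carrier M \<Longrightarrow> f (x \<oplus>\<^bsub>M\<^esub> y) = f x \<oplus>\<^bsub>N\<^esub> f y"
    and mod_hom_smult: "\<And>r x. r \<in> carrier R \<Longrightarrow> x \<in> carrier M \<Longrightarrow> f (r \<odot>\<^bsub>M\<^esub> x) = r \<odot>\<^bsub>N\<^esub> f x"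
  using assms unfolding mod_hom_def by auto

lemma mod_hom_zero:
  assumes "f \<in> mod_hom R M N" "module R M" "module R N"
  shows "f \<zero>\<^bsub>M\<^esub> = \<zero>\<^bsub>N\<^esub>"
proof -
  have "f (\<zero> \<odot>\<^bsub>M\<^esub> \<zero>\<^bsub>M\<^esub>) = \<zero> \<odot>\<^bsub>N\<^esub> f \<zero>\<^bsub>M\<^esub>"
    using assms by (intro mod_hom_smult) auto
  with assms show ?thesis by (simp add: mod_hom_closed)
qed

lemma mod_hom_neg:
  assumes "f \<in> mod_hom R M N" "module R M" "module R N" "x \<in> carrier M"
  shows "f (\<ominus>\<^bsub>M\<^esub> x) = \<ominus>\<^bsub>N\<^esub> f x"
  using assms by (simp add: module_neg_eq_smult mod_hom_smult[OF assms(1)] mod_hom_closed[OF assms(1)])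

lemma mod_hom_minus:
  assumes "f \<in> mod_hom R M N" "module R M" "module R N" "x \<in> carrier M" "y \<in> carrier M"
  shows "f (x \<ominus>\<^bsub>M\<^esub> y) = f x \<ominus>\<^bsub>N\<^esub> f y"
  using assms by (simp add: a_minus_def mod_hom_add[OF assms(1)] mod_hom_neg)

lemma mod_hom_cong:
  assumes "f \<in> mod_hom R M N" "module R M" "\<And>x. x \<in> carrier M \<Longrightarrow> g x = f x"
  shows "g \<in> mod_hom R M N"
  by (rule mod_homI) (use assms in \<open>simp_all add: mod_hom_closed mod_hom_add mod_hom_smult\<close>)

lemma mod_hom_comp:
  assumes "f \<in> mod_hom R L M" "g \<in> mod_hom R M N"
  shows "(\<lambda>x. g (f x)) \<in> mod_hom R L N"
  by (rule mod_homI)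
    (simp_all add: mod_hom_closed[OF assms(1)] mod_hom_closed[OF assms(2)]
      mod_hom_add[OF assms(1)] mod_hom_add[OF assms(2)]
      mod_hom_smult[OF assms(1)] mod_hom_smult[OF assms(2)])

lemma mod_hom_id: "(\<lambda>x. x) \<in> mod_hom R M M"
  by (rule mod_homI) simp_all

lemma mod_hom_const_zero: "module R N \<Longrightarrow> (\<lambda>x. \<zero>\<^bsub>N\<^esub>) \<in> mod_hom R M N"
  by (rule mod_homI) simp_all

lemma mod_hom_plus:
  assumes "f \<in> mod_hom R M N" "g \<in> mod_hom R M N" "module R N"
  shows "(\<lambda>x. f x \<oplus>\<^bsub>N\<^esub> g x) \<in> mod_hom R M N"
  by (rule mod_homI)
    (use assms in \<open>simp_all add: mod_hom_closed[OF assms(1)] mod_hom_closed[OF assms(2)]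
      mod_hom_add[OF assms(1)] mod_hom_add[OF assms(2)] module_smult_add
      mod_hom_smult[OF assms(1)] mod_hom_smult[OF assms(2)] module_ac[of N]\<close>)

lemma mod_hom_scale:
  assumes "f \<in> mod_hom R M N" "r \<in> carrier R" "module R N"
  shows "(\<lambda>x. r \<odot>\<^bsub>N\<^esub> f x) \<in> mod_hom R M N"
  by (rule mod_homI)
    (use assms in \<open>simp_all add: mod_hom_closed[OF assms(1)] mod_hom_add[OF assms(1)]
      module_smult_add mod_hom_smult[OF assms(1)] module_mult_smult[symmetric] m_comm\<close>)

lemma mod_hom_diff:
  assumes "f \<in> mod_hom R M N" "g \<in> mod_hom R M N" "module R M" "module R N"
  shows "(\<lambda>x. f x \<ominus>\<^bsub>N\<^esub> g x) \<in> mod_hom R M N"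
  by (rule mod_hom_cong[OF mod_hom_plus[OF assms(1) mod_hom_scale[OF assms(2), of "\<ominus> \<one>"]]])
    (use assms in \<open>simp_all add: module_minus_eq_smult mod_hom_closed[OF assms(1)] mod_hom_closed[OF assms(2)]\<close>)

text \<open>A submodule is the ambient module with its carrier replaced and the same operations;
  these rules move the source or target of a homomorphism across such a replacement.\<close>

lemma mod_hom_carrier_update:
  "f \<in> mod_hom R M N \<Longrightarrow> f ` carrier M \<subseteq> S \<Longrightarrow> f \<in> mod_hom R M (N\<lparr>carrier := S\<rparr>)"
  unfolding mod_hom_def by auto

lemma mod_hom_restrict_carrier:
  "f \<in> mod_hom R M N \<Longrightarrow> S \<subseteq> carrier M \<Longrightarrow> f \<in> mod_hom R (M\<lparr>carrier := S\<rparr>) N"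
  unfolding mod_hom_def by (auto simp: subset_eq)

lemma mod_hom_carrier_updateD:
  "f \<in> mod_hom R M (N\<lparr>carrier := S\<rparr>) \<Longrightarrow> S \<subseteq> carrier N \<Longrightarrow> f \<in> mod_hom R M N"
  unfolding mod_hom_def by auto

section \<open>Submodules and transport of module structures\<close>

lemma submodule_intro:
  assumes "module R M" "S \<subseteq> carrier M" "\<zero>\<^bsub>M\<^esub> \<in> S"
    and "\<And>x y. x \<in> S \<Longrightarrow> y \<in> S \<Longrightarrow> x \<oplus>\<^bsub>M\<^esub> y \<in> S"
    and "\<And>r x. r \<in> carrier R \<Longrightarrow> x \<in> S \<Longrightarrow> r \<odot>\<^bsub>M\<^esub> x \<in> S"
  shows "submodule S R M"
  by (rule module.submoduleI) (use assms in \<open>auto simp: module_neg_eq_smult subset_eq\<close>)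

lemma
  assumes "submodule S R M" "module R M"
  shows submodule_subset: "S \<subseteq> carrier M"
    and submodule_zero: "\<zero>\<^bsub>M\<^esub> \<in> S"
    and submodule_add: "\<And>x y. x \<in> S \<Longrightarrow> y \<in> S \<Longrightarrow> x \<oplus>\<^bsub>M\<^esub> y \<in> S"
    and submodule_smult: "\<And>r x. r \<in> carrier R \<Longrightarrow> x \<in> S \<Longrightarrow> r \<odot>\<^bsub>M\<^esub> x \<in> S"
    and submodule_minus: "\<And>x y. x \<in> S \<Longrightarrow> y \<in> S \<Longrightarrow> x \<ominus>\<^bsub>M\<^esub> y \<in> S"
    and submodule_module: "module R (M\<lparr>carrier := S\<rparr>)"
proof -
  interpret S: submodule S R M by fact
  note E = module.submoduleE[OF assms(2,1)]
  show "S \<subseteq> carrier M" "\<zero>\<^bsub>M\<^esub> \<in> S" using E(1) S.one_closed by auto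
  show "\<And>x y. x \<in> S \<Longrightarrow> y \<in> S \<Longrightarrow> x \<oplus>\<^bsub>M\<^esub> y \<in> S"
    "\<And>r x. r \<in> carrier R \<Longrightarrow> x \<in> S \<Longrightarrow> r \<odot>\<^bsub>M\<^esub> x \<in> S"
    "\<And>x y. x \<in> S \<Longrightarrow> y \<in> S \<Longrightarrow> x \<ominus>\<^bsub>M\<^esub> y \<in> S"
    using E by (auto simp: a_minus_def)
  show "module R (M\<lparr>carrier := S\<rparr>)" by (rule S.submodule_is_module[OF assms(2)])
qed

lemma a_kernel_iff: "x \<in> a_kernel M N f \<longleftrightarrow> x \<in> carrier M \<and> f x = \<zero>\<^bsub>N\<^esub>"
  by (simp add: a_kernel_def')

lemma submodule_kernel:
  assumes "f \<in> mod_hom R M N" "module R M" "module R N"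
  shows "submodule (a_kernel M N f) R M"
  by (rule submodule_intro)
    (use assms in \<open>auto simp: a_kernel_iff mod_hom_zero mod_hom_add mod_hom_smult\<close>)

lemma submodule_image:
  assumes "f \<in> mod_hom R M N" "module R M" "module R N"
  shows "submodule (f ` carrier M) R N"
proof (rule submodule_intro)
  show "f ` carrier M \<subseteq> carrier N" using mod_hom_closed[OF assms(1)] by auto
  show "\<zero>\<^bsub>N\<^esub> \<in> f ` carrier M" using mod_hom_zero[OF assms] assms(2) by (metis imageI module_zero_closed)
  fix x y r assume "x \<in> f ` carrier M"
  then obtain a where a: "a \<in> carrier M" "x = f a" by auto
  show "r \<in> carrier R \<Longrightarrow> r \<odot>\<^bsub>N\<^esub> x \<in> f ` carrier M"
    using a assms by (metis imageI module_smult_closed mod_hom_smult)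
  assume "y \<in> f ` carrier M"
  then obtain b where "b \<in> carrier M" "y = f b" by auto
  then show "x \<oplus>\<^bsub>N\<^esub> y \<in> f ` carrier M"
    using a assms by (metis imageI module_add_closed mod_hom_add)
qed fact

text \<open>All axioms are checked on representatives in \<open>B\<close>. Preservation of zero is a
  separate hypothesis because it follows from additivity only once \<open>Q\<close> is known to be a
  group.\<close>

lemma module_surj_image:
  assumes B: "module R B" and surj: "p ` carrier B = carrier Q"
    and add: "\<And>x y. x \<in> carrier B \<Longrightarrow> y \<in> carrier B \<Longrightarrow> p (x \<oplus>\<^bsub>B\<^esub> y) = p x \<oplus>\<^bsub>Q\<^esub> p y"
    and smult: "\<And>r x. r \<in> carrier R \<Longrightarrow> x \<in> carrier B \<Longrightarrow> p (r \<odot>\<^bsub>B\<^esub> x) = r \<odot>\<^bsub>Q\<^esub> p x"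
    and zero: "p \<zero>\<^bsub>B\<^esub> = \<zero>\<^bsub>Q\<^esub>"
  shows "module R Q"
proof (rule moduleI)
  have rep: "\<exists>x\<in>carrier B. p x = y" if "y \<in> carrier Q" for y
    using surj that by (metis imageE)
  have cl: "p x \<in> carrier Q" if "x \<in> carrier B" for x using surj that by auto
  show "abelian_group Q"
  proof (rule abelian_groupI)
    show "\<zero>\<^bsub>Q\<^esub> \<in> carrier Q" using module_zero_closed[OF B] cl zero by metis
    fix x assume "x \<in> carrier Q"
    then obtain a where a: "a \<in> carrier B" "p a = x" using rep by blast
    show "\<zero>\<^bsub>Q\<^esub> \<oplus>\<^bsub>Q\<^esub> x = x" using a B add[of "\<zero>\<^bsub>B\<^esub>" a] zero by simp
    show "\<exists>y\<in>carrier Q. y \<oplus>\<^bsub>Q\<^esub> x = \<zero>\<^bsub>Q\<^esub>"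
      using a B add[of "\<ominus>\<^bsub>B\<^esub> a" a] zero cl by (metis module_neg_add module_neg_closed)
    fix y assume "y \<in> carrier Q"
    then obtain b where b: "b \<in> carrier B" "p b = y" using rep by blast
    show "x \<oplus>\<^bsub>Q\<^esub> y \<in> carrier Q" using a b add B cl by (metis module_add_closed)
    show "x \<oplus>\<^bsub>Q\<^esub> y = y \<oplus>\<^bsub>Q\<^esub> x" using a b add B by (metis module_comm)
    fix z assume "z \<in> carrier Q"
    then obtain c where c: "c \<in> carrier B" "p c = z" using rep by blast
    show "x \<oplus>\<^bsub>Q\<^esub> y \<oplus>\<^bsub>Q\<^esub> z = x \<oplus>\<^bsub>Q\<^esub> (y \<oplus>\<^bsub>Q\<^esub> z)"
      using a b c B add[of a b] add[of "a \<oplus>\<^bsub>B\<^esub> b" c] add[of b c] add[of a "b \<oplus>\<^bsub>B\<^esub> c"]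
      by (simp add: module_assoc)
  qed
  fix r s x y assume "r \<in> carrier R"
  note r = this
  assume "x \<in> carrier Q"
  then obtain a where a: "a \<in> carrier B" "p a = x" using rep by blast
  show "r \<odot>\<^bsub>Q\<^esub> x \<in> carrier Q" using a r B smult cl by (metis module_smult_closed)
  show "(r \<oplus> s) \<odot>\<^bsub>Q\<^esub> x = r \<odot>\<^bsub>Q\<^esub> x \<oplus>\<^bsub>Q\<^esub> s \<odot>\<^bsub>Q\<^esub> x" if "s \<in> carrier R"
    using a r that B smult[of r a] smult[of s a] smult[of "r \<oplus> s" a] add[of "r \<odot>\<^bsub>B\<^esub> a" "s \<odot>\<^bsub>B\<^esub> a"]
    by (simp add: module_add_smult)
  show "(r \<otimes> s) \<odot>\<^bsub>Q\<^esub> x = r \<odot>\<^bsub>Q\<^esub> (s \<odot>\<^bsub>Q\<^esub> x)" if "s \<in> carrier R"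
    using a r that B smult[of "r \<otimes> s" a] smult[of s a] smult[of r "s \<odot>\<^bsub>B\<^esub> a"]
    by (simp add: module_mult_smult)
  assume "y \<in> carrier Q"
  then obtain b where b: "b \<in> carrier B" "p b = y" using rep by blast
  show "r \<odot>\<^bsub>Q\<^esub> (x \<oplus>\<^bsub>Q\<^esub> y) = r \<odot>\<^bsub>Q\<^esub> x \<oplus>\<^bsub>Q\<^esub> r \<odot>\<^bsub>Q\<^esub> y"
    using a b r B add[of a b] smult[of r "a \<oplus>\<^bsub>B\<^esub> b"] smult[of r a] smult[of r b]
      add[of "r \<odot>\<^bsub>B\<^esub> a" "r \<odot>\<^bsub>B\<^esub> b"]
    by (simp add: module_smult_add)
next
  fix x assume "x \<in> carrier Q"
  then obtain a where a: "a \<in> carrier B" "p a = x" using surj by (metis imageE)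
  show "\<one> \<odot>\<^bsub>Q\<^esub> x = x" using a B smult[of \<one> a] by simp
qed (rule cring_axioms)

text \<open>A quotient by the congruence \<open>p x = p y\<close>: compatibility with the operations
  lets them be computed on the representatives that \<open>inv_into\<close> picks.\<close>

lemma ex_module_on_image:
  fixes B :: "('a, 'm) module" and p :: "'m \<Rightarrow> 'q"
  assumes B: "module R B"
    and add: "\<And>x x' y y'. x \<in> carrier B \<Longrightarrow> x' \<in> carrier B \<Longrightarrow> y \<in> carrier B \<Longrightarrow> y' \<in> carrier B
      \<Longrightarrow> p x = p x' \<Longrightarrow> p y = p y' \<Longrightarrow> p (x \<oplus>\<^bsub>B\<^esub> y) = p (x' \<oplus>\<^bsub>B\<^esub> y')"
    and smult: "\<And>r x x'. r \<in> carrier R \<Longrightarrow> x \<in> carrier B \<Longrightarrow> x' \<in> carrier B \<Longrightarrow> p x = p x'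
      \<Longrightarrow> p (r \<odot>\<^bsub>B\<^esub> x) = p (r \<odot>\<^bsub>B\<^esub> x')"
  shows "\<exists>Q :: ('a, 'q) module. module R Q \<and> p \<in> mod_hom R B Q \<and> p ` carrier B = carrier Q"
proof -
  let ?i = "inv_into (carrier B) p"
  define Q :: "('a, 'q) module" where "Q = \<lparr>carrier = p ` carrier B, monoid.mult = undefined,
    one = undefined, ring.zero = p \<zero>\<^bsub>B\<^esub>, add = (\<lambda>u v. p (?i u \<oplus>\<^bsub>B\<^esub> ?i v)),
    smult = (\<lambda>r u. p (r \<odot>\<^bsub>B\<^esub> ?i u))\<rparr>"
  have i: "?i (p x) \<in> carrier B" "p (?i (p x)) = p x" if "x \<in> carrier B" for x
    using that by (auto simp: inv_into_into f_inv_into_f)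
  have 1: "p (x \<oplus>\<^bsub>B\<^esub> y) = p x \<oplus>\<^bsub>Q\<^esub> p y" if "x \<in> carrier B" "y \<in> carrier B" for x y
    using that i by (auto simp: Q_def intro: add)
  have 2: "p (r \<odot>\<^bsub>B\<^esub> x) = r \<odot>\<^bsub>Q\<^esub> p x" if "r \<in> carrier R" "x \<in> carrier B" for r x
    using that i by (auto simp: Q_def intro: smult)
  have "module R Q"
    by (rule module_surj_image[OF B, where p = p]) (auto simp: 1 2, auto simp: Q_def)
  moreover have "p \<in> mod_hom R B Q" by (rule mod_homI) (auto simp: 1 2, auto simp: Q_def)
  ultimately show ?thesis by (auto simp: Q_def)
qed

text \<open>An arbitrary injection of sets carries the structure along; this is how modules are
  moved into the universe.\<close>

lemma ex_module_copy:
  fixes B :: "('a, 'm) module" and p :: "'m \<Rightarrow> 'q"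
  assumes "module R B" "inj_on p (carrier B)"
  shows "\<exists>Q :: ('a, 'q) module. module R Q \<and> p \<in> mod_hom R B Q \<and> p ` carrier B = carrier Q"
  by (rule ex_module_on_image) (use assms inj_onD[OF assms(2)] in metis)+

section \<open>The regular module and Hom modules\<close>

lemma module_regular: "module R (regular_module R)"
proof (rule moduleI)
  show "abelian_group (regular_module R)"
    by (rule abelian_groupI) (auto simp: regular_module_def a_ac intro!: bexI[of _ "\<ominus> _"] l_neg)
qed (auto simp: regular_module_def l_distr r_distr m_assoc cring_axioms)

lemma regular_simps [simp]:
  "carrier (regular_module R) = carrier R" "\<zero>\<^bsub>regular_module R\<^esub> = \<zero>"
  "x \<oplus>\<^bsub>regular_module R\<^esub> y = x \<oplus> y" "r \<odot>\<^bsub>regular_module R\<^esub> x = r \<otimes> x"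
  by (simp_all add: regular_module_def)

lemma hom_module_simps [simp]:
  "carrier (hom_module R M N) = mod_hom R M N \<inter> extensional (carrier M)"
  "\<zero>\<^bsub>hom_module R M N\<^esub> = (\<lambda>x\<in>carrier M. \<zero>\<^bsub>N\<^esub>)"
  "f \<oplus>\<^bsub>hom_module R M N\<^esub> g = (\<lambda>x\<in>carrier M. f x \<oplus>\<^bsub>N\<^esub> g x)"
  "r \<odot>\<^bsub>hom_module R M N\<^esub> f = (\<lambda>x\<in>carrier M. r \<odot>\<^bsub>N\<^esub> f x)"
  by (simp_all add: hom_module_def)

lemma mod_hom_restrict:
  assumes "f \<in> mod_hom R M N" "module R M"
  shows "restrict f (carrier M) \<in> mod_hom R M N"
  by (rule mod_hom_cong[OF assms]) simp

lemma module_hom_module: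
  assumes "module R M" "module R N"
  shows "module R (hom_module R M N)"
proof (rule moduleI)
  note cl = mod_hom_restrict[OF _ assms(1)]
  note ext = extensionalityI[where A = "carrier M"]
  show "abelian_group (hom_module R M N)"
  proof (rule abelian_groupI)
    fix f assume f: "f \<in> carrier (hom_module R M N)"
    then show "\<exists>g\<in>carrier (hom_module R M N). g \<oplus>\<^bsub>hom_module R M N\<^esub> f = \<zero>\<^bsub>hom_module R M N\<^esub>"
      using assms mod_hom_scale[of f M N "\<ominus> \<one>"]
      by (intro bexI[of _ "\<lambda>x\<in>carrier M. (\<ominus> \<one>) \<odot>\<^bsub>N\<^esub> f x"])
        (auto intro!: ext cl simp: module_neg_eq_smult[symmetric] mod_hom_closed)
  qed (use assms in \<open>auto intro!: ext cl mod_hom_plus mod_hom_const_zero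
      simp: mod_hom_closed module_assoc, auto intro!: ext simp: mod_hom_closed module_comm[of N]\<close>)
qed (use assms in \<open>auto intro!: extensionalityI[where A = "carrier M"] mod_hom_restrict mod_hom_scale cring_axioms
   simp: mod_hom_closed module_smult_add module_add_smult module_mult_smult\<close>)

section \<open>Short exact sequences and quotients\<close>

definition ses where
  "ses A i B p C \<longleftrightarrow> module R A \<and> module R B \<and> module R C \<and> short_exact R A i B p C"

lemma
  assumes "ses A i B p C"
  shows ses_modules: "module R A" "module R B" "module R C"
    and ses_homs: "i \<in> mod_hom R A B" "p \<in> mod_hom R B C"
    and ses_inj: "inj_on i (carrier A)"
    and ses_comp: "\<And>a. a \<in> carrier A \<Longrightarrow> p (i a) = \<zero>\<^bsub>C\<^esub>"
    and ses_exact: "\<And>b. b \<in> carrier B \<Longrightarrow> p b = \<zero>\<^bsub>C\<^esub> \<Longrightarrow> \<exists>a\<in>carrier A. i a = b"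
    and ses_surj: "\<And>c. c \<in> carrier C \<Longrightarrow> \<exists>b\<in>carrier B. p b = c"
proof -
  have s: "short_exact R A i B p C" and m: "module R A" "module R B" "module R C"
    using assms by (auto simp: ses_def)
  then have ker: "i ` carrier A = a_kernel B C p" and im: "p ` carrier B = carrier C"
    by (auto simp: short_exact_def)
  show "module R A" "module R B" "module R C" by (fact m)+
  show "i \<in> mod_hom R A B" "p \<in> mod_hom R B C" "inj_on i (carrier A)"
    using s by (auto simp: short_exact_def)
  show "p (i a) = \<zero>\<^bsub>C\<^esub>" if "a \<in> carrier A" for a
  proof -
    have "i a \<in> a_kernel B C p" unfolding ker[symmetric] using that by simp
    then show ?thesis by (simp add: a_kernel_iff)
  qed
  show "\<exists>a\<in>carrier A. i a = b" if "b \<in> carrier B" "p b = \<zero>\<^bsub>C\<^esub>" for b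
  proof -
    have "b \<in> i ` carrier A" unfolding ker using that by (simp add: a_kernel_iff)
    then show ?thesis by auto
  qed
  show "\<And>c. c \<in> carrier C \<Longrightarrow> \<exists>b\<in>carrier B. p b = c" using im by (metis imageE)
qed

lemma sesI:
  assumes "module R A" "module R B" "module R C" "i \<in> mod_hom R A B" "p \<in> mod_hom R B C"
    and "\<And>a. a \<in> carrier A \<Longrightarrow> i a = \<zero>\<^bsub>B\<^esub> \<Longrightarrow> a = \<zero>\<^bsub>A\<^esub>"
    and "\<And>a. a \<in> carrier A \<Longrightarrow> p (i a) = \<zero>\<^bsub>C\<^esub>"
    and "\<And>b. b \<in> carrier B \<Longrightarrow> p b = \<zero>\<^bsub>C\<^esub> \<Longrightarrow> \<exists>a\<in>carrier A. i a = b"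
    and "\<And>c. c \<in> carrier C \<Longrightarrow> \<exists>b\<in>carrier B. p b = c"
  shows "ses A i B p C"
proof -
  have "inj_on i (carrier A)"
  proof (rule inj_onI)
    fix x y assume xy: "x \<in> carrier A" "y \<in> carrier A" "i x = i y"
    then have "i (x \<ominus>\<^bsub>A\<^esub> y) = \<zero>\<^bsub>B\<^esub>"
      using assms(1,2,4) by (simp add: mod_hom_minus mod_hom_closed)
    then show "x = y" using assms(6)[of "x \<ominus>\<^bsub>A\<^esub> y"] assms(1) xy by (simp add: module_minus_eq_zero)
  qed
  moreover have "i ` carrier A = a_kernel B C p"
    using assms(8) mod_hom_closed[OF assms(4)] assms(7) by (force simp: a_kernel_iff)
  moreover have "p ` carrier B = carrier C"
    using assms(9) mod_hom_closed[OF assms(5)] by force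
  ultimately show ?thesis using assms(1-5) by (simp add: ses_def short_exact_def)
qed

lemma ses_kernel:
  assumes "module R B" "module R C" "p \<in> mod_hom R B C" "p ` carrier B = carrier C"
  shows "ses (B\<lparr>carrier := a_kernel B C p\<rparr>) (\<lambda>x. x) B p C"
proof (intro sesI assms(1-3))
  show "\<exists>b\<in>carrier B. p b = c" if "c \<in> carrier C" for c using assms(4) that by (metis imageE)
qed (use submodule_module[OF submodule_kernel[OF assms(3,1,2)] assms(1)]
    in \<open>auto simp: a_kernel_iff intro!: mod_homI\<close>)

text \<open>The quotient is realised on chosen representatives instead of cosets, so it stays in the
  type, and inside the carrier, of \<open>B\<close>. This keeps cosyzygies in the universe, cyclic
  modules on the type of the ring, and the divisible hull on finitely supported functions.\<close>

lemma ses_submodule: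
  fixes B :: "('a, 'm) module"
  assumes B: "module R B" and S: "submodule S R B"
  shows "\<exists>p (Q :: ('a, 'm) module). carrier Q \<subseteq> carrier B \<and> ses (B\<lparr>carrier := S\<rparr>) (\<lambda>x. x) B p Q"
proof -
  define E where "E x = {y \<in> carrier B. y \<ominus>\<^bsub>B\<^esub> x \<in> S}" for x
  \<comment> \<open>The choice depends on \<open>x\<close> only through its class
    \<open>E x\<close>, so equal classes get equal representatives.\<close>
  define p where "p x = (SOME y. y \<in> E x)" for x
  have diff: "(x \<ominus>\<^bsub>B\<^esub> y) \<oplus>\<^bsub>B\<^esub> (y \<ominus>\<^bsub>B\<^esub> z) = x \<ominus>\<^bsub>B\<^esub> z"
    if "x \<in> carrier B" "y \<in> carrier B" "z \<in> carrier B" for x y z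
    using that B by (simp add: module_minus_cancel[symmetric])
  have neg: "\<zero>\<^bsub>B\<^esub> \<ominus>\<^bsub>B\<^esub> (x \<ominus>\<^bsub>B\<^esub> y) = y \<ominus>\<^bsub>B\<^esub> x" if "x \<in> carrier B" "y \<in> carrier B" for x y
    using that B by (simp add: module_minus_eq_smult module_smult_add module_mult_smult[symmetric] l_minus module_comm)
  have eqE: "E x = E y" if "x \<in> carrier B" "y \<in> carrier B" "x \<ominus>\<^bsub>B\<^esub> y \<in> S" for x y
  proof -
    have "y \<ominus>\<^bsub>B\<^esub> x \<in> S" using neg[of x y] that submodule_minus[OF S B] submodule_zero[OF S B] by metis
    then show ?thesis unfolding E_def
      using diff that submodule_add[OF S B] by (metis (no_types, lifting))
  qed
  have pE: "p x \<in> E x" if "x \<in> carrier B" for x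
  proof -
    have "x \<in> E x" using that B submodule_zero[OF S B] by (simp add: E_def)
    then show ?thesis unfolding p_def by (rule someI)
  qed
  have p_eq: "p x = p y \<longleftrightarrow> x \<ominus>\<^bsub>B\<^esub> y \<in> S" if xy: "x \<in> carrier B" "y \<in> carrier B" for x y
  proof
    assume "p x = p y"
    then have "p x \<in> carrier B" "p x \<ominus>\<^bsub>B\<^esub> x \<in> S" "p x \<ominus>\<^bsub>B\<^esub> y \<in> S"
      using pE[of x] pE[of y] xy by (auto simp: E_def)
    then show "x \<ominus>\<^bsub>B\<^esub> y \<in> S"
      using diff[of x "p x" y] neg[of "p x" x] xy submodule_minus[OF S B] submodule_zero[OF S B]
        submodule_add[OF S B] by metis
  next
    assume "x \<ominus>\<^bsub>B\<^esub> y \<in> S"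
    then show "p x = p y" using eqE[OF xy] by (simp add: p_def)
  qed
  have "\<exists>Q :: ('a, 'm) module. module R Q \<and> p \<in> mod_hom R B Q \<and> p ` carrier B = carrier Q"
  proof (rule ex_module_on_image[OF B])
    fix x x' y y' assume a: "x \<in> carrier B" "x' \<in> carrier B" "y \<in> carrier B" "y' \<in> carrier B"
      "p x = p x'" "p y = p y'"
    have "(x \<oplus>\<^bsub>B\<^esub> y) \<ominus>\<^bsub>B\<^esub> (x' \<oplus>\<^bsub>B\<^esub> y') = (x \<ominus>\<^bsub>B\<^esub> x') \<oplus>\<^bsub>B\<^esub> (y \<ominus>\<^bsub>B\<^esub> y')"
      using a(1-4) B by (simp add: module_minus_eq_smult module_smult_add module_ac)
    then show "p (x \<oplus>\<^bsub>B\<^esub> y) = p (x' \<oplus>\<^bsub>B\<^esub> y')"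
      using a B p_eq submodule_add[OF S B] by simp
  next
    fix r x x' assume a: "r \<in> carrier R" "x \<in> carrier B" "x' \<in> carrier B" "p x = p x'"
    have "r \<odot>\<^bsub>B\<^esub> x \<ominus>\<^bsub>B\<^esub> r \<odot>\<^bsub>B\<^esub> x' = r \<odot>\<^bsub>B\<^esub> (x \<ominus>\<^bsub>B\<^esub> x')"
      using a(1-3) B by (simp add: module_minus_eq_smult module_smult_add module_mult_smult[symmetric] m_comm)
    then show "p (r \<odot>\<^bsub>B\<^esub> x) = p (r \<odot>\<^bsub>B\<^esub> x')"
      using a B p_eq submodule_smult[OF S B] by simp
  qed
  then obtain Q :: "('a, 'm) module" where Q: "module R Q" "p \<in> mod_hom R B Q" "p ` carrier B = carrier Q"
    by blast
  have ker: "p x = \<zero>\<^bsub>Q\<^esub> \<longleftrightarrow> x \<in> S" if "x \<in> carrier B" for x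
    using p_eq[of x "\<zero>\<^bsub>B\<^esub>"] that B mod_hom_zero[OF Q(2) B Q(1)] by simp
  have "ses (B\<lparr>carrier := S\<rparr>) (\<lambda>x. x) B p Q"
  proof (intro sesI)
    show "\<exists>b\<in>carrier B. p b = c" if "c \<in> carrier Q" for c using Q(3) that by (metis imageE)
  qed (use submodule_subset[OF S B] ker submodule_module[OF S B] B Q(1,2)
        in \<open>auto intro!: mod_homI\<close>)
  moreover have "carrier Q \<subseteq> carrier B"
    using pE unfolding Q(3)[symmetric] by (auto simp: E_def)
  ultimately show ?thesis by blast
qed

lemma ses_descend:
  assumes s: "ses A i B p C" and h: "h \<in> mod_hom R B L" and L: "module R L"
    and van: "\<And>a. a \<in> carrier A \<Longrightarrow> h (i a) = \<zero>\<^bsub>L\<^esub>"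
  shows "\<exists>h'\<in>mod_hom R C L. \<forall>b\<in>carrier B. h' (p b) = h b"
proof -
  note m = ses_modules[OF s] and ip = ses_homs[OF s]
  have wd: "h b = h b'" if bb: "b \<in> carrier B" "b' \<in> carrier B" "p b = p b'" for b b'
  proof -
    have "p (b \<ominus>\<^bsub>B\<^esub> b') = \<zero>\<^bsub>C\<^esub>"
      using that m by (simp add: mod_hom_minus[OF ip(2)] mod_hom_closed[OF ip(2)])
    then obtain a where "a \<in> carrier A" "i a = b \<ominus>\<^bsub>B\<^esub> b'"
      using ses_exact[OF s, of "b \<ominus>\<^bsub>B\<^esub> b'"] bb m by auto
    then have "h (b \<ominus>\<^bsub>B\<^esub> b') = \<zero>\<^bsub>L\<^esub>" using van by metis
    then show ?thesis
      using that m L by (simp add: mod_hom_minus[OF h] mod_hom_closed[OF h] module_minus_eq_zero)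
  qed
  \<comment> \<open>Preimages are picked arbitrarily; by \<open>wd\<close> the value of
    \<open>h\<close> does not depend on the pick, which makes the induced map linear.\<close>
  define q where "q c = (SOME b. b \<in> carrier B \<and> p b = c)" for c
  have q: "q c \<in> carrier B" "p (q c) = c" if "c \<in> carrier C" for c
    using someI_ex[of "\<lambda>b. b \<in> carrier B \<and> p b = c"] ses_surj[OF s that] unfolding q_def by blast+
  have "(\<lambda>c. h (q c)) \<in> mod_hom R C L"
  proof (rule mod_homI)
    fix x y assume xy: "x \<in> carrier C" "y \<in> carrier C"
    have "h (q (x \<oplus>\<^bsub>C\<^esub> y)) = h (q x \<oplus>\<^bsub>B\<^esub> q y)"
      by (rule wd) (use q xy m in \<open>simp_all add: mod_hom_add[OF ip(2)]\<close>)
    then show "h (q (x \<oplus>\<^bsub>C\<^esub> y)) = h (q x) \<oplus>\<^bsub>L\<^esub> h (q y)"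
      using q xy by (simp add: mod_hom_add[OF h])
  next
    fix r x assume rx: "r \<in> carrier R" "x \<in> carrier C"
    have "h (q (r \<odot>\<^bsub>C\<^esub> x)) = h (r \<odot>\<^bsub>B\<^esub> q x)"
      by (rule wd) (use q rx m in \<open>simp_all add: mod_hom_smult[OF ip(2)]\<close>)
    then show "h (q (r \<odot>\<^bsub>C\<^esub> x)) = r \<odot>\<^bsub>L\<^esub> h (q x)"
      using q rx by (simp add: mod_hom_smult[OF h])
  qed (use q in \<open>simp add: mod_hom_closed[OF h]\<close>)
  moreover have "h (q (p b)) = h b" if "b \<in> carrier B" for b
    using that wd q mod_hom_closed[OF ip(2)] by blast
  ultimately show ?thesis by (intro bexI[of _ "\<lambda>c. h (q c)"]) auto
qed

section \<open>Baer's criterion\<close>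

text \<open>The extension property along ideals, in the form it takes after evaluating at \<open>\<one>\<close>.\<close>

definition baer where
  "baer I \<longleftrightarrow> module R I \<and>
     (\<forall>\<aa> f. submodule \<aa> R (regular_module R) \<and> f \<in> mod_hom R ((regular_module R)\<lparr>carrier := \<aa>\<rparr>) I
       \<longrightarrow> (\<exists>y\<in>carrier I. \<forall>r\<in>\<aa>. f r = r \<odot>\<^bsub>I\<^esub> y))"

lemma baer_module: "baer I \<Longrightarrow> module R I"
  by (simp add: baer_def)

text \<open>Zorn's lemma is applied to graphs of partial extensions.\<close>

lemma baer_extend:
  assumes I: "baer I" and AB: "module R A" "module R B"
    and i: "i \<in> mod_hom R A B" "inj_on i (carrier A)" and f: "f \<in> mod_hom R A I"
  shows "\<exists>h\<in>mod_hom R B I. \<forall>a\<in>carrier A. h (i a) = f a"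
proof -
  note mI = baer_module[OF I]
  \<comment> \<open>A partial extension is a subset of \<open>B \<times> I\<close> closed under the
    operations and containing all pairs \<open>(i a, f a)\<close>. The last clause makes it
    single-valued, because the difference of two pairs with equal first entry has first entry
    0.\<close>
  define good where "good G \<longleftrightarrow> G \<subseteq> carrier B \<times> carrier I \<and> (\<forall>a\<in>carrier A. (i a, f a) \<in> G)
    \<and> (\<forall>b y b' y'. (b, y) \<in> G \<and> (b', y') \<in> G \<longrightarrow> (b \<oplus>\<^bsub>B\<^esub> b', y \<oplus>\<^bsub>I\<^esub> y') \<in> G)
    \<and> (\<forall>r\<in>carrier R. \<forall>b y. (b, y) \<in> G \<longrightarrow> (r \<odot>\<^bsub>B\<^esub> b, r \<odot>\<^bsub>I\<^esub> y) \<in> G)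
    \<and> (\<forall>y. (\<zero>\<^bsub>B\<^esub>, y) \<in> G \<longrightarrow> y = \<zero>\<^bsub>I\<^esub>)" for G
  have "\<exists>G\<in>Collect good. \<forall>H\<in>Collect good. G \<subseteq> H \<longrightarrow> H = G"
  proof (rule subset_Zorn_nonempty)
    have "good ((\<lambda>a. (i a, f a)) ` carrier A)"
      unfolding good_def
    proof (intro conjI allI ballI impI)
      fix y assume "(\<zero>\<^bsub>B\<^esub>, y) \<in> (\<lambda>a. (i a, f a)) ` carrier A"
      then obtain a where a: "a \<in> carrier A" "i a = \<zero>\<^bsub>B\<^esub>" "y = f a" by auto
      then have "a = \<zero>\<^bsub>A\<^esub>" using inj_onD[OF i(2), of a "\<zero>\<^bsub>A\<^esub>"] mod_hom_zero[OF i(1)] AB by simp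
      then show "y = \<zero>\<^bsub>I\<^esub>" using a mod_hom_zero[OF f] AB mI by simp
    next
      fix b y b' y' assume "(b, y) \<in> (\<lambda>a. (i a, f a)) ` carrier A \<and> (b', y') \<in> (\<lambda>a. (i a, f a)) ` carrier A"
      then obtain a a' where "a \<in> carrier A" "b = i a" "y = f a" "a' \<in> carrier A" "b' = i a'" "y' = f a'"
        by auto
      then show "(b \<oplus>\<^bsub>B\<^esub> b', y \<oplus>\<^bsub>I\<^esub> y') \<in> (\<lambda>a. (i a, f a)) ` carrier A"
        using AB by (intro image_eqI[of _ _ "a \<oplus>\<^bsub>A\<^esub> a'"]) (simp_all add: mod_hom_add[OF i(1)] mod_hom_add[OF f])
    next
      fix r b y assume "r \<in> carrier R" "(b, y) \<in> (\<lambda>a. (i a, f a)) ` carrier A"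
      then obtain a where "a \<in> carrier A" "b = i a" "y = f a" by auto
      then show "(r \<odot>\<^bsub>B\<^esub> b, r \<odot>\<^bsub>I\<^esub> y) \<in> (\<lambda>a. (i a, f a)) ` carrier A"
        using AB \<open>r \<in> carrier R\<close>
        by (intro image_eqI[of _ _ "r \<odot>\<^bsub>A\<^esub> a"]) (simp_all add: mod_hom_smult[OF i(1)] mod_hom_smult[OF f])
    qed (use mod_hom_closed[OF i(1)] mod_hom_closed[OF f] in auto)
    then show "Collect good \<noteq> {}" by blast
  next
    fix \<C> assume ne: "\<C> \<noteq> {}" and ch: "subset.chain (Collect good) \<C>"
    have g: "good G" if "G \<in> \<C>" for G using ch that by (auto simp: pred_on.chain_def)
    have two: "\<exists>G\<in>\<C>. u \<in> G \<and> v \<in> G" if "u \<in> \<Union>\<C>" "v \<in> \<Union>\<C>" for u v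
    proof -
      obtain U V where "U \<in> \<C>" "u \<in> U" "V \<in> \<C>" "v \<in> V" using \<open>u \<in> \<Union>\<C>\<close> \<open>v \<in> \<Union>\<C>\<close> by auto
      moreover then have "U \<subseteq> V \<or> V \<subseteq> U" using ch by (auto simp: pred_on.chain_def)
      ultimately show ?thesis by blast
    qed
    have "good (\<Union>\<C>)"
      unfolding good_def
    proof (intro conjI allI ballI impI)
      show "\<Union>\<C> \<subseteq> carrier B \<times> carrier I" using g unfolding good_def by blast
      show "(i a, f a) \<in> \<Union>\<C>" if "a \<in> carrier A" for a using g ne that unfolding good_def by blast
      show "(b \<oplus>\<^bsub>B\<^esub> b', y \<oplus>\<^bsub>I\<^esub> y') \<in> \<Union>\<C>" if "(b, y) \<in> \<Union>\<C> \<and> (b', y') \<in> \<Union>\<C>" for b y b' y'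
        using two[of "(b, y)" "(b', y')"] g that unfolding good_def by blast
      show "(r \<odot>\<^bsub>B\<^esub> b, r \<odot>\<^bsub>I\<^esub> y) \<in> \<Union>\<C>" if "r \<in> carrier R" "(b, y) \<in> \<Union>\<C>" for r b y
        using g that unfolding good_def by blast
      show "y = \<zero>\<^bsub>I\<^esub>" if "(\<zero>\<^bsub>B\<^esub>, y) \<in> \<Union>\<C>" for y using g that unfolding good_def by blast
    qed
    then show "\<Union>\<C> \<in> Collect good" by simp
  qed
  then obtain G where "good G" and max: "\<And>H. good H \<Longrightarrow> G \<subseteq> H \<Longrightarrow> H = G" by blast
  then have G: "G \<subseteq> carrier B \<times> carrier I" "\<And>a. a \<in> carrier A \<Longrightarrow> (i a, f a) \<in> G"
    "\<And>b y b' y'. (b, y) \<in> G \<Longrightarrow> (b', y') \<in> G \<Longrightarrow> (b \<oplus>\<^bsub>B\<^esub> b', y \<oplus>\<^bsub>I\<^esub> y') \<in> G"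
    "\<And>r b y. r \<in> carrier R \<Longrightarrow> (b, y) \<in> G \<Longrightarrow> (r \<odot>\<^bsub>B\<^esub> b, r \<odot>\<^bsub>I\<^esub> y) \<in> G"
    "\<And>y. (\<zero>\<^bsub>B\<^esub>, y) \<in> G \<Longrightarrow> y = \<zero>\<^bsub>I\<^esub>"
    unfolding good_def by blast+
  have Gc: "b \<in> carrier B" "y \<in> carrier I" if "(b, y) \<in> G" for b y using G(1) that by auto
  have G0: "(\<zero>\<^bsub>B\<^esub>, \<zero>\<^bsub>I\<^esub>) \<in> G"
    using G(2)[of "\<zero>\<^bsub>A\<^esub>"] AB mI by (simp add: mod_hom_zero[OF i(1)] mod_hom_zero[OF f])
  have fn: "y = y'" if "(b, y) \<in> G" "(b, y') \<in> G" for b y y'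
  proof -
    have "(b \<oplus>\<^bsub>B\<^esub> (\<ominus> \<one>) \<odot>\<^bsub>B\<^esub> b, y \<oplus>\<^bsub>I\<^esub> (\<ominus> \<one>) \<odot>\<^bsub>I\<^esub> y') \<in> G" using that G(3,4) by simp
    then have "(\<zero>\<^bsub>B\<^esub>, y \<ominus>\<^bsub>I\<^esub> y') \<in> G"
      using Gc[OF that(1)] Gc[OF that(2)] AB mI by (simp add: module_minus_eq_smult[symmetric])
    then show ?thesis using G(5) Gc that mI by (metis module_minus_eq_zero)
  qed
  have dom: "\<exists>y. (b, y) \<in> G" if b: "b \<in> carrier B" for b
  proof -
    \<comment> \<open>The ideal of scalars that move \<open>b\<close> into the domain. On it,
      \<open>r\<close> goes to the value at \<open>r b\<close>; the Baer property writes this map as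
      \<open>r y0\<close>, and \<open>y0\<close> is the value to be assigned to
      \<open>b\<close>.\<close>
    define \<aa> where "\<aa> = {r \<in> carrier R. \<exists>y. (r \<odot>\<^bsub>B\<^esub> b, y) \<in> G}"
    have a: "submodule \<aa> R (regular_module R)"
    proof (rule submodule_intro[OF module_regular])
      show "\<zero>\<^bsub>regular_module R\<^esub> \<in> \<aa>" using G0 b AB by (auto simp: \<aa>_def)
      fix r s assume r: "r \<in> \<aa>"
      then obtain y where y: "(r \<odot>\<^bsub>B\<^esub> b, y) \<in> G" "r \<in> carrier R" by (auto simp: \<aa>_def)
      show "s \<odot>\<^bsub>regular_module R\<^esub> r \<in> \<aa>" if "s \<in> carrier R"
        using G(4)[OF that y(1)] that y(2) b AB by (auto simp: \<aa>_def module_mult_smult)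
      assume "s \<in> \<aa>"
      then obtain z where z: "(s \<odot>\<^bsub>B\<^esub> b, z) \<in> G" "s \<in> carrier R" by (auto simp: \<aa>_def)
      show "r \<oplus>\<^bsub>regular_module R\<^esub> s \<in> \<aa>"
        using G(3)[OF y(1) z(1)] y(2) z(2) b AB by (auto simp: \<aa>_def module_add_smult)
    qed (auto simp: \<aa>_def)
    define \<phi> where "\<phi> r = (THE y. (r \<odot>\<^bsub>B\<^esub> b, y) \<in> G)" for r
    have \<phi>: "\<phi> r = y" if "(r \<odot>\<^bsub>B\<^esub> b, y) \<in> G" for r y
      unfolding \<phi>_def by (rule the_equality) (use that fn in auto)
    have \<phi>G: "(r \<odot>\<^bsub>B\<^esub> b, \<phi> r) \<in> G" if "r \<in> \<aa>" for r using that \<phi> by (auto simp: \<aa>_def)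
    have "\<phi> \<in> mod_hom R ((regular_module R)\<lparr>carrier := \<aa>\<rparr>) I"
    proof (rule mod_homI, simp_all)
      show "\<phi> r \<in> carrier I" if "r \<in> \<aa>" for r using \<phi>G[OF that] Gc by blast
      show "\<phi> (r \<oplus> s) = \<phi> r \<oplus>\<^bsub>I\<^esub> \<phi> s" if "r \<in> \<aa>" "s \<in> \<aa>" for r s
        by (rule \<phi>) (use G(3)[OF \<phi>G[OF that(1)] \<phi>G[OF that(2)]] that b AB in \<open>auto simp: module_add_smult \<aa>_def\<close>)
      show "\<phi> (r \<otimes> s) = r \<odot>\<^bsub>I\<^esub> \<phi> s" if "r \<in> carrier R" "s \<in> \<aa>" for r s
        by (rule \<phi>) (use G(4)[OF that(1) \<phi>G[OF that(2)]] that b AB in \<open>auto simp: module_mult_smult \<aa>_def\<close>)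
    qed
    then obtain y0 where y0: "y0 \<in> carrier I" "\<And>r. r \<in> \<aa> \<Longrightarrow> \<phi> r = r \<odot>\<^bsub>I\<^esub> y0"
      using I a unfolding baer_def by blast
    define G' where "G' = {(b' \<oplus>\<^bsub>B\<^esub> r \<odot>\<^bsub>B\<^esub> b, y' \<oplus>\<^bsub>I\<^esub> r \<odot>\<^bsub>I\<^esub> y0) | b' y' r. (b', y') \<in> G \<and> r \<in> carrier R}"
    have G'I: "(x, y) \<in> G'" if "(b', y') \<in> G" "r \<in> carrier R" "x = b' \<oplus>\<^bsub>B\<^esub> r \<odot>\<^bsub>B\<^esub> b" "y = y' \<oplus>\<^bsub>I\<^esub> r \<odot>\<^bsub>I\<^esub> y0"
      for x y b' y' r using that unfolding G'_def by blast
    have G'E: "\<exists>b' y' r. (b', y') \<in> G \<and> r \<in> carrier R \<and> x = b' \<oplus>\<^bsub>B\<^esub> r \<odot>\<^bsub>B\<^esub> b \<and> y = y' \<oplus>\<^bsub>I\<^esub> r \<odot>\<^bsub>I\<^esub> y0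
        \<and> b' \<in> carrier B \<and> y' \<in> carrier I"
      if "(x, y) \<in> G'" for x y using that Gc unfolding G'_def by blast
    have sub: "G \<subseteq> G'"
    proof (rule subrelI)
      fix x y assume "(x, y) \<in> G"
      then show "(x, y) \<in> G'" using Gc b y0(1) AB mI by (intro G'I[of x y \<zero>]) auto
    qed
    have "good G'"
      unfolding good_def
    proof (intro conjI allI ballI impI)
      show "G' \<subseteq> carrier B \<times> carrier I" using Gc b y0(1) AB mI by (auto simp: G'_def)
      show "(i a, f a) \<in> G'" if "a \<in> carrier A" for a using G(2) sub that by blast
      show "(x \<oplus>\<^bsub>B\<^esub> x', y \<oplus>\<^bsub>I\<^esub> y') \<in> G'" if h: "(x, y) \<in> G' \<and> (x', y') \<in> G'" for x y x' y'
      proof -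
        obtain b1 y1 r1 b2 y2 r2 where "(b1, y1) \<in> G" "r1 \<in> carrier R" "x = b1 \<oplus>\<^bsub>B\<^esub> r1 \<odot>\<^bsub>B\<^esub> b"
          "y = y1 \<oplus>\<^bsub>I\<^esub> r1 \<odot>\<^bsub>I\<^esub> y0" "b1 \<in> carrier B" "y1 \<in> carrier I"
          "(b2, y2) \<in> G" "r2 \<in> carrier R" "x' = b2 \<oplus>\<^bsub>B\<^esub> r2 \<odot>\<^bsub>B\<^esub> b"
          "y' = y2 \<oplus>\<^bsub>I\<^esub> r2 \<odot>\<^bsub>I\<^esub> y0" "b2 \<in> carrier B" "y2 \<in> carrier I"
          using G'E[of x y] G'E[of x' y'] h by metis
        then show ?thesis
          using b y0(1) AB mI G(3)
          by (intro G'I[of "b1 \<oplus>\<^bsub>B\<^esub> b2" "y1 \<oplus>\<^bsub>I\<^esub> y2" "r1 \<oplus> r2"]) (simp_all add: module_add_smult module_ac)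
      qed
      show "(r \<odot>\<^bsub>B\<^esub> x, r \<odot>\<^bsub>I\<^esub> y) \<in> G'" if r: "r \<in> carrier R" and h: "(x, y) \<in> G'" for r x y
      proof -
        obtain b1 y1 r1 where "(b1, y1) \<in> G" "r1 \<in> carrier R" "x = b1 \<oplus>\<^bsub>B\<^esub> r1 \<odot>\<^bsub>B\<^esub> b"
          "y = y1 \<oplus>\<^bsub>I\<^esub> r1 \<odot>\<^bsub>I\<^esub> y0" "b1 \<in> carrier B" "y1 \<in> carrier I"
          using G'E[OF h] by metis
        then show ?thesis
          using b y0(1) AB mI G(4) r
          by (intro G'I[of "r \<odot>\<^bsub>B\<^esub> b1" "r \<odot>\<^bsub>I\<^esub> y1" "r \<otimes> r1"]) (simp_all add: module_smult_add module_mult_smult)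
      qed
      \<comment> \<open>If b1 + r b = 0, then r lies in \<open>\<aa>\<close> and
        \<open>r y0 = \<phi> r = - y1\<close>, so the value at 0 is still 0.\<close>
      show "y = \<zero>\<^bsub>I\<^esub>" if h: "(\<zero>\<^bsub>B\<^esub>, y) \<in> G'" for y
      proof -
        obtain b1 y1 r where 1: "(b1, y1) \<in> G" "r \<in> carrier R" "\<zero>\<^bsub>B\<^esub> = b1 \<oplus>\<^bsub>B\<^esub> r \<odot>\<^bsub>B\<^esub> b"
          "y = y1 \<oplus>\<^bsub>I\<^esub> r \<odot>\<^bsub>I\<^esub> y0" "b1 \<in> carrier B" "y1 \<in> carrier I"
          using G'E[OF h] by metis
        have "((\<ominus> \<one>) \<odot>\<^bsub>B\<^esub> b1, (\<ominus> \<one>) \<odot>\<^bsub>I\<^esub> y1) \<in> G" using G(4) 1 by simp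
        moreover have "(\<ominus> \<one>) \<odot>\<^bsub>B\<^esub> b1 = r \<odot>\<^bsub>B\<^esub> b"
        proof -
          have "r \<odot>\<^bsub>B\<^esub> b = (\<ominus> \<one>) \<odot>\<^bsub>B\<^esub> b1 \<oplus>\<^bsub>B\<^esub> (b1 \<oplus>\<^bsub>B\<^esub> r \<odot>\<^bsub>B\<^esub> b)"
            using 1(2,5) b AB by (simp add: module_neg_eq_smult[symmetric] module_assoc[symmetric])
          also have "\<dots> = (\<ominus> \<one>) \<odot>\<^bsub>B\<^esub> b1 \<oplus>\<^bsub>B\<^esub> \<zero>\<^bsub>B\<^esub>"
            unfolding 1(3)[symmetric] ..
          finally show ?thesis using 1(5) AB by simp
        qed
        ultimately have rG: "(r \<odot>\<^bsub>B\<^esub> b, (\<ominus> \<one>) \<odot>\<^bsub>I\<^esub> y1) \<in> G" by simp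
        then have "r \<in> \<aa>" using 1 by (auto simp: \<aa>_def)
        then have "(\<ominus> \<one>) \<odot>\<^bsub>I\<^esub> y1 = r \<odot>\<^bsub>I\<^esub> y0" using \<phi>[OF rG] y0(2) by simp
        then have "y = y1 \<oplus>\<^bsub>I\<^esub> (\<ominus> \<one>) \<odot>\<^bsub>I\<^esub> y1" using 1(4) by simp
        also have "\<dots> = \<zero>\<^bsub>I\<^esub>" using 1(6) mI by (simp add: module_neg_eq_smult[symmetric])
        finally show "y = \<zero>\<^bsub>I\<^esub>" .
      qed
    qed
    then have "G' = G" using max sub by blast
    moreover have "(b, y0) \<in> G'" by (rule G'I[OF G0, of \<one>]) (use b y0 AB mI in auto)
    ultimately show ?thesis by blast
  qed
  define h where "h b = (THE y. (b, y) \<in> G)" for b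
  have h: "h b = y" if "(b, y) \<in> G" for b y
    unfolding h_def by (rule the_equality) (use that fn in auto)
  have hG: "(b, h b) \<in> G" if "b \<in> carrier B" for b using dom[OF that] h by auto
  have "h \<in> mod_hom R B I"
  proof (rule mod_homI)
    show "h b \<in> carrier I" if "b \<in> carrier B" for b using hG[OF that] Gc by blast
    show "h (b \<oplus>\<^bsub>B\<^esub> b') = h b \<oplus>\<^bsub>I\<^esub> h b'" if "b \<in> carrier B" "b' \<in> carrier B" for b b'
      by (rule h, rule G(3)) (use that hG in auto)
    show "h (r \<odot>\<^bsub>B\<^esub> b) = r \<odot>\<^bsub>I\<^esub> h b" if "r \<in> carrier R" "b \<in> carrier B" for b r
      by (rule h, rule G(4)) (use that hG in auto)
  qed
  moreover have "\<forall>a\<in>carrier A. h (i a) = f a" using h G(2) by blast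
  ultimately show ?thesis by blast
qed

lemma injective_module_if_baer:
  assumes "baer I"
  shows "injective_module R I"
  unfolding injective_module_def using baer_extend[OF assms] baer_module[OF assms] by metis

end

section \<open>Enough injectives\<close>

context cring
begin

lemma mod_hom_inverse:
  assumes p: "p \<in> mod_hom R B Q" "inj_on p (carrier B)" "p ` carrier B = carrier Q" and B: "module R B"
  shows "inv_into (carrier B) p \<in> mod_hom R Q B"
proof -
  have i: "inv_into (carrier B) p (p x) = x" if "x \<in> carrier B" for x
    using that p(2) by (rule inv_into_f_f[rotated])
  show ?thesis
  proof (rule mod_homI)
    fix x y assume "x \<in> carrier Q"
    then obtain a where a: "a \<in> carrier B" "x = p a" using p(3) by (metis imageE)
    then show "inv_into (carrier B) p x \<in> carrier B" using i by simp
    show "inv_into (carrier B) p (r \<odot>\<^bsub>Q\<^esub> x) = r \<odot>\<^bsub>B\<^esub> inv_into (carrier B) p x" if "r \<in> carrier R" for r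
      using a that i B by (simp add: mod_hom_smult[OF p(1), symmetric])
    assume "y \<in> carrier Q"
    then obtain b where b: "b \<in> carrier B" "y = p b" using p(3) by (metis imageE)
    show "inv_into (carrier B) p (x \<oplus>\<^bsub>Q\<^esub> y) = inv_into (carrier B) p x \<oplus>\<^bsub>B\<^esub> inv_into (carrier B) p y"
      using a b i B by (simp add: mod_hom_add[OF p(1), symmetric])
  qed
qed

lemma baer_iso:
  assumes I: "baer I" and p: "p \<in> mod_hom R I Q" "inj_on p (carrier I)" "p ` carrier I = carrier Q"
    and Q: "module R Q"
  shows "baer Q"
  unfolding baer_def
proof (intro conjI allI impI)
  fix \<aa> f
  assume a: "submodule \<aa> R (regular_module R) \<and> f \<in> mod_hom R (regular_module R\<lparr>carrier := \<aa>\<rparr>) Q"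
  let ?g = "inv_into (carrier I) p"
  have "(\<lambda>r. ?g (f r)) \<in> mod_hom R (regular_module R\<lparr>carrier := \<aa>\<rparr>) I"
    using mod_hom_comp[OF _ mod_hom_inverse[OF p baer_module[OF I]]] a by blast
  then obtain y where y: "y \<in> carrier I" "\<And>r. r \<in> \<aa> \<Longrightarrow> ?g (f r) = r \<odot>\<^bsub>I\<^esub> y"
    using I a unfolding baer_def by blast
  have "f r = r \<odot>\<^bsub>Q\<^esub> p y" if "r \<in> \<aa>" for r
  proof -
    have "f r \<in> carrier Q" using a that mod_hom_closed[of f "regular_module R\<lparr>carrier := \<aa>\<rparr>" Q r] by simp
    then have "f r = p (?g (f r))" using p(3) by (simp add: f_inv_into_f)
    also have "\<dots> = p (r \<odot>\<^bsub>I\<^esub> y)" using y that by simp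
    also have "\<dots> = r \<odot>\<^bsub>Q\<^esub> p y"
      using a that submodule_subset[OF _ module_regular] y by (auto intro!: mod_hom_smult[OF p(1)])
    finally show ?thesis .
  qed
  then show "\<exists>y\<in>carrier Q. \<forall>r\<in>\<aa>. f r = r \<odot>\<^bsub>Q\<^esub> y" using mod_hom_closed[OF p(1) y(1)] by blast
qed (rule Q)

end

section \<open>Divisible abelian groups\<close>

definition int_module :: "('b, 'c) ring_scheme \<Rightarrow> (int, 'b) module" where
  "int_module A = \<lparr>carrier = carrier A, monoid.mult = undefined, one = undefined,
     ring.zero = \<zero>\<^bsub>A\<^esub>, add = (\<oplus>\<^bsub>A\<^esub>), smult = (\<lambda>n x. [n] \<cdot>\<^bsub>A\<^esub> x)\<rparr>"

lemma int_module_simps [simp]: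
  "carrier (int_module A) = carrier A" "\<zero>\<^bsub>int_module A\<^esub> = \<zero>\<^bsub>A\<^esub>"
  "x \<oplus>\<^bsub>int_module A\<^esub> y = x \<oplus>\<^bsub>A\<^esub> y"
  by (simp_all add: int_module_def)

lemma module_int_module:
  assumes "abelian_group A"
  shows "module \<Z> (int_module A)"
proof (rule moduleI)
  interpret A: abelian_group A by fact
  show "abelian_group (int_module A)"
    by (rule abelian_groupI) (auto simp: A.a_ac intro!: bexI[of _ "\<ominus>\<^bsub>A\<^esub> _"] A.l_neg)
  show "a \<otimes>\<^bsub>\<Z>\<^esub> b \<odot>\<^bsub>int_module A\<^esub> x = a \<odot>\<^bsub>int_module A\<^esub> (b \<odot>\<^bsub>int_module A\<^esub> x)"
    if "x \<in> carrier (int_module A)" for a b x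
    using that A.add.int_pow_pow[of x a b] by (simp add: int_module_def add_pow_def mult.commute)
  show "(a \<oplus>\<^bsub>\<Z>\<^esub> b) \<odot>\<^bsub>int_module A\<^esub> x = a \<odot>\<^bsub>int_module A\<^esub> x \<oplus>\<^bsub>int_module A\<^esub> b \<odot>\<^bsub>int_module A\<^esub> x"
    if "x \<in> carrier (int_module A)" for a b x
    using that A.add.int_pow_mult[of x a b] by (simp add: int_module_def add_pow_def)
  show "a \<odot>\<^bsub>int_module A\<^esub> (x \<oplus>\<^bsub>int_module A\<^esub> y) = a \<odot>\<^bsub>int_module A\<^esub> x \<oplus>\<^bsub>int_module A\<^esub> a \<odot>\<^bsub>int_module A\<^esub> y"
    if "x \<in> carrier (int_module A)" "y \<in> carrier (int_module A)" for a x y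
    using that A.add.int_pow_distrib[of x y a] by (simp add: int_module_def add_pow_def)
  show "a \<odot>\<^bsub>int_module A\<^esub> x \<in> carrier (int_module A)" if "x \<in> carrier (int_module A)" for a x
    using that A.add.int_pow_closed[of x a] by (simp add: int_module_def add_pow_def)
  show "\<one>\<^bsub>\<Z>\<^esub> \<odot>\<^bsub>int_module A\<^esub> x = x" if "x \<in> carrier (int_module A)" for x
    using that A.add.int_pow_1[of x] by (simp add: int_module_def add_pow_def)
qed (rule int_is_cring)

text \<open>Compatibility with integer multiples is automatic, by induction upwards and downwards
  from 0.\<close>

lemma additive_mod_hom_int:
  assumes M: "module \<Z> M" and N: "module \<Z> N" and cl: "\<And>x. x \<in> carrier M \<Longrightarrow> f x \<in> carrier N"
    and add: "\<And>x y. x \<in> carrier M \<Longrightarrow> y \<in> carrier M \<Longrightarrow> f (x \<oplus>\<^bsub>M\<^esub> y) = f x \<oplus>\<^bsub>N\<^esub> f y"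
  shows "f \<in> mod_hom \<Z> M N"
proof -
  interpret M: module \<Z> M by fact
  interpret N: module \<Z> N by fact
  have sm: "(a + b) \<odot>\<^bsub>M\<^esub> x = a \<odot>\<^bsub>M\<^esub> x \<oplus>\<^bsub>M\<^esub> b \<odot>\<^bsub>M\<^esub> x" "a \<odot>\<^bsub>M\<^esub> x \<in> carrier M" "1 \<odot>\<^bsub>M\<^esub> x = x"
    if "x \<in> carrier M" for a b x
    using M.smult_l_distr[of a b x] M.smult_closed[of a x] M.smult_one[of x] that by simp_all
  have sn: "(a + b) \<odot>\<^bsub>N\<^esub> x = a \<odot>\<^bsub>N\<^esub> x \<oplus>\<^bsub>N\<^esub> b \<odot>\<^bsub>N\<^esub> x" "a \<odot>\<^bsub>N\<^esub> x \<in> carrier N" "1 \<odot>\<^bsub>N\<^esub> x = x"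
    if "x \<in> carrier N" for a b x
    using N.smult_l_distr[of a b x] N.smult_closed[of a x] N.smult_one[of x] that by simp_all
  have "f (n \<odot>\<^bsub>M\<^esub> x) = n \<odot>\<^bsub>N\<^esub> f x" if x: "x \<in> carrier M" for n x
  proof (induction n rule: int_induct[where k = 0])
    case base
    have "f \<zero>\<^bsub>M\<^esub> \<oplus>\<^bsub>N\<^esub> f \<zero>\<^bsub>M\<^esub> = f \<zero>\<^bsub>M\<^esub>" using add[of "\<zero>\<^bsub>M\<^esub>" "\<zero>\<^bsub>M\<^esub>"] by simp
    then have "f \<zero>\<^bsub>M\<^esub> = \<zero>\<^bsub>N\<^esub>" using cl[of "\<zero>\<^bsub>M\<^esub>"] by simp
    then show ?case using M.smult_l_null[OF x] N.smult_l_null[OF cl[OF x]] by simp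
  next
    case (step1 n)
    then show ?case using x sm sn cl add by simp
  next
    case (step2 n)
    have "f ((n - 1) \<odot>\<^bsub>M\<^esub> x) \<oplus>\<^bsub>N\<^esub> f x = (n - 1) \<odot>\<^bsub>N\<^esub> f x \<oplus>\<^bsub>N\<^esub> f x"
      using step2 x sm(1)[OF x, of "n - 1" 1] sn(1)[OF cl[OF x], of "n - 1" 1] sm sn cl
        add[of "(n - 1) \<odot>\<^bsub>M\<^esub> x" x] by simp
    then show ?case using sm(2)[OF x] cl[OF x] sn(2)[OF cl[OF x]] cl by (simp add: N.M.add.right_cancel)
  qed
  then show ?thesis using cl add unfolding mod_hom_def by auto
qed

text \<open>A nonzero ideal is generated by its least positive element n, so a homomorphism on it is
  determined by its value at n; any \<open>z\<close> with n z equal to that value gives the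
  extension.\<close>

lemma baer_divisible_int:
  assumes D: "module \<Z> D"
    and divis: "\<And>n y. n \<noteq> 0 \<Longrightarrow> y \<in> carrier D \<Longrightarrow> \<exists>z\<in>carrier D. n \<odot>\<^bsub>D\<^esub> z = y"
  shows "cring.baer \<Z> D"
proof -
  show ?thesis
    unfolding cring.baer_def[OF int_is_cring]
  proof (intro conjI allI impI D)
    fix \<aa> f
    assume "submodule \<aa> \<Z> (regular_module \<Z>) \<and> f \<in> mod_hom \<Z> (regular_module \<Z>\<lparr>carrier := \<aa>\<rparr>) D"
    then have a: "submodule \<aa> \<Z> (regular_module \<Z>)" and f: "f \<in> mod_hom \<Z> (regular_module \<Z>\<lparr>carrier := \<aa>\<rparr>) D"
      by auto
    have a1: "0 \<in> \<aa>" and a2: "x - y \<in> \<aa>" if "x \<in> \<aa>" "y \<in> \<aa>" for x y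
      using cring.submodule_zero[OF int_is_cring, OF a cring.module_regular[OF int_is_cring]]
        cring.submodule_add[OF int_is_cring, OF a cring.module_regular[OF int_is_cring], of x "(- 1) * y"]
        cring.submodule_smult[OF int_is_cring, OF a cring.module_regular[OF int_is_cring], of "- 1" y] that by (simp_all add: regular_module_def)
    have a0: "0 \<in> \<aa>" using cring.submodule_zero[OF int_is_cring, OF a cring.module_regular[OF int_is_cring]] by (simp add: regular_module_def)
    have a3: "n * x \<in> \<aa>" if "x \<in> \<aa>" for n x
      using cring.submodule_smult[OF int_is_cring, OF a cring.module_regular[OF int_is_cring], of n x] that by (simp add: regular_module_def)
    have fs: "f (n * x) = n \<odot>\<^bsub>D\<^esub> f x" and fc: "f x \<in> carrier D" if "x \<in> \<aa>" for n x
      using that f by (auto simp: mod_hom_def regular_module_def)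
    show "\<exists>y\<in>carrier D. \<forall>r\<in>\<aa>. f r = r \<odot>\<^bsub>D\<^esub> y"
    proof (cases "\<exists>x\<in>\<aa>. x \<noteq> 0")
      case False
      then have z: "r = 0" if "r \<in> \<aa>" for r using that by auto
      have "f r = r \<odot>\<^bsub>D\<^esub> \<zero>\<^bsub>D\<^esub>" if "r \<in> \<aa>" for r
        using fs[OF a0, of 0] cring.module_zero_smult[OF int_is_cring, OF D fc[OF a0]]
          cring.module_smult_zero[OF int_is_cring, OF D] unfolding z[OF that] by simp
      then show ?thesis using cring.module_zero_closed[OF int_is_cring, OF D] by blast
    next
      case True
      then obtain x where x: "x \<in> \<aa>" "x \<noteq> 0" by auto
      then have "\<bar>x\<bar> \<in> \<aa>" using a3[of x "-1"] by (auto simp: abs_if)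
      then have ex: "\<exists>n. n > 0 \<and> int n \<in> \<aa>" using x by (intro exI[of _ "nat \<bar>x\<bar>"]) auto
      define n where "n = (LEAST n. n > 0 \<and> int n \<in> \<aa>)"
      have n: "n > 0" "int n \<in> \<aa>" using LeastI_ex[OF ex] by (auto simp: n_def)
      have dv: "r = (r div int n) * int n" if "r \<in> \<aa>" for r
      proof -
        have "r mod int n \<in> \<aa>"
          using a2[OF that a3[OF n(2), of "r div int n"]] by (simp add: minus_div_mult_eq_mod)
        then have "\<not> nat (r mod int n) > 0"
          using not_less_Least[of "nat (r mod int n)" "\<lambda>n. n > 0 \<and> int n \<in> \<aa>"] n(1)
          by (fold n_def) (auto simp: nat_less_iff)
        then have "r mod int n = 0" using n(1) pos_mod_sign[of "int n" r] by linarith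
        then show ?thesis by (simp add: dvd_div_mult_self mod_eq_0_iff_dvd)
      qed
      obtain z where z: "z \<in> carrier D" "int n \<odot>\<^bsub>D\<^esub> z = f (int n)"
        using divis[of "int n" "f (int n)"] n fc by auto
      have "f r = r \<odot>\<^bsub>D\<^esub> z" if "r \<in> \<aa>" for r
      proof -
        have "f r = (r div int n) \<odot>\<^bsub>D\<^esub> (int n \<odot>\<^bsub>D\<^esub> z)"
          using fs[OF n(2), of "r div int n"] z dv[OF that] by simp
        also have "\<dots> = ((r div int n) * int n) \<odot>\<^bsub>D\<^esub> z"
          using cring.module_mult_smult[OF int_is_cring, OF D _ _ z(1), of "r div int n" "int n"] by simp
        finally show ?thesis using dv[OF that] by simp
      qed
      then show ?thesis using z by blast
    qed
  qed
qed

text \<open>\<open>D\<close> is \<open>\<rat>\<^sup>(\<^sup>A\<^sup>)\<close> modulo the kernel of \<open>\<int>\<^sup>(\<^sup>A\<^sup>) \<rightarrow> A\<close>. Unlike a product of copies of \<open>\<rat>/\<int>\<close>, it is not larger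
  than an infinite \<open>A\<close>, which keeps injective coresolutions inside the universe.\<close>

lemma ex_divisible_hull:
  fixes A :: "(int, 'm) module"
  assumes A: "module \<Z> A"
  shows "\<exists>(D :: (int, 'm \<Rightarrow> rat) module) e. cring.baer \<Z> D \<and> (\<forall>q\<in>carrier D. finite {m. q m \<noteq> 0}) \<and>
    e \<in> mod_hom \<Z> A D \<and> inj_on e (carrier A)"
proof -
  interpret A: module \<Z> A by fact
  define supp where "supp q = {m. q m \<noteq> 0}" for q :: "'m \<Rightarrow> rat"
  define V :: "(int, 'm \<Rightarrow> rat) module" where
    "V = \<lparr>carrier = {q. finite (supp q) \<and> supp q \<subseteq> carrier A}, monoid.mult = undefined, one = undefined,
      ring.zero = (\<lambda>_. 0), add = (\<lambda>p q m. p m + q m), smult = (\<lambda>n q m. of_int n * q m)\<rparr>"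
  have cV: "q \<in> carrier V \<longleftrightarrow> finite (supp q) \<and> supp q \<subseteq> carrier A" for q by (simp add: V_def)
  have oV: "\<zero>\<^bsub>V\<^esub> = (\<lambda>_. 0)" "p \<oplus>\<^bsub>V\<^esub> q = (\<lambda>m. p m + q m)" "n \<odot>\<^bsub>V\<^esub> q = (\<lambda>m. of_int n * q m)" for p q n
    by (simp_all add: V_def)
  have supp_add: "supp (\<lambda>m. p m + q m) \<subseteq> supp p \<union> supp q" for p q by (auto simp: supp_def)
  have supp_sc: "supp (\<lambda>m. c * q m) \<subseteq> supp q" for c q by (auto simp: supp_def)
  have V_add: "p \<in> carrier V \<Longrightarrow> q \<in> carrier V \<Longrightarrow> p \<oplus>\<^bsub>V\<^esub> q \<in> carrier V" for p q
    unfolding cV oV using supp_add[of p q] by (meson finite_Un finite_subset le_sup_iff order_trans)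
  have V_sc: "(\<lambda>m. c * q m) \<in> carrier V" if "q \<in> carrier V" for q c
    using that supp_sc[of c q] unfolding cV by (meson finite_subset order_trans)
  have V: "module \<Z> V"
  proof (rule moduleI[OF int_is_cring])
    show "abelian_group V"
    proof (rule abelian_groupI)
      fix q assume "q \<in> carrier V"
      then show "\<exists>p\<in>carrier V. p \<oplus>\<^bsub>V\<^esub> q = \<zero>\<^bsub>V\<^esub>" using V_sc[of q "- 1"] by (intro bexI[of _ "\<lambda>m. - 1 * q m"]) (auto simp: oV)
    qed (auto simp: V_add, auto simp: oV cV supp_def)
  qed (use V_sc in \<open>auto simp: oV distrib_left distrib_right mult.assoc\<close>)
  define VZ where "VZ = {q \<in> carrier V. \<forall>m. q m \<in> \<int>}"
  have VZ: "submodule VZ \<Z> V"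
    by (rule cring.submodule_intro[OF int_is_cring, OF V]) (use V_add V_sc in \<open>auto simp: VZ_def oV\<close>, auto simp: cV supp_def)
  note mVZ = cring.submodule_module[OF int_is_cring, OF VZ V]
  \<comment> \<open>The summation map from the free abelian group on the set \<open>A\<close> to
    \<open>A\<close>. On \<open>VZ\<close> the floor only converts an integral rational to type
    \<open>int\<close>.\<close>
  define \<sigma> where "\<sigma> q = (\<Oplus>\<^bsub>A\<^esub>m\<in>supp q. \<lfloor>q m\<rfloor> \<odot>\<^bsub>A\<^esub> m)" for q
  have cl: "n \<odot>\<^bsub>A\<^esub> m \<in> carrier A" if "m \<in> carrier A" for n m using A.smult_closed[of n m] that by simp
  have \<sigma>: "\<sigma> q = (\<Oplus>\<^bsub>A\<^esub>m\<in>T. \<lfloor>q m\<rfloor> \<odot>\<^bsub>A\<^esub> m)" if "finite T" "supp q \<subseteq> T" "T \<subseteq> carrier A" for q T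
    unfolding \<sigma>_def
  proof (rule A.add.finprod_mono_neutral_cong_left)
    show "\<lfloor>q m\<rfloor> \<odot>\<^bsub>A\<^esub> m = \<zero>\<^bsub>A\<^esub>" if "m \<in> T - supp q" for m
    proof -
      have "q m = 0" "m \<in> carrier A" using that \<open>T \<subseteq> carrier A\<close> by (auto simp: supp_def)
      then show ?thesis using A.smult_l_null[of m] by simp
    qed
  qed (use that cl in auto)
  have hom: "\<sigma> \<in> mod_hom \<Z> (V\<lparr>carrier := VZ\<rparr>) A"
  proof (rule additive_mod_hom_int[OF mVZ A], simp_all)
    show "\<sigma> q \<in> carrier A" if "q \<in> VZ" for q
      unfolding \<sigma>_def using that cl by (intro A.finsum_closed) (auto simp: VZ_def cV)
    fix p q assume pq: "p \<in> VZ" "q \<in> VZ"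
    define T where "T = supp p \<union> supp q"
    have T: "finite T" "supp q \<subseteq> T" "supp p \<subseteq> T" "T \<subseteq> carrier A" "supp (p \<oplus>\<^bsub>V\<^esub> q) \<subseteq> T"
      using pq supp_add[of p q] by (auto simp: T_def VZ_def cV oV)
    have "\<sigma> (p \<oplus>\<^bsub>V\<^esub> q) = (\<Oplus>\<^bsub>A\<^esub>m\<in>T. \<lfloor>p m\<rfloor> \<odot>\<^bsub>A\<^esub> m \<oplus>\<^bsub>A\<^esub> \<lfloor>q m\<rfloor> \<odot>\<^bsub>A\<^esub> m)"
      unfolding \<sigma>[OF T(1,5,4)]
    proof (rule A.finsum_cong')
      fix m assume "m \<in> T"
      then have "m \<in> carrier A" using T by auto
      moreover have "\<lfloor>p m + q m\<rfloor> = \<lfloor>p m\<rfloor> + \<lfloor>q m\<rfloor>"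
        using pq by (auto simp: VZ_def elim!: Ints_cases[of "q m"])
      ultimately show "\<lfloor>(p \<oplus>\<^bsub>V\<^esub> q) m\<rfloor> \<odot>\<^bsub>A\<^esub> m = \<lfloor>p m\<rfloor> \<odot>\<^bsub>A\<^esub> m \<oplus>\<^bsub>A\<^esub> \<lfloor>q m\<rfloor> \<odot>\<^bsub>A\<^esub> m"
        using A.smult_l_distr[of "\<lfloor>p m\<rfloor>" "\<lfloor>q m\<rfloor>" m] by (simp add: oV)
    qed (use T cl in auto)
    also have "\<dots> = \<sigma> p \<oplus>\<^bsub>A\<^esub> \<sigma> q"
      unfolding \<sigma>[OF T(1,2,4)] \<sigma>[OF T(1,3,4)] using T cl by (intro A.finsum_addf) auto
    finally show "\<sigma> (p \<oplus>\<^bsub>V\<^esub> q) = \<sigma> p \<oplus>\<^bsub>A\<^esub> \<sigma> q" .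
  qed
  define K where "K = a_kernel (V\<lparr>carrier := VZ\<rparr>) A \<sigma>"
  have Ksub: "submodule K \<Z> V"
    using cring.submodule_kernel[OF int_is_cring, OF hom mVZ A] cring.submodule_subset[OF int_is_cring, OF VZ V] unfolding K_def
    by (intro cring.submodule_intro[OF int_is_cring, OF V])
      (auto simp: cring.a_kernel_iff[OF int_is_cring] dest: cring.submodule_zero[OF int_is_cring, OF _ mVZ] cring.submodule_add[OF int_is_cring, OF _ mVZ] cring.submodule_smult[OF int_is_cring, OF _ mVZ])
  obtain p D where D: "carrier D \<subseteq> carrier V" and s: "cring.ses \<Z> (V\<lparr>carrier := K\<rparr>) (\<lambda>x. x) V p D"
    using cring.ses_submodule[OF int_is_cring, OF V Ksub] by blast
  note mD = cring.ses_modules(3)[OF int_is_cring, OF s] and pD = cring.ses_homs(2)[OF int_is_cring, OF s]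
  \<comment> \<open>Division by n is carried out coordinatewise in \<open>V\<close> and survives in
    the quotient.\<close>
  have "\<exists>z\<in>carrier D. n \<odot>\<^bsub>D\<^esub> z = y" if n: "n \<noteq> 0" and y: "y \<in> carrier D" for n y
  proof -
    obtain q where q: "q \<in> carrier V" "p q = y" using cring.ses_surj[OF int_is_cring, OF s y] by blast
    let ?q = "\<lambda>m. (1 / of_int n) * q m"
    have "n \<odot>\<^bsub>V\<^esub> ?q = q" using n by (simp add: oV)
    then have "n \<odot>\<^bsub>D\<^esub> p ?q = y"
      using cring.mod_hom_smult[OF int_is_cring, OF pD, of n ?q] V_sc[OF q(1), of "1 / of_int n"] q(2)
      by (simp del: times_divide_eq_left)
    then show ?thesis using cring.mod_hom_closed[OF int_is_cring, OF pD V_sc[OF q(1)]] by blast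
  qed
  then have bD: "cring.baer \<Z> D" by (rule baer_divisible_int[OF mD])
  \<comment> \<open>\<open>\<delta>\<close> is not additive, but the images of x + y and of x and y
    have the same sum under \<open>\<sigma>\<close>, so additivity holds modulo \<open>K\<close>. By
    \<open>p_eq\<close> the embedding is also injective.\<close>
  define \<delta> where "\<delta> x = (\<lambda>m. if m = x then 1 else 0 :: rat)" for x :: 'm
  have supp\<delta>: "supp (\<delta> x) = {x}" for x by (auto simp: supp_def \<delta>_def)
  have \<delta>: "\<delta> x \<in> VZ" "\<sigma> (\<delta> x) = x" "\<delta> x \<in> carrier V" if "x \<in> carrier A" for x
  proof -
    show "\<delta> x \<in> carrier V" using that supp\<delta> by (simp add: cV)
    then show "\<delta> x \<in> VZ" by (simp add: VZ_def \<delta>_def)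
    show "\<sigma> (\<delta> x) = x" using that A.smult_one[OF that] unfolding \<sigma>_def supp\<delta> by (simp add: \<delta>_def)
  qed
  have p_eq: "p u = p v \<longleftrightarrow> \<sigma> u = \<sigma> v" if "u \<in> VZ" "v \<in> VZ" for u v
  proof -
    have uv: "u \<in> carrier V" "v \<in> carrier V" "u \<ominus>\<^bsub>V\<^esub> v \<in> VZ"
      using that cring.submodule_minus[OF int_is_cring, OF VZ V] by (auto simp: VZ_def)
    have "p u = p v \<longleftrightarrow> p (u \<ominus>\<^bsub>V\<^esub> v) = \<zero>\<^bsub>D\<^esub>"
      using uv V mD by (simp add: cring.mod_hom_minus[OF int_is_cring, OF pD] cring.mod_hom_closed[OF int_is_cring, OF pD] cring.module_minus_eq_zero[OF int_is_cring])
    also have "\<dots> \<longleftrightarrow> u \<ominus>\<^bsub>V\<^esub> v \<in> K"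
      using cring.ses_exact[OF int_is_cring, OF s, of "u \<ominus>\<^bsub>V\<^esub> v"] cring.ses_comp[OF int_is_cring, OF s] uv V by auto
    also have "\<dots> \<longleftrightarrow> \<sigma> (u \<oplus>\<^bsub>V\<^esub> (\<ominus>\<^bsub>\<Z>\<^esub> \<one>\<^bsub>\<Z>\<^esub>) \<odot>\<^bsub>V\<^esub> v) = \<zero>\<^bsub>A\<^esub>"
      unfolding K_def cring.a_kernel_iff[OF int_is_cring] using uv V by (simp add: cring.module_minus_eq_smult[OF int_is_cring])
    also have "\<sigma> (u \<oplus>\<^bsub>V\<^esub> (\<ominus>\<^bsub>\<Z>\<^esub> \<one>\<^bsub>\<Z>\<^esub>) \<odot>\<^bsub>V\<^esub> v) = \<sigma> u \<oplus>\<^bsub>A\<^esub> (\<ominus>\<^bsub>\<Z>\<^esub> \<one>\<^bsub>\<Z>\<^esub>) \<odot>\<^bsub>A\<^esub> \<sigma> v"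
      using cring.mod_hom_add[OF int_is_cring, OF hom, of u "(\<ominus>\<^bsub>\<Z>\<^esub> \<one>\<^bsub>\<Z>\<^esub>) \<odot>\<^bsub>V\<^esub> v"] cring.mod_hom_smult[OF int_is_cring, OF hom, of "\<ominus>\<^bsub>\<Z>\<^esub> \<one>\<^bsub>\<Z>\<^esub>" v]
        that cring.submodule_smult[OF int_is_cring, OF VZ V, of "\<ominus>\<^bsub>\<Z>\<^esub> \<one>\<^bsub>\<Z>\<^esub>" v] by simp
    also have "\<dots> = \<sigma> u \<ominus>\<^bsub>A\<^esub> \<sigma> v"
      using cring.mod_hom_closed[OF int_is_cring, OF hom] that A by (simp add: cring.module_minus_eq_smult[OF int_is_cring])
    also have "\<dots> = \<zero>\<^bsub>A\<^esub> \<longleftrightarrow> \<sigma> u = \<sigma> v"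
      using cring.mod_hom_closed[OF int_is_cring, OF hom] that A by (simp add: cring.module_minus_eq_zero[OF int_is_cring])
    finally show ?thesis .
  qed
  have "(\<lambda>x. p (\<delta> x)) \<in> mod_hom \<Z> A D"
  proof (rule additive_mod_hom_int[OF A mD])
    fix x y assume xy: "x \<in> carrier A" "y \<in> carrier A"
    have "p (\<delta> (x \<oplus>\<^bsub>A\<^esub> y)) = p (\<delta> x \<oplus>\<^bsub>V\<^esub> \<delta> y)"
      using xy \<delta> cring.mod_hom_add[OF int_is_cring, OF hom, of "\<delta> x" "\<delta> y"] cring.submodule_add[OF int_is_cring, OF VZ V]
      by (subst p_eq) simp_all
    then show "p (\<delta> (x \<oplus>\<^bsub>A\<^esub> y)) = p (\<delta> x) \<oplus>\<^bsub>D\<^esub> p (\<delta> y)"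
      using cring.mod_hom_add[OF int_is_cring, OF pD] \<delta> xy by simp
  qed (use \<delta> cring.mod_hom_closed[OF int_is_cring, OF pD] in auto)
  moreover have "inj_on (\<lambda>x. p (\<delta> x)) (carrier A)"
    using p_eq \<delta> by (intro inj_onI) metis
  moreover have "\<forall>q\<in>carrier D. finite {m. q m \<noteq> 0}"
    using D by (auto simp: cV supp_def subset_eq)
  ultimately show ?thesis using bD by blast
qed

text \<open>\<open>E\<close> is \<open>Hom\<^sub>\<int>(R, D)\<close> for a divisible hull \<open>D\<close> of \<open>N\<close>.\<close>

lemma (in cring) ex_baer_hull:
  fixes N :: "('a, 'm) module"
  assumes N: "module R N"
  shows "\<exists>(E :: ('a, 'a \<Rightarrow> 'm \<Rightarrow> rat) module) e. baer E \<and>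
    carrier E \<subseteq> {\<phi> \<in> extensional (carrier R). \<forall>r\<in>carrier R. finite {m. \<phi> r m \<noteq> 0}} \<and>
    e \<in> mod_hom R N E \<and> inj_on e (carrier N)"
proof -
  interpret N: module R N by fact
  note mN = module_int_module[OF module_abelian_group[OF N]] and mR = module_int_module[OF abelian_group_axioms]
  obtain D :: "(int, 'm \<Rightarrow> rat) module" and d where D: "cring.baer \<Z> D"
    "\<And>q. q \<in> carrier D \<Longrightarrow> finite {m. q m \<noteq> 0}"
    "d \<in> mod_hom \<Z> (int_module N) D" "inj_on d (carrier N)"
    using ex_divisible_hull[OF mN] by (metis int_module_simps(1))
  note mD = cring.baer_module[OF int_is_cring, OF D(1)]
  define H where "H = hom_module \<Z> (int_module R) D"
  have mH: "module \<Z> H" unfolding H_def by (rule cring.module_hom_module[OF int_is_cring, OF mR mD])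
  define E :: "('a, 'a \<Rightarrow> 'm \<Rightarrow> rat) module" where
    "E = \<lparr>carrier = carrier H, monoid.mult = undefined, one = undefined, ring.zero = \<zero>\<^bsub>H\<^esub>, add = (\<oplus>\<^bsub>H\<^esub>),
       smult = (\<lambda>s \<phi>. \<lambda>r\<in>carrier R. \<phi> (r \<otimes> s))\<rparr>"
  have cE: "\<phi> \<in> carrier E \<longleftrightarrow> \<phi> \<in> extensional (carrier R) \<and> (\<forall>r\<in>carrier R. \<phi> r \<in> carrier D)
      \<and> (\<forall>r\<in>carrier R. \<forall>s\<in>carrier R. \<phi> (r \<oplus> s) = \<phi> r \<oplus>\<^bsub>D\<^esub> \<phi> s)" for \<phi>
    using additive_mod_hom_int[OF mR mD, of \<phi>] by (auto simp: E_def H_def mod_hom_def)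
  have oE: "\<phi> \<oplus>\<^bsub>E\<^esub> \<psi> = (\<lambda>r\<in>carrier R. \<phi> r \<oplus>\<^bsub>D\<^esub> \<psi> r)" "s \<odot>\<^bsub>E\<^esub> \<phi> = (\<lambda>r\<in>carrier R. \<phi> (r \<otimes> s))" for \<phi> \<psi> s
    by (simp_all add: E_def H_def)
  have mE: "module R E"
  proof (rule moduleI[OF cring_axioms])
    show "abelian_group E"
    proof -
      interpret H: abelian_group H by (rule cring.module_abelian_group[OF int_is_cring, OF mH])
      have [simp]: "carrier E = carrier H" "\<zero>\<^bsub>E\<^esub> = \<zero>\<^bsub>H\<^esub>" "x \<oplus>\<^bsub>E\<^esub> y = x \<oplus>\<^bsub>H\<^esub> y" for x y
        by (simp_all add: E_def)
      show ?thesis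
        by (rule abelian_groupI) (auto simp del: hom_module_simps simp: H.a_ac intro!: bexI[of _ "\<ominus>\<^bsub>H\<^esub> _"] H.l_neg)
    qed
  qed (auto simp: cE oE m_assoc l_distr r_distr intro!: extensionalityI[where A = "carrier R"])
  have "baer E"
    unfolding baer_def
  proof (intro conjI allI impI mE)
    fix \<aa> f
    assume "submodule \<aa> R (regular_module R) \<and> f \<in> mod_hom R (regular_module R\<lparr>carrier := \<aa>\<rparr>) E"
    then have a: "submodule \<aa> R (regular_module R)" and f: "f \<in> mod_hom R (regular_module R\<lparr>carrier := \<aa>\<rparr>) E"
      by auto
    note aR = submodule_subset[OF a module_regular, simplified]
    have fE: "f r \<in> carrier E" if "r \<in> \<aa>" for r using mod_hom_closed[OF f] that by simp
    have "abelian_group (regular_module R\<lparr>carrier := \<aa>\<rparr>)"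
      using submodule_module[OF a module_regular] by (rule module_abelian_group)
    note mA = module_int_module[OF this]
    \<comment> \<open>Adjunction: a linear map into Hom(R, D) amounts to an additive map into
      \<open>D\<close>, by evaluation at \<one>. The extension of that additive map to
      \<open>R\<close> is itself the element \<open>y\<close> sought.\<close>
    have "(\<lambda>r. f r \<one>) \<in> mod_hom \<Z> (int_module (regular_module R\<lparr>carrier := \<aa>\<rparr>)) D"
      by (rule additive_mod_hom_int[OF mA mD])
        (use fE in \<open>auto simp: cE mod_hom_add[OF f, simplified] oE\<close>)
    moreover have "(\<lambda>r. r) \<in> mod_hom \<Z> (int_module (regular_module R\<lparr>carrier := \<aa>\<rparr>)) (int_module R)"
      by (rule additive_mod_hom_int[OF mA mR]) (use aR in auto)
    moreover have "inj_on (\<lambda>r. r) (carrier (int_module (regular_module R\<lparr>carrier := \<aa>\<rparr>)))" by simp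
    ultimately have "\<exists>h\<in>mod_hom \<Z> (int_module R) D. \<forall>a\<in>\<aa>. h a = f a \<one>"
      using cring.baer_extend[OF int_is_cring, OF D(1) mA mR, of "\<lambda>r. r" "\<lambda>r. f r \<one>"] by simp
    then obtain \<Phi> where \<Phi>: "\<Phi> \<in> mod_hom \<Z> (int_module R) D" "\<And>r. r \<in> \<aa> \<Longrightarrow> \<Phi> r = f r \<one>"
      by blast
    define y where "y = restrict \<Phi> (carrier R)"
    have y: "y \<in> carrier E"
      using cring.mod_hom_closed[OF int_is_cring, OF \<Phi>(1)] cring.mod_hom_add[OF int_is_cring, OF \<Phi>(1)] by (auto simp: cE y_def)
    have "f r = r \<odot>\<^bsub>E\<^esub> y" if r: "r \<in> \<aa>" for r
    proof (rule extensionalityI[where A = "carrier R"])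
      fix s assume s: "s \<in> carrier R"
      have "f (s \<otimes> r) = s \<odot>\<^bsub>E\<^esub> f r" using mod_hom_smult[OF f s] r by simp
      then have "f (s \<otimes> r) \<one> = f r s" using s by (simp add: oE)
      moreover have "s \<otimes> r \<in> \<aa>" using submodule_smult[OF a module_regular s r] by simp
      ultimately show "f r s = (r \<odot>\<^bsub>E\<^esub> y) s" using \<Phi>(2)[of "s \<otimes> r"] s r aR by (auto simp: oE y_def)
    qed (use fE[OF r] in \<open>auto simp: cE oE\<close>)
    then show "\<exists>y\<in>carrier E. \<forall>r\<in>\<aa>. f r = r \<odot>\<^bsub>E\<^esub> y" using y by blast
  qed
  moreover have "carrier E \<subseteq> {\<phi> \<in> extensional (carrier R). \<forall>r\<in>carrier R. finite {m. \<phi> r m \<noteq> 0}}"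
    using D(2) by (auto simp: cE)
  moreover have "(\<lambda>n. \<lambda>r\<in>carrier R. d (r \<odot>\<^bsub>N\<^esub> n)) \<in> mod_hom R N E"
    using cring.mod_hom_closed[OF int_is_cring, OF D(3)] cring.mod_hom_add[OF int_is_cring, OF D(3)] N
    by (intro mod_homI) (auto simp: cE oE module_add_smult module_smult_add module_mult_smult
        intro!: extensionalityI[where A = "carrier R"])
  moreover have "inj_on (\<lambda>n. \<lambda>r\<in>carrier R. d (r \<odot>\<^bsub>N\<^esub> n)) (carrier N)"
  proof (rule inj_onI)
    fix x y assume xy: "x \<in> carrier N" "y \<in> carrier N"
      and eq: "(\<lambda>r\<in>carrier R. d (r \<odot>\<^bsub>N\<^esub> x)) = (\<lambda>r\<in>carrier R. d (r \<odot>\<^bsub>N\<^esub> y))"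
    have "d x = d y" using fun_cong[OF eq, of \<one>] xy N by simp
    then show "x = y" using xy D(4) by (auto dest: inj_onD)
  qed
  ultimately show ?thesis by blast
qed

section \<open>Coding hulls inside the universe\<close>

lemma ex_inj_sequences: "\<exists>s :: (nat \<Rightarrow> 'a univ) \<Rightarrow> 'a univ. inj s"
proof -
  have inf: "\<not> finite (UNIV :: 'a list set)" by (rule infinite_UNIV_listI)
  then obtain g :: "nat \<Rightarrow> 'a list" where g: "inj g" using infinite_countable_subset by blast
  \<comment> \<open>The lists form an infinite set, equipotent with its square; so a sequence of
    sets of lists can be stored as one set of tagged lists.\<close>
  obtain h :: "'a list \<times> 'a list \<Rightarrow> 'a list" where h: "bij_betw h (UNIV \<times> UNIV) UNIV"
    using card_of_Times_same_infinite[OF inf] unfolding card_of_ordIso[symmetric] by (auto simp del: UNIV_Times_UNIV)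
  define k where "k n l = h (g n, l)" for n l
  have k: "k n l = k n' l' \<longleftrightarrow> n = n' \<and> l = l'" for n l n' l'
    unfolding k_def by (simp add: inj_eq[OF g] inj_eq[OF bij_betw_imp_inj_on[OF h, unfolded UNIV_Times_UNIV]])
  have "inj (\<lambda>f. {k n l | n l. l \<in> f n})"
  proof (rule injI, rule ext)
    fix f f' :: "nat \<Rightarrow> 'a univ" and n
    assume eq: "{k n l | n l. l \<in> f n} = {k n l | n l. l \<in> f' n}"
    have "l \<in> f n \<longleftrightarrow> l \<in> f' n" for l
      using eq[unfolded set_eq_iff, rule_format, of "k n l"] by (auto simp: k)
    then show "f n = f' n" by blast
  qed
  then show ?thesis by blast
qed

text \<open>A finitely supported function is determined by its graph over the support. An
  enumeration turns this finite set into a sequence, once each pair in it is coded as an element of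
  the universe.\<close>

lemma ex_inj_finite_support: "\<exists>s :: ('a univ \<Rightarrow> rat) \<Rightarrow> 'a univ. inj_on s {q. finite {m. q m \<noteq> 0}}"
proof -
  obtain s :: "(nat \<Rightarrow> 'a univ) \<Rightarrow> 'a univ" where s: "inj s" using ex_inj_sequences by blast
  \<comment> \<open>Slot 0 stores the set \<open>u\<close>; the rational is stored as the position
    of the only nonempty slot after it.\<close>
  define c where "c = (\<lambda>(u, r :: rat). s (\<lambda>n. if n = 0 then u else if n = Suc (to_nat r) then {[]} else {}))"
  have "inj c"
  proof (rule injI)
    fix x y assume "c x = c y"
    moreover obtain u r v t where xy: "x = (u, r)" "y = (v, t)" by (metis surj_pair)
    ultimately have eq: "(\<lambda>n. if n = 0 then u else if n = Suc (to_nat r) then {[]} else {})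
      = (\<lambda>n. if n = 0 then v else if n = Suc (to_nat t) then {[]} else {})"
      using injD[OF s] by (auto simp: c_def)
    have "u = v" using fun_cong[OF eq, of 0] by simp
    moreover have "r = t" using fun_cong[OF eq, of "Suc (to_nat r)"] by (auto split: if_splits)
    ultimately show "x = y" using xy by simp
  qed
  \<comment> \<open>The extra pair keeps \<open>G q\<close> nonempty when q = 0, so that the range
    of its enumeration is \<open>G q\<close>. It lies on the graph of \<open>q\<close>, so first
    entries still determine second ones.\<close>
  define G where "G q = insert ({}, q {}) ((\<lambda>m. (m, q m)) ` {m. q m \<noteq> 0})" for q :: "'a univ \<Rightarrow> rat"
  have G: "q = q'" if "G q = G q'" for q q'
  proof
    fix m
    have 1: "(m, t) \<in> G q \<Longrightarrow> t = q m" "(m, t) \<in> G q' \<Longrightarrow> t = q' m" "q m \<noteq> 0 \<Longrightarrow> (m, q m) \<in> G q"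
      "q' m \<noteq> 0 \<Longrightarrow> (m, q' m) \<in> G q'" for t by (auto simp: G_def)
    then show "q m = q' m" using that by metis
  qed
  have "inj_on (\<lambda>q. s (\<lambda>n. c (from_nat_into (G q) n))) {q. finite {m. q m \<noteq> 0}}"
  proof (rule inj_onI, simp)
    fix q q' assume f: "finite {m. q m \<noteq> 0}" "finite {m. q' m \<noteq> 0}"
      and "s (\<lambda>n. c (from_nat_into (G q) n)) = s (\<lambda>n. c (from_nat_into (G q') n))"
    then have "from_nat_into (G q) n = from_nat_into (G q') n" for n
      using fun_cong[OF injD[OF s], of "\<lambda>n. c (from_nat_into (G q) n)" "\<lambda>n. c (from_nat_into (G q') n)" n]
        injD[OF \<open>inj c\<close>] by blast
    then have "range (from_nat_into (G q)) = range (from_nat_into (G q'))" by simp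
    moreover have "countable (G q)" "countable (G q')" "G q \<noteq> {}" "G q' \<noteq> {}"
      using f by (auto simp: G_def intro!: countable_finite)
    ultimately have "G q = G q'" by simp
    then show "q = q'" by (rule G)
  qed
  then show ?thesis by blast
qed

lemma (in cring) ex_baer_hull_univ:
  fixes N :: "('a, 'a univ) module"
  assumes N: "module R N"
  shows "\<exists>(E :: ('a, 'a univ) module) e. baer E \<and> e \<in> mod_hom R N E \<and> inj_on e (carrier N)"
proof -
  obtain E :: "('a, 'a \<Rightarrow> 'a univ \<Rightarrow> rat) module" and e where E: "baer E"
    "carrier E \<subseteq> {\<phi> \<in> extensional (carrier R). \<forall>r\<in>carrier R. finite {m. \<phi> r m \<noteq> 0}}"
    "e \<in> mod_hom R N E" "inj_on e (carrier N)"
    using ex_baer_hull[OF N] by blast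
  obtain s :: "('a univ \<Rightarrow> rat) \<Rightarrow> 'a univ" where s: "inj_on s {q. finite {m. q m \<noteq> 0}}"
    using ex_inj_finite_support by blast
  \<comment> \<open>The lists starting with \<open>a\<close> carry the code of the value at
    \<open>a\<close>, so all values of \<phi> fit into one set of lists.\<close>
  define t where "t \<phi> = {a # l | a l. a \<in> carrier R \<and> l \<in> s (\<phi> a)}" for \<phi>
  have t: "inj_on t (carrier E)"
  proof (rule inj_onI)
    fix \<phi> \<psi> assume p: "\<phi> \<in> carrier E" "\<psi> \<in> carrier E" and eq: "t \<phi> = t \<psi>"
    show "\<phi> = \<psi>"
    proof (rule extensionalityI[where A = "carrier R"])
      fix a assume a: "a \<in> carrier R"
      have "l \<in> s (\<phi> a) \<longleftrightarrow> l \<in> s (\<psi> a)" for l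
        using eq[unfolded set_eq_iff, rule_format, of "a # l"] a by (auto simp: t_def)
      then have "s (\<phi> a) = s (\<psi> a)" by blast
      then show "\<phi> a = \<psi> a" using p E(2) a by (intro inj_onD[OF s]) auto
    qed (use p E(2) in auto)
  qed
  obtain Q :: "('a, 'a univ) module" where Q: "module R Q" "t \<in> mod_hom R E Q" "t ` carrier E = carrier Q"
    using ex_module_copy[OF baer_module[OF E(1)] t] by blast
  have "baer Q" by (rule baer_iso[OF E(1) Q(2) t Q(3,1)])
  moreover have "(\<lambda>n. t (e n)) \<in> mod_hom R N Q" by (rule mod_hom_comp[OF E(3) Q(2)])
  moreover have "inj_on (\<lambda>n. t (e n)) (carrier N)"
    using E(4) t mod_hom_closed[OF E(3)] by (simp add: inj_on_def)
  ultimately show ?thesis by blast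
qed

section \<open>Ext by injective coresolutions of the second argument\<close>

text \<open>The coresolved module is \<open>J 0\<close>, so that cocycles of degree \<open>j\<close> take values in \<open>J (j + 1)\<close>.\<close>

locale coresolution = cring R for R (structure) +
  fixes J :: "nat \<Rightarrow> ('a, 'a univ) module" and \<delta> :: "nat \<Rightarrow> 'a univ \<Rightarrow> 'a univ"
  assumes J_module [simp]: "\<And>j. module R (J j)"
    and \<delta>_hom: "\<And>j. \<delta> j \<in> mod_hom R (J j) (J (Suc j))"
    and \<delta>_inj: "inj_on (\<delta> 0) (carrier (J 0))"
    and \<delta>_exact: "\<And>j. \<delta> j ` carrier (J j) = a_kernel (J (Suc j)) (J (Suc (Suc j))) (\<delta> (Suc j))"
    and J_baer: "\<And>j. baer (J (Suc j))"

text \<open>Repeated embedding into Baer modules, continuing each time with the cokernel. Both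
  operations stay in the universe.\<close>

lemma (in cring) ex_coresolution:
  fixes N :: "('a, 'a univ) module"
  assumes N: "module R N"
  shows "\<exists>J \<delta>. coresolution R J \<delta> \<and> J 0 = N"
proof -
  have step: "\<exists>(I :: ('a, 'a univ) module) e p (Q :: ('a, 'a univ) module). baer I \<and> ses N e I p Q"
    if N: "module R N" for N :: "('a, 'a univ) module"
  proof -
    obtain I :: "('a, 'a univ) module" and e where I: "baer I" "e \<in> mod_hom R N I" "inj_on e (carrier N)"
      using ex_baer_hull_univ[OF N] by blast
    note mI = baer_module[OF I(1)]
    obtain p and Q :: "('a, 'a univ) module" where s: "ses (I\<lparr>carrier := e ` carrier N\<rparr>) (\<lambda>x. x) I p Q"
      using ses_submodule[OF mI submodule_image[OF I(2) N mI]] by blast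
    have "ses N e I p Q"
    proof (rule sesI[OF N mI ses_modules(3)[OF s] I(2) ses_homs(2)[OF s]])
      show "a = \<zero>\<^bsub>N\<^esub>" if "a \<in> carrier N" "e a = \<zero>\<^bsub>I\<^esub>" for a
        using inj_onD[OF I(3), of a "\<zero>\<^bsub>N\<^esub>"] that N mI mod_hom_zero[OF I(2)] by simp
      show "\<exists>a\<in>carrier N. e a = b" if "b \<in> carrier I" "p b = \<zero>\<^bsub>Q\<^esub>" for b
        using ses_exact[OF s that] by auto
    qed (use ses_comp[OF s] ses_surj[OF s] in auto)
    then show ?thesis using I by blast
  qed
  define good where "good = (\<lambda>(N :: ('a, 'a univ) module) (I :: ('a, 'a univ) module, e, p, Q :: ('a, 'a univ) module). baer I \<and> ses N e I p Q)"
  have "\<exists>c. \<forall>N. module R N \<longrightarrow> good N (c N)"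
  proof (intro choice allI)
    fix N :: "('a, 'a univ) module"
    show "\<exists>c. module R N \<longrightarrow> good N c"
    proof (cases "module R N")
      case True
      from step[OF this] obtain I :: "('a, 'a univ) module" and e p and Q :: "('a, 'a univ) module"
        where "baer I \<and> ses N e I p Q" by blast
      then have "good N (I, e, p, Q)" by (simp add: good_def)
      then show ?thesis by blast
    qed simp
  qed
  then obtain c where c: "\<And>N. module R N \<Longrightarrow> good N (c N)" by blast
  define E e p Q where "E N = fst (c N)" and "e N = fst (snd (c N))"
    and "p N = fst (snd (snd (c N)))" and "Q N = snd (snd (snd (c N)))" for N
  have c: "baer (E N)" "ses N (e N) (E N) (p N) (Q N)" if "module R N" for N
    using c[OF that] by (auto simp: good_def E_def e_def p_def Q_def split: prod.splits)
  \<comment> \<open>\<open>C j\<close> is the j-th cosyzygy. The differential out of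
    \<open>E (C i)\<close> passes through the next one, \<open>C (Suc i)\<close>.\<close>
  define C where "C = rec_nat N (\<lambda>_. Q)"
  have C: "C 0 = N" "C (Suc j) = Q (C j)" for j by (simp_all add: C_def)
  have mC: "module R (C j)" for j
    by (induction j) (auto simp: C N intro: ses_modules(3)[OF c(2)])
  note s = c(2)[OF mC, folded C(2)]
  define J where "J j = (case j of 0 \<Rightarrow> N | Suc i \<Rightarrow> E (C i))" for j
  define \<delta> where "\<delta> j = (case j of 0 \<Rightarrow> e N | Suc i \<Rightarrow> (\<lambda>x. e (C (Suc i)) (p (C i) x)))" for j
  have J: "J 0 = N" "J (Suc i) = E (C i)" "\<delta> 0 = e N" "\<delta> (Suc i) = (\<lambda>x. e (C (Suc i)) (p (C i) x))" for i
    by (simp_all add: J_def \<delta>_def)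
  have e0: "e (C j) y = \<zero>\<^bsub>E (C j)\<^esub> \<longleftrightarrow> y = \<zero>\<^bsub>C j\<^esub>" if "y \<in> carrier (C j)" for j y
    using inj_onD[OF ses_inj[OF s], of j y "\<zero>\<^bsub>C j\<^esub>"] that mC ses_modules[OF s]
      mod_hom_zero[OF ses_homs(1)[OF s]] by auto
  have ker: "a_kernel (J (Suc j)) (J (Suc (Suc j))) (\<delta> (Suc j)) = e (C j) ` carrier (C j)" for j
  proof -
    have "x \<in> a_kernel (J (Suc j)) (J (Suc (Suc j))) (\<delta> (Suc j)) \<longleftrightarrow> x \<in> carrier (E (C j)) \<and> p (C j) x = \<zero>\<^bsub>C (Suc j)\<^esub>" for x
      using e0[OF mod_hom_closed[OF ses_homs(2)[OF s[of j]], of x]] by (auto simp: a_kernel_iff J)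
    moreover have "x \<in> e (C j) ` carrier (C j) \<longleftrightarrow> x \<in> carrier (E (C j)) \<and> p (C j) x = \<zero>\<^bsub>C (Suc j)\<^esub>" for x
    proof
      assume "x \<in> e (C j) ` carrier (C j)"
      then obtain a where "a \<in> carrier (C j)" "x = e (C j) a" by blast
      then show "x \<in> carrier (E (C j)) \<and> p (C j) x = \<zero>\<^bsub>C (Suc j)\<^esub>"
        using ses_comp[OF s[of j]] mod_hom_closed[OF ses_homs(1)[OF s[of j]]] by simp
    next
      assume "x \<in> carrier (E (C j)) \<and> p (C j) x = \<zero>\<^bsub>C (Suc j)\<^esub>"
      then have "\<exists>a\<in>carrier (C j). e (C j) a = x" using ses_exact[OF s[of j], of x] by simp
      then show "x \<in> e (C j) ` carrier (C j)" by (metis imageI)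
    qed
    ultimately show ?thesis by (intro equalityI subsetI) simp_all
  qed
  have "coresolution R J \<delta>"
  proof (intro coresolution.intro coresolution_axioms.intro cring_axioms)
    show "module R (J j)" for j using N ses_modules(2)[OF s] by (cases j) (auto simp: J)
    show "\<delta> j \<in> mod_hom R (J j) (J (Suc j))" for j
      using ses_homs(1)[OF s, of 0] mod_hom_comp[OF ses_homs(2)[OF s] ses_homs(1)[OF s]]
      by (cases j) (auto simp: J C(1))
    show "inj_on (\<delta> 0) (carrier (J 0))" using ses_inj[OF s, of 0] by (simp add: J C(1))
    show "baer (J (Suc j))" for j using c(1) mC by (simp add: J)
    show "\<delta> j ` carrier (J j) = a_kernel (J (Suc j)) (J (Suc (Suc j))) (\<delta> (Suc j))" for j
    proof (cases j)
      case 0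
      then show ?thesis unfolding ker by (simp add: J C(1))
    next
      case (Suc i)
      have "p (C i) ` carrier (E (C i)) = carrier (C (Suc i))"
        using ses_surj[OF s[of i]] mod_hom_closed[OF ses_homs(2)[OF s[of i]]] by (intro equalityI subsetI) (auto simp: image_iff eq_commute)
      then show ?thesis unfolding ker by (simp add: Suc J image_image[symmetric])
    qed
  qed
  then show ?thesis using J(1) by blast
qed

section \<open>Cohomology of Hom(N, J)\<close>

context coresolution
begin

lemma \<delta>_\<delta>: "x \<in> carrier (J j) \<Longrightarrow> \<delta> (Suc j) (\<delta> j x) = \<zero>\<^bsub>J (Suc (Suc j))\<^esub>"
  using \<delta>_exact[of j] by (auto simp: set_eq_iff a_kernel_iff)

definition cocycle where
  "cocycle N j f \<longleftrightarrow> f \<in> mod_hom R N (J (Suc j)) \<and> (\<forall>x\<in>carrier N. \<delta> (Suc j) (f x) = \<zero>\<^bsub>J (Suc (Suc j))\<^esub>)"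

definition coboundary where
  "coboundary N j f \<longleftrightarrow> (\<exists>g\<in>mod_hom R N (J j). \<forall>x\<in>carrier N. f x = \<delta> j (g x))"

text \<open>For j > 0 this is the vanishing of Ext^j(N, J 0). In degree 0 the coboundaries come from
  maps into \<open>J 0\<close>, so the complex is the augmented one and Hom(N, J 0) is divided
  out.\<close>

definition ext_zero where
  "ext_zero N j \<longleftrightarrow> (\<forall>f. cocycle N j f \<longrightarrow> coboundary N j f)"

lemma cocycle_hom: "cocycle N j f \<Longrightarrow> f \<in> mod_hom R N (J (Suc j))"
  by (simp add: cocycle_def)

lemma cocycle_minus:
  assumes "cocycle N j f" "cocycle N j g" "module R N"
  shows "cocycle N j (\<lambda>x. f x \<ominus>\<^bsub>J (Suc j)\<^esub> g x)"
  using assms mod_hom_diff[of f N "J (Suc j)" g]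
  by (simp add: cocycle_def mod_hom_minus[OF \<delta>_hom] mod_hom_closed[of f N] mod_hom_closed[of g N])

lemma cocycle_plus:
  assumes "cocycle N j f" "cocycle N j g"
  shows "cocycle N j (\<lambda>x. f x \<oplus>\<^bsub>J (Suc j)\<^esub> g x)"
  using assms mod_hom_plus[of f N "J (Suc j)" g]
  by (simp add: cocycle_def mod_hom_add[OF \<delta>_hom] mod_hom_closed[of f N] mod_hom_closed[of g N])

lemma cocycle_scale:
  assumes "cocycle N j f" "r \<in> carrier R"
  shows "cocycle N j (\<lambda>x. r \<odot>\<^bsub>J (Suc j)\<^esub> f x)"
  using assms mod_hom_scale[of f N "J (Suc j)" r]
  by (simp add: cocycle_def mod_hom_smult[OF \<delta>_hom] mod_hom_closed[of f N])

lemma cocycle_zero: "cocycle N j (\<lambda>x. \<zero>\<^bsub>J (Suc j)\<^esub>)"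
  by (simp add: cocycle_def mod_hom_const_zero mod_hom_zero[OF \<delta>_hom])

lemma cocycle_comp:
  assumes "cocycle N j f" "p \<in> mod_hom R L N"
  shows "cocycle L j (\<lambda>x. f (p x))"
  using assms mod_hom_comp[OF assms(2), of f "J (Suc j)"] by (simp add: cocycle_def mod_hom_closed)

lemma coboundary_comp:
  assumes "coboundary N j f" "p \<in> mod_hom R L N"
  shows "coboundary L j (\<lambda>x. f (p x))"
proof -
  obtain g where "g \<in> mod_hom R N (J j)" "\<forall>x\<in>carrier N. f x = \<delta> j (g x)"
    using assms(1) unfolding coboundary_def by blast
  then show ?thesis unfolding coboundary_def
    using mod_hom_comp[OF assms(2)] mod_hom_closed[OF assms(2)] by (intro bexI[of _ "\<lambda>x. g (p x)"]) auto
qed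

lemma coboundary_cong:
  "coboundary N j f \<Longrightarrow> (\<And>x. x \<in> carrier N \<Longrightarrow> f' x = f x) \<Longrightarrow> coboundary N j f'"
  by (auto simp: coboundary_def)

lemma coboundary_plus:
  assumes "coboundary N j f" "coboundary N j g"
  shows "coboundary N j (\<lambda>x. f x \<oplus>\<^bsub>J (Suc j)\<^esub> g x)"
proof -
  obtain u v where uv: "u \<in> mod_hom R N (J j)" "\<And>x. x \<in> carrier N \<Longrightarrow> f x = \<delta> j (u x)"
    "v \<in> mod_hom R N (J j)" "\<And>x. x \<in> carrier N \<Longrightarrow> g x = \<delta> j (v x)"
    using assms unfolding coboundary_def by blast
  then show ?thesis unfolding coboundary_def
    by (intro bexI[of _ "\<lambda>x. u x \<oplus>\<^bsub>J j\<^esub> v x"] mod_hom_plus)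
      (auto simp: mod_hom_add[OF \<delta>_hom] mod_hom_closed[OF uv(1)] mod_hom_closed[OF uv(3)])
qed

lemma coboundary_scale:
  assumes "coboundary N j f" "r \<in> carrier R"
  shows "coboundary N j (\<lambda>x. r \<odot>\<^bsub>J (Suc j)\<^esub> f x)"
proof -
  obtain u where u: "u \<in> mod_hom R N (J j)" "\<And>x. x \<in> carrier N \<Longrightarrow> f x = \<delta> j (u x)"
    using assms unfolding coboundary_def by blast
  then show ?thesis unfolding coboundary_def
    using assms(2) by (intro bexI[of _ "\<lambda>x. r \<odot>\<^bsub>J j\<^esub> u x"] mod_hom_scale)
      (auto simp: mod_hom_smult[OF \<delta>_hom] mod_hom_closed[OF u(1)])
qed

lemma coboundary_zero: "coboundary N j (\<lambda>x. \<zero>\<^bsub>J (Suc j)\<^esub>)"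
  unfolding coboundary_def
  by (intro bexI[of _ "\<lambda>x. \<zero>\<^bsub>J j\<^esub>"]) (auto simp: mod_hom_zero[OF \<delta>_hom] mod_hom_const_zero)

text \<open>Left exactness of Hom: a map killed by \<open>\<delta> (Suc 0)\<close> lands in the
  image of the injective map \<open>\<delta> 0\<close>, hence factors through
  \<open>J 0\<close>.\<close>

lemma ext_zero_0:
  assumes N: "module R N"
  shows "ext_zero N 0"
  unfolding ext_zero_def
proof (intro allI impI)
  fix f assume f: "cocycle N 0 f"
  let ?K = "J (Suc 0)\<lparr>carrier := \<delta> 0 ` carrier (J 0)\<rparr>"
  let ?i = "inv_into (carrier (J 0)) (\<delta> 0)"
  have i: "?i \<in> mod_hom R ?K (J 0)"
    by (rule mod_hom_inverse) (use \<delta>_hom[of 0] \<delta>_inj in \<open>auto intro: mod_hom_carrier_update\<close>)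
  have im: "f ` carrier N \<subseteq> \<delta> 0 ` carrier (J 0)"
    unfolding \<delta>_exact using f by (auto simp: cocycle_def a_kernel_iff mod_hom_closed)
  have "(\<lambda>x. ?i (f x)) \<in> mod_hom R N (J 0)"
    by (rule mod_hom_comp[OF mod_hom_carrier_update[OF cocycle_hom[OF f] im] i])
  moreover have "f x = \<delta> 0 (?i (f x))" if "x \<in> carrier N" for x
    using im that by (simp add: f_inv_into_f image_subset_iff)
  ultimately show "coboundary N 0 f"
    unfolding coboundary_def by (intro bexI[of _ "\<lambda>x. ?i (f x)"]) auto
qed

section \<open>Connecting maps and long exact sequences\<close>

text \<open>The connecting homomorphism of a short exact sequence, as a relation between cocycles.\<close>

definition connect where
  "connect A i B p j f f' \<longleftrightarrow> (\<exists>g\<in>mod_hom R B (J (Suc j)).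
     (\<forall>a\<in>carrier A. g (i a) = f a) \<and> (\<forall>b\<in>carrier B. \<delta> (Suc j) (g b) = f' (p b)))"

lemma connect_plus:
  assumes s: "ses A i B p C" and "connect A i B p j f f'" "connect A i B p j g g'"
  shows "connect A i B p j (\<lambda>x. f x \<oplus>\<^bsub>J (Suc j)\<^esub> g x) (\<lambda>x. f' x \<oplus>\<^bsub>J (Suc (Suc j))\<^esub> g' x)"
proof -
  obtain u v where uv: "u \<in> mod_hom R B (J (Suc j))" "\<And>a. a \<in> carrier A \<Longrightarrow> u (i a) = f a"
    "\<And>b. b \<in> carrier B \<Longrightarrow> \<delta> (Suc j) (u b) = f' (p b)"
    "v \<in> mod_hom R B (J (Suc j))" "\<And>a. a \<in> carrier A \<Longrightarrow> v (i a) = g a"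
    "\<And>b. b \<in> carrier B \<Longrightarrow> \<delta> (Suc j) (v b) = g' (p b)"
    using assms(2,3) unfolding connect_def by metis
  show ?thesis unfolding connect_def
    using uv(2,3,5,6) by (intro bexI[OF _ mod_hom_plus[OF uv(1,4)]])
      (simp_all add: mod_hom_add[OF \<delta>_hom] mod_hom_closed[OF uv(1)] mod_hom_closed[OF uv(4)])
qed

lemma connect_scale:
  assumes "connect A i B p j f f'" "r \<in> carrier R"
  shows "connect A i B p j (\<lambda>x. r \<odot>\<^bsub>J (Suc j)\<^esub> f x) (\<lambda>x. r \<odot>\<^bsub>J (Suc (Suc j))\<^esub> f' x)"
proof -
  obtain u where u: "u \<in> mod_hom R B (J (Suc j))" "\<And>a. a \<in> carrier A \<Longrightarrow> u (i a) = f a"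
    "\<And>b. b \<in> carrier B \<Longrightarrow> \<delta> (Suc j) (u b) = f' (p b)"
    using assms(1) unfolding connect_def by metis
  show ?thesis unfolding connect_def
    using u(2,3) assms(2) by (intro bexI[OF _ mod_hom_scale[OF u(1) assms(2)]])
      (simp_all add: mod_hom_smult[OF \<delta>_hom] mod_hom_closed[OF u(1)])
qed

lemma connect_restriction:
  assumes "cocycle B j h"
  shows "connect A i B p j (\<lambda>a. h (i a)) (\<lambda>c. \<zero>\<^bsub>J (Suc (Suc j))\<^esub>)"
  using assms unfolding connect_def cocycle_def by blast

text \<open>Injectivity of \<open>J (Suc j)\<close> extends \<open>f\<close> to a map
  \<open>g\<close> on \<open>B\<close>; the differential composed with \<open>g\<close> vanishes on
  \<open>A\<close> because \<open>f\<close> is a cocycle, so it descends to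
  \<open>C\<close>.\<close>

lemma connect_exists:
  assumes s: "ses A i B p C" and f: "cocycle A j f"
  shows "\<exists>f'. cocycle C (Suc j) f' \<and> connect A i B p j f f'"
proof -
  note m = ses_modules[OF s] and ip = ses_homs[OF s]
  obtain g where g: "g \<in> mod_hom R B (J (Suc j))" "\<And>a. a \<in> carrier A \<Longrightarrow> g (i a) = f a"
    using baer_extend[OF J_baer m(1,2) ip(1) ses_inj[OF s] cocycle_hom[OF f]] by blast
  obtain f' where f': "f' \<in> mod_hom R C (J (Suc (Suc j)))" "\<And>b. b \<in> carrier B \<Longrightarrow> f' (p b) = \<delta> (Suc j) (g b)"
    using ses_descend[OF s mod_hom_comp[OF g(1) \<delta>_hom] J_module] f g(2) by (auto simp: cocycle_def)
  have "\<delta> (Suc (Suc j)) (f' c) = \<zero>\<^bsub>J (Suc (Suc (Suc j)))\<^esub>" if c: "c \<in> carrier C" for c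
  proof -
    obtain b where "b \<in> carrier B" "p b = c" using ses_surj[OF s c] by blast
    then show ?thesis using f'(2) \<delta>_\<delta>[OF mod_hom_closed[OF g(1)]] by force
  qed
  then have "cocycle C (Suc j) f'" using f'(1) by (simp add: cocycle_def)
  moreover have "connect A i B p j f f'"
    using g f'(2) unfolding connect_def by (intro bexI[of _ g]) simp_all
  ultimately show ?thesis by blast
qed

text \<open>Exactness at the cohomology of \<open>C\<close>: a primitive of \<open>f' p\<close>
  restricts along \<open>i\<close> to a cocycle, since \<open>p i = 0\<close>.\<close>

lemma connect_surj:
  assumes s: "ses A i B p C" and f': "cocycle C (Suc j) f'" and cob: "coboundary B (Suc j) (\<lambda>b. f' (p b))"
  shows "\<exists>f. cocycle A j f \<and> connect A i B p j f f'"
proof -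
  obtain g where g: "g \<in> mod_hom R B (J (Suc j))" "\<And>b. b \<in> carrier B \<Longrightarrow> f' (p b) = \<delta> (Suc j) (g b)"
    using cob unfolding coboundary_def by blast
  have "cocycle A j (\<lambda>a. g (i a))"
    using mod_hom_comp[OF ses_homs(1)[OF s] g(1)] g(2)[symmetric] mod_hom_closed[OF ses_homs(1)[OF s]]
      ses_comp[OF s] mod_hom_zero[OF cocycle_hom[OF f'] ses_modules(3)[OF s]]
    by (simp add: cocycle_def)
  then show ?thesis using g unfolding connect_def by (metis (no_types, lifting))
qed

text \<open>If \<open>f\<close> has a primitive that is the restriction of \<open>h\<close>, then
  \<open>g - \<delta> h\<close> descends to \<open>C\<close> and is a primitive of
  \<open>f'\<close>. Asking for \<open>h\<close> on all of \<open>B\<close> covers degree 0, where a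
  primitive takes values in \<open>J 0\<close> and need not extend.\<close>

lemma connect_coboundary:
  assumes s: "ses A i B p C" and c: "connect A i B p j f f'"
    and h: "h \<in> mod_hom R B (J j)" "\<And>a. a \<in> carrier A \<Longrightarrow> f a = \<delta> j (h (i a))"
  shows "coboundary C (Suc j) f'"
proof -
  note m = ses_modules[OF s] and ip = ses_homs[OF s]
  obtain g where g: "g \<in> mod_hom R B (J (Suc j))" "\<And>a. a \<in> carrier A \<Longrightarrow> g (i a) = f a"
    "\<And>b. b \<in> carrier B \<Longrightarrow> \<delta> (Suc j) (g b) = f' (p b)"
    using c unfolding connect_def by blast
  let ?k = "\<lambda>b. g b \<ominus>\<^bsub>J (Suc j)\<^esub> \<delta> j (h b)"
  have "?k \<in> mod_hom R B (J (Suc j))"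
    by (rule mod_hom_diff[OF g(1) mod_hom_comp[OF h(1) \<delta>_hom] m(2) J_module])
  moreover have "?k (i a) = \<zero>\<^bsub>J (Suc j)\<^esub>" if "a \<in> carrier A" for a
    using g(2)[OF that] h(2)[OF that] mod_hom_closed[OF g(1) mod_hom_closed[OF ip(1) that]] by simp
  ultimately obtain k where k: "k \<in> mod_hom R C (J (Suc j))" "\<And>b. b \<in> carrier B \<Longrightarrow> k (p b) = ?k b"
    using ses_descend[OF s _ J_module] by (metis (no_types, lifting))
  have "f' c = \<delta> (Suc j) (k c)" if c: "c \<in> carrier C" for c
  proof -
    obtain b where b: "b \<in> carrier B" "p b = c" using ses_surj[OF s c] by blast
    have "\<delta> (Suc j) (k (p b)) = \<delta> (Suc j) (g b)"
      unfolding k(2)[OF b(1)]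
      using mod_hom_closed[OF g(1) b(1)] mod_hom_closed[OF h(1) b(1)] mod_hom_closed[OF \<delta>_hom]
      by (simp add: mod_hom_minus[OF \<delta>_hom] \<delta>_\<delta>)
    then show ?thesis using g(3) b by simp
  qed
  then show ?thesis using k(1) unfolding coboundary_def by blast
qed

text \<open>In positive degree the primitive takes values in an injective module and extends from
  \<open>A\<close> to \<open>B\<close>.\<close>

lemma connect_coboundary_Suc:
  assumes s: "ses A i B p C" and c: "connect A i B p (Suc j) f f'" and f: "coboundary A (Suc j) f"
  shows "coboundary C (Suc (Suc j)) f'"
proof -
  obtain h where h: "h \<in> mod_hom R A (J (Suc j))" "\<And>a. a \<in> carrier A \<Longrightarrow> f a = \<delta> (Suc j) (h a)"
    using f unfolding coboundary_def by blast
  obtain h' where h': "h' \<in> mod_hom R B (J (Suc j))" "\<And>a. a \<in> carrier A \<Longrightarrow> h' (i a) = h a"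
    using baer_extend[OF J_baer ses_modules(1,2)[OF s] ses_homs(1)[OF s] ses_inj[OF s] h(1)] by blast
  show ?thesis by (rule connect_coboundary[OF s c h'(1)]) (simp add: h(2) h'(2))
qed

text \<open>Exactness at the cohomology of \<open>A\<close>: subtracting the pullback of a primitive
  of \<open>f'\<close> turns the extension \<open>g\<close> of \<open>f\<close> into a cocycle
  without changing it on \<open>A\<close>.\<close>

lemma connect_lift:
  assumes s: "ses A i B p C" and c: "connect A i B p j f f'" and f': "coboundary C (Suc j) f'"
  shows "\<exists>h. cocycle B j h \<and> (\<forall>a\<in>carrier A. h (i a) = f a)"
proof -
  note m = ses_modules[OF s] and ip = ses_homs[OF s]
  obtain g where g: "g \<in> mod_hom R B (J (Suc j))" "\<And>a. a \<in> carrier A \<Longrightarrow> g (i a) = f a"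
    "\<And>b. b \<in> carrier B \<Longrightarrow> \<delta> (Suc j) (g b) = f' (p b)"
    using c unfolding connect_def by blast
  obtain u where u: "u \<in> mod_hom R C (J (Suc j))" "\<And>c. c \<in> carrier C \<Longrightarrow> f' c = \<delta> (Suc j) (u c)"
    using f' unfolding coboundary_def by blast
  note up = mod_hom_comp[OF ip(2) u(1)]
  let ?h = "\<lambda>b. g b \<ominus>\<^bsub>J (Suc j)\<^esub> u (p b)"
  have "cocycle B j ?h"
    unfolding cocycle_def
  proof (intro conjI ballI)
    show "?h \<in> mod_hom R B (J (Suc j))" by (rule mod_hom_diff[OF g(1) up m(2) J_module])
    fix b assume b: "b \<in> carrier B"
    have "\<delta> (Suc j) (g b) = \<delta> (Suc j) (u (p b))" using g(3) u(2) b mod_hom_closed[OF ip(2)] by simp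
    then show "\<delta> (Suc j) (?h b) = \<zero>\<^bsub>J (Suc (Suc j))\<^esub>"
      using mod_hom_closed[OF g(1) b] mod_hom_closed[OF up b] mod_hom_closed[OF \<delta>_hom]
      by (simp add: mod_hom_minus[OF \<delta>_hom])
  qed
  moreover have "?h (i a) = f a" if "a \<in> carrier A" for a
    using g(2)[OF that] ses_comp[OF s that] mod_hom_zero[OF u(1) m(3)]
      mod_hom_closed[OF g(1) mod_hom_closed[OF ip(1) that]] by simp
  ultimately show ?thesis by blast
qed

lemma cocycle_extend:
  assumes s: "ses A i B p C" and C: "ext_zero C (Suc j)" and f: "cocycle A j f"
  shows "\<exists>h. cocycle B j h \<and> (\<forall>a\<in>carrier A. h (i a) = f a)"
  using connect_exists[OF s f] connect_lift[OF s] C unfolding ext_zero_def by blast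

text \<open>A primitive on \<open>A\<close> extends to \<open>B\<close> by injectivity. Subtracting
  its coboundary leaves a cocycle that vanishes on \<open>A\<close>, hence comes from
  \<open>C\<close>, where it has a primitive by assumption.\<close>

lemma coboundary_from_sub:
  assumes s: "ses A i B p C" and C: "ext_zero C (Suc j)" and f: "cocycle B (Suc j) f"
    and fi: "coboundary A (Suc j) (\<lambda>a. f (i a))"
  shows "coboundary B (Suc j) f"
proof -
  note m = ses_modules[OF s] and ip = ses_homs[OF s]
  obtain h where h: "h \<in> mod_hom R A (J (Suc j))" "\<And>a. a \<in> carrier A \<Longrightarrow> f (i a) = \<delta> (Suc j) (h a)"
    using fi unfolding coboundary_def by blast
  obtain h' where h': "h' \<in> mod_hom R B (J (Suc j))" "\<And>a. a \<in> carrier A \<Longrightarrow> h' (i a) = h a"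
    using baer_extend[OF J_baer m(1,2) ip(1) ses_inj[OF s] h(1)] by blast
  let ?k = "\<lambda>b. f b \<ominus>\<^bsub>J (Suc (Suc j))\<^esub> \<delta> (Suc j) (h' b)"
  have dh: "cocycle B (Suc j) (\<lambda>b. \<delta> (Suc j) (h' b))"
    using mod_hom_comp[OF h'(1) \<delta>_hom] by (simp add: cocycle_def \<delta>_\<delta> mod_hom_closed[OF h'(1)])
  have k: "cocycle B (Suc j) ?k" by (rule cocycle_minus[OF f dh m(2)])
  have "?k (i a) = \<zero>\<^bsub>J (Suc (Suc j))\<^esub>" if "a \<in> carrier A" for a
    using h(2)[OF that] h'(2)[OF that] mod_hom_closed[OF cocycle_hom[OF dh] mod_hom_closed[OF ip(1) that]] by simp
  then obtain k' where k': "k' \<in> mod_hom R C (J (Suc (Suc j)))" "\<And>b. b \<in> carrier B \<Longrightarrow> k' (p b) = ?k b"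
    using ses_descend[OF s cocycle_hom[OF k] J_module] by (metis (no_types, lifting))
  have "\<delta> (Suc (Suc j)) (k' c) = \<zero>\<^bsub>J (Suc (Suc (Suc j)))\<^esub>" if c: "c \<in> carrier C" for c
  proof -
    obtain b where "b \<in> carrier B" "p b = c" using ses_surj[OF s c] by blast
    then show ?thesis using k k'(2)[of b] by (auto simp: cocycle_def)
  qed
  then have "coboundary C (Suc j) k'" using C k'(1) unfolding ext_zero_def cocycle_def by blast
  then obtain u where u: "u \<in> mod_hom R C (J (Suc j))" "\<And>c. c \<in> carrier C \<Longrightarrow> k' c = \<delta> (Suc j) (u c)"
    unfolding coboundary_def by blast
  note up = mod_hom_comp[OF ip(2) u(1)]
  have "f b = \<delta> (Suc j) (h' b \<oplus>\<^bsub>J (Suc j)\<^esub> u (p b))" if b: "b \<in> carrier B" for b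
  proof -
    have "\<delta> (Suc j) (h' b \<oplus>\<^bsub>J (Suc j)\<^esub> u (p b)) = \<delta> (Suc j) (h' b) \<oplus>\<^bsub>J (Suc (Suc j))\<^esub> ?k b"
      using mod_hom_closed[OF h'(1) b] mod_hom_closed[OF up b] u(2)[of "p b"] k'(2)[OF b] mod_hom_closed[OF ip(2) b]
      by (simp add: mod_hom_add[OF \<delta>_hom])
    also have "\<dots> = f b"
      using mod_hom_closed[OF cocycle_hom[OF f] b] mod_hom_closed[OF cocycle_hom[OF dh] b] by simp
    finally show ?thesis by simp
  qed
  then show ?thesis
    unfolding coboundary_def by (intro bexI[OF _ mod_hom_plus[OF h'(1) up J_module]]) blast
qed

lemma ext_zero_extension:
  assumes s: "ses A i B p C" and "ext_zero A (Suc j)" "ext_zero C (Suc j)"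
  shows "ext_zero B (Suc j)"
  using coboundary_from_sub[OF s assms(3)] assms(2) cocycle_comp[OF _ ses_homs(1)[OF s]]
  unfolding ext_zero_def by blast

lemma ext_zero_retract:
  assumes N: "ext_zero N j" and u: "u \<in> mod_hom R L N" "v \<in> mod_hom R N L"
    and vu: "\<And>x. x \<in> carrier L \<Longrightarrow> v (u x) = x"
  shows "ext_zero L j"
  unfolding ext_zero_def
proof (intro allI impI)
  fix f assume "cocycle L j f"
  then have "coboundary N j (\<lambda>x. f (v x))" using N cocycle_comp[OF _ u(2)] unfolding ext_zero_def by blast
  from coboundary_comp[OF this u(1)] show "coboundary L j f" by (rule coboundary_cong) (simp add: vu)
qed

text \<open>Dimension shifting, from both ends of the connecting map. Only positive degrees of
  \<open>K\<close> occur; the passage from degree 1 to degree 0 has the different form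
  \<open>ext_zero_1_iff\<close>.\<close>

lemma ext_zero_shift:
  assumes s: "ses K i P p N" and P: "\<And>j. ext_zero P j"
  shows "ext_zero N (Suc (Suc j)) \<longleftrightarrow> ext_zero K (Suc j)"
proof
  assume N: "ext_zero N (Suc (Suc j))"
  show "ext_zero K (Suc j)"
    unfolding ext_zero_def
  proof (intro allI impI)
    fix f assume f: "cocycle K (Suc j) f"
    obtain h where h: "cocycle P (Suc j) h" "\<And>a. a \<in> carrier K \<Longrightarrow> h (i a) = f a"
      using cocycle_extend[OF s N f] by blast
    then have "coboundary P (Suc j) h" using P unfolding ext_zero_def by blast
    from coboundary_comp[OF this ses_homs(1)[OF s]] show "coboundary K (Suc j) f"
      by (rule coboundary_cong) (simp add: h(2))
  qed
next
  assume K: "ext_zero K (Suc j)"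
  show "ext_zero N (Suc (Suc j))"
    unfolding ext_zero_def
  proof (intro allI impI)
    fix f' assume f': "cocycle N (Suc (Suc j)) f'"
    have "coboundary P (Suc (Suc j)) (\<lambda>x. f' (p x))"
      using P cocycle_comp[OF f' ses_homs(2)[OF s]] unfolding ext_zero_def by blast
    from connect_surj[OF s f' this] obtain f where "cocycle K (Suc j) f" "connect K i P p (Suc j) f f'"
      by blast
    then show "coboundary N (Suc (Suc j)) f'"
      using K connect_coboundary_Suc[OF s] unfolding ext_zero_def by blast
  qed
qed

text \<open>Ext^1(N, J 0) is the cokernel of the restriction Hom(P, J 0) -> Hom(K, J 0). Degree 0
  cocycles correspond to maps into \<open>J 0\<close> because \<open>\<delta> 0\<close> is
  injective.\<close>

lemma ext_zero_1_iff:
  assumes s: "ses K i P p N" and P: "\<And>j. ext_zero P j"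
  shows "ext_zero N (Suc 0) \<longleftrightarrow>
    (\<forall>f\<in>mod_hom R K (J 0). \<exists>g\<in>mod_hom R P (J 0). \<forall>a\<in>carrier K. g (i a) = f a)"
proof
  assume N: "ext_zero N (Suc 0)"
  show "\<forall>f\<in>mod_hom R K (J 0). \<exists>g\<in>mod_hom R P (J 0). \<forall>a\<in>carrier K. g (i a) = f a"
  proof
    fix f assume f: "f \<in> mod_hom R K (J 0)"
    have df: "cocycle K 0 (\<lambda>x. \<delta> 0 (f x))"
      using mod_hom_comp[OF f \<delta>_hom] by (simp add: cocycle_def \<delta>_\<delta> mod_hom_closed[OF f])
    obtain h where h: "cocycle P 0 h" "\<And>a. a \<in> carrier K \<Longrightarrow> h (i a) = \<delta> 0 (f a)"
      using cocycle_extend[OF s N df] by blast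
    from h(1) have "coboundary P 0 h" using P by (simp add: ext_zero_def)
    then obtain g where g: "g \<in> mod_hom R P (J 0)" "\<And>x. x \<in> carrier P \<Longrightarrow> h x = \<delta> 0 (g x)"
      unfolding coboundary_def by blast
    have "g (i a) = f a" if "a \<in> carrier K" for a
    proof -
      have ia: "i a \<in> carrier P" by (rule mod_hom_closed[OF ses_homs(1)[OF s] that])
      show ?thesis
        using h(2)[OF that] g(2)[OF ia]
        by (intro inj_onD[OF \<delta>_inj _ mod_hom_closed[OF g(1) ia] mod_hom_closed[OF f that]]) simp
    qed
    then show "\<exists>g\<in>mod_hom R P (J 0). \<forall>a\<in>carrier K. g (i a) = f a" using g(1) by blast
  qed
next
  assume ext: "\<forall>f\<in>mod_hom R K (J 0). \<exists>g\<in>mod_hom R P (J 0). \<forall>a\<in>carrier K. g (i a) = f a"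
  show "ext_zero N (Suc 0)"
    unfolding ext_zero_def
  proof (intro allI impI)
    fix f' assume f': "cocycle N (Suc 0) f'"
    have "coboundary P (Suc 0) (\<lambda>x. f' (p x))"
      using P cocycle_comp[OF f' ses_homs(2)[OF s]] unfolding ext_zero_def by blast
    from connect_surj[OF s f' this] obtain f where f: "cocycle K 0 f" "connect K i P p 0 f f'"
      by blast
    from f(1) have "coboundary K 0 f" using ext_zero_0[OF ses_modules(1)[OF s]] by (simp add: ext_zero_def)
    then obtain u where u: "u \<in> mod_hom R K (J 0)" "\<And>x. x \<in> carrier K \<Longrightarrow> f x = \<delta> 0 (u x)"
      unfolding coboundary_def by blast
    from bspec[OF ext u(1)] obtain g where g: "g \<in> mod_hom R P (J 0)" "\<And>a. a \<in> carrier K \<Longrightarrow> g (i a) = u a"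
      by blast
    show "coboundary N (Suc 0) f'"
      by (rule connect_coboundary[OF s f(2) g(1)]) (simp add: u(2) g(2))
  qed
qed

text \<open>A cocycle lands in the image of \<open>\<delta> j\<close>, and the lifting property
  applies to \<open>J j\<close> and this image. Both lie in the universe, which is what
  \<open>projective_module\<close> tests.\<close>

lemma ext_zero_projective:
  assumes P: "projective_module R P"
  shows "ext_zero P j"
  unfolding ext_zero_def
proof (intro allI impI)
  fix f assume f: "cocycle P j f"
  let ?K = "J (Suc j)\<lparr>carrier := \<delta> j ` carrier (J j)\<rparr>"
  have "module R ?K" using submodule_module[OF submodule_image[OF \<delta>_hom]] by simp
  moreover have "\<delta> j \<in> mod_hom R (J j) ?K" using mod_hom_carrier_update[OF \<delta>_hom] by simp
  moreover have "f ` carrier P \<subseteq> \<delta> j ` carrier (J j)"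
    unfolding \<delta>_exact using f by (auto simp: cocycle_def a_kernel_iff mod_hom_closed)
  then have "f \<in> mod_hom R P ?K" using mod_hom_carrier_update[OF cocycle_hom[OF f]] by blast
  moreover have "\<delta> j ` carrier (J j) = carrier ?K" by simp
  ultimately obtain h where "h \<in> mod_hom R P (J j)" "\<forall>x\<in>carrier P. \<delta> j (h x) = f x"
    using P J_module unfolding projective_module_def by metis
  then show "coboundary P j f" unfolding coboundary_def by force
qed

end

section \<open>Comparison with projective resolutions\<close>

text \<open>Exactness of \<open>Hom(P, L)\<close> in degree \<open>j + 1\<close>.\<close>

definition hom_exact where
  "hom_exact R P d L j \<longleftrightarrow> (\<forall>f\<in>mod_hom R (P (Suc j)) L.
     (\<forall>x\<in>carrier (P (Suc (Suc j))). f (d (Suc j) x) = \<zero>\<^bsub>L\<^esub>) \<longrightarrow>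
     (\<exists>g\<in>mod_hom R (P j) L. \<forall>x\<in>carrier (P (Suc j)). f x = g (d j x)))"

text \<open>Index 0 is the kernel of \<open>e\<close>, so index i stands for the (i + 1)-st syzygy
  of \<open>Y\<close>, a submodule of \<open>P i\<close>.\<close>

definition syzygy where
  "syzygy Y P d e i = (case i of 0 \<Rightarrow> P 0\<lparr>carrier := a_kernel (P 0) Y e\<rparr>
     | Suc j \<Rightarrow> P (Suc j)\<lparr>carrier := a_kernel (P (Suc j)) (P j) (d j)\<rparr>)"

lemma (in cring) ses_syzygy:
  assumes res: "projective_resolution R Y P d e" and Y: "module R Y"
  shows "ses (syzygy Y P d e 0) (\<lambda>x. x) (P 0) e Y"
    and "ses (syzygy Y P d e (Suc i)) (\<lambda>x. x) (P (Suc i)) (d i) (syzygy Y P d e i)"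
proof -
  have P: "module R (P i)" and d: "d i \<in> mod_hom R (P (Suc i)) (P i)"
    and ex: "d (Suc i) ` carrier (P (Suc (Suc i))) = a_kernel (P (Suc i)) (P i) (d i)"
    and e: "e \<in> mod_hom R (P 0) Y" "e ` carrier (P 0) = carrier Y"
      "d 0 ` carrier (P (Suc 0)) = a_kernel (P 0) Y e" for i
    using res by (auto simp: projective_resolution_def projective_module_def)
  show "ses (syzygy Y P d e 0) (\<lambda>x. x) (P 0) e Y"
    using ses_kernel[OF P Y e(1,2)] by (simp add: syzygy_def)
  have car: "d i ` carrier (P (Suc i)) = carrier (syzygy Y P d e i)" for i
    using ex e(3) by (cases i) (auto simp: syzygy_def)
  have m: "module R (syzygy Y P d e i)" for i
    using submodule_module[OF submodule_kernel[OF e(1) P Y] P] submodule_module[OF submodule_kernel[OF d P P] P]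
    by (cases i) (auto simp: syzygy_def)
  have "d i \<in> mod_hom R (P (Suc i)) (syzygy Y P d e i)"
    using mod_hom_carrier_update[OF d, of i "d i ` carrier (P (Suc i))"]
    unfolding car by (cases i) (simp_all add: syzygy_def)
  from ses_kernel[OF P m this car]
  show "ses (syzygy Y P d e (Suc i)) (\<lambda>x. x) (P (Suc i)) (d i) (syzygy Y P d e i)"
    by (cases i) (simp_all add: syzygy_def a_kernel_def')
qed

text \<open>Balancing of Ext without a double complex: shifting along the syzygies reduces degree i
  + 2 of \<open>Y\<close> to degree 1 of the syzygy of index i, where the question is whether maps
  on the next syzygy extend to \<open>P (Suc i)\<close>. Maps on that syzygy are the maps on
  \<open>P (Suc (Suc i))\<close> that vanish on the image of the next differential.\<close>

lemma (in coresolution) hom_exact_iff_ext_zero: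
  assumes res: "projective_resolution R Y P d e" and Y: "module R Y"
  shows "hom_exact R P d (J 0) (Suc i) \<longleftrightarrow> ext_zero Y (Suc (Suc i))"
proof -
  let ?Z = "syzygy Y P d e"
  note s = ses_syzygy[OF res Y]
  have "projective_module R (P i)" for i using res by (simp add: projective_resolution_def)
  note P = ext_zero_projective[OF this]
  \<comment> \<open>After k shifts, syzygy index and degree still add up to i + 1.\<close>
  have "ext_zero (?Z 0) (Suc i) \<longleftrightarrow> ext_zero (?Z k) (Suc (i - k))" if "k \<le> i" for k
    using that
  proof (induction k)
    case (Suc k)
    then have "i - k = Suc (i - Suc k)" by simp
    then show ?case using Suc ext_zero_shift[OF s(2) P] by simp
  qed simp
  from this[of i] have "ext_zero Y (Suc (Suc i)) \<longleftrightarrow> ext_zero (?Z i) (Suc 0)"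
    using ext_zero_shift[OF s(1) P] by simp
  also have "\<dots> \<longleftrightarrow> (\<forall>f\<in>mod_hom R (?Z (Suc i)) (J 0). \<exists>g\<in>mod_hom R (P (Suc i)) (J 0). \<forall>a\<in>carrier (?Z (Suc i)). g a = f a)"
    by (rule ext_zero_1_iff[OF s(2) P])
  also have "\<dots> \<longleftrightarrow> hom_exact R P d (J 0) (Suc i)"
  proof
    assume ext: "\<forall>f\<in>mod_hom R (?Z (Suc i)) (J 0). \<exists>g\<in>mod_hom R (P (Suc i)) (J 0). \<forall>a\<in>carrier (?Z (Suc i)). g a = f a"
    show "hom_exact R P d (J 0) (Suc i)"
      unfolding hom_exact_def
    proof (intro ballI impI)
      fix f assume f: "f \<in> mod_hom R (P (Suc (Suc i))) (J 0)"
        and van: "\<forall>x\<in>carrier (P (Suc (Suc (Suc i)))). f (d (Suc (Suc i)) x) = \<zero>\<^bsub>J 0\<^esub>"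
      have "f a = \<zero>\<^bsub>J 0\<^esub>" if "a \<in> carrier (?Z (Suc (Suc i)))" for a
        using ses_surj[OF s(2) that] van by blast
      from ses_descend[OF s(2) f J_module this] obtain u where u: "u \<in> mod_hom R (?Z (Suc i)) (J 0)"
        "\<And>x. x \<in> carrier (P (Suc (Suc i))) \<Longrightarrow> u (d (Suc i) x) = f x"
        by blast
      from bspec[OF ext u(1)] obtain g where g: "g \<in> mod_hom R (P (Suc i)) (J 0)"
        "\<And>a. a \<in> carrier (?Z (Suc i)) \<Longrightarrow> g a = u a" by blast
      show "\<exists>g\<in>mod_hom R (P (Suc i)) (J 0). \<forall>x\<in>carrier (P (Suc (Suc i))). f x = g (d (Suc i) x)"
        by (rule bexI[OF _ g(1)]) (simp add: u(2) g(2) mod_hom_closed[OF ses_homs(2)[OF s(2)]])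
    qed
  next
    assume he: "hom_exact R P d (J 0) (Suc i)"
    show "\<forall>f\<in>mod_hom R (?Z (Suc i)) (J 0). \<exists>g\<in>mod_hom R (P (Suc i)) (J 0). \<forall>a\<in>carrier (?Z (Suc i)). g a = f a"
    proof
      fix f assume f: "f \<in> mod_hom R (?Z (Suc i)) (J 0)"
      have dd: "d (Suc i) (d (Suc (Suc i)) x) = \<zero>\<^bsub>?Z (Suc i)\<^esub>" if "x \<in> carrier (P (Suc (Suc (Suc i))))" for x
        using ses_comp[OF s(2) mod_hom_closed[OF ses_homs(2)[OF s(2)] that]] .
      have "f (d (Suc i) (d (Suc (Suc i)) x)) = \<zero>\<^bsub>J 0\<^esub>" if "x \<in> carrier (P (Suc (Suc (Suc i))))" for x
        unfolding dd[OF that] by (rule mod_hom_zero[OF f ses_modules(3)[OF s(2)] J_module])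
      then have "\<exists>g\<in>mod_hom R (P (Suc i)) (J 0). \<forall>x\<in>carrier (P (Suc (Suc i))). f (d (Suc i) x) = g (d (Suc i) x)"
        using he[unfolded hom_exact_def, rule_format, OF mod_hom_comp[OF ses_homs(2)[OF s(2)] f]] by simp
      then obtain g where g: "g \<in> mod_hom R (P (Suc i)) (J 0)"
        "\<And>x. x \<in> carrier (P (Suc (Suc i))) \<Longrightarrow> f (d (Suc i) x) = g (d (Suc i) x)" by blast
      have "g a = f a" if "a \<in> carrier (?Z (Suc i))" for a
        using ses_surj[OF s(2) that] g(2) by metis
      then show "\<exists>g\<in>mod_hom R (P (Suc i)) (J 0). \<forall>a\<in>carrier (?Z (Suc i)). g a = f a" using g(1) by blast
    qed
  qed
  finally show ?thesis ..
qed

text \<open>\<open>Ext\<close> is computed from one chosen resolution, so exactness is obtained for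
  that one only, whence the existential quantifier. Vanishing of the factor module says that every
  cocycle is a coboundary.\<close>

lemma (in cring) hom_exact_Ext:
  assumes Y: "Ext_eventually_zero R Y L" and L: "module R L"
    and ex: "\<exists>P d e. projective_resolution R Y P d e"
  shows "\<exists>P d e n. projective_resolution R Y P d e \<and> (\<forall>j\<ge>n. hom_exact R P d L j)"
proof -
  define T where "T = (SOME (P, d, e). projective_resolution R Y P d e)"
  obtain P d e where T: "T = (P, d, e)" by (metis surj_pair)
  have "case T of (P, d, e) \<Rightarrow> projective_resolution R Y P d e"
    unfolding T_def using ex by (intro someI_ex[of "\<lambda>(P, d, e). projective_resolution R Y P d e"]) auto
  then have res: "projective_resolution R Y P d e" by (simp add: T)
  obtain n where n: "\<And>i. i \<ge> n \<Longrightarrow> zero_module (Ext R i Y L)" using Y unfolding Ext_eventually_zero_def by blast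
  have P: "module R (P i)" for i
    using res by (auto simp: projective_resolution_def projective_module_def)
  have "hom_exact R P d L j" if j: "j \<ge> n" for j
    unfolding hom_exact_def
  proof (intro ballI impI)
    fix f assume f: "f \<in> mod_hom R (P (Suc j)) L"
      and van: "\<forall>x\<in>carrier (P (Suc (Suc j))). f (d (Suc j) x) = \<zero>\<^bsub>L\<^esub>"
    have d: "d (Suc j) \<in> mod_hom R (P (Suc (Suc j))) (P (Suc j))" "d j \<in> mod_hom R (P (Suc j)) (P j)"
      using res by (auto simp: projective_resolution_def)
    let ?f = "restrict f (carrier (P (Suc j)))"
    let ?Z = "ext_cocycles R P d L (Suc j)" and ?B = "ext_coboundaries R P d L (Suc j)"
    let ?H = "hom_module R (P (Suc j)) L\<lparr>carrier := ?Z\<rparr>"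
    have fZ: "?f \<in> ?Z"
      using mod_hom_restrict[OF f P] van mod_hom_closed[OF d(1)] by (simp add: ext_cocycles_def)
    have "zero_module (factor_module ?H ?B)"
      using n[of "Suc j"] j unfolding Ext_def T_def[symmetric] T by simp
    then have "a_rcosets\<^bsub>?H\<^esub> ?B = {?B}" by (simp add: zero_module_def factor_module_def)
    \<comment> \<open>The coset of \<open>?f\<close> is the only coset, and it contains
      \<open>?f\<close> because the zero map is a coboundary.\<close>
    then have "?B +>\<^bsub>?H\<^esub> ?f = ?B" using fZ by (auto simp: A_RCOSETS_def')
    moreover have "(\<lambda>x\<in>carrier (P (Suc j)). \<zero>\<^bsub>L\<^esub>) \<in> ?B"
      using mod_hom_restrict[OF mod_hom_const_zero[OF L] P]
      by (auto intro!: image_eqI[of _ _ "\<lambda>x\<in>carrier (P j). \<zero>\<^bsub>L\<^esub>"] extensionalityI[where A = "carrier (P (Suc j))"]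
        simp: mod_hom_closed[OF d(2)])
    then have "(\<lambda>x\<in>carrier (P (Suc j)). \<zero>\<^bsub>L\<^esub>) \<oplus>\<^bsub>hom_module R (P (Suc j)) L\<^esub> ?f \<in> ?B +>\<^bsub>?H\<^esub> ?f"
      unfolding a_r_coset_def' by (rule UN_I) simp
    moreover have "(\<lambda>x\<in>carrier (P (Suc j)). \<zero>\<^bsub>L\<^esub>) \<oplus>\<^bsub>hom_module R (P (Suc j)) L\<^esub> ?f = ?f"
      using L by (auto intro!: restrict_ext simp: mod_hom_closed[OF f])
    ultimately have "?f \<in> ?B" by simp
    then obtain g where g: "g \<in> mod_hom R (P j) L" and fg: "?f = (\<lambda>x\<in>carrier (P (Suc j)). g (d j x))" by auto
    have "f x = g (d j x)" if "x \<in> carrier (P (Suc j))" for x using fun_cong[OF fg, of x] that by simp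
    then show "\<exists>g\<in>mod_hom R (P j) L. \<forall>x\<in>carrier (P (Suc j)). f x = g (d j x)" using g by blast
  qed
  then show ?thesis using res by blast
qed

section \<open>Noetherian modules and minimal free resolutions\<close>

text \<open>Elements of the free module of rank \<open>b\<close> are encoded as singletons of lists of length \<open>b\<close>.\<close>

definition fcons :: "'a \<Rightarrow> 'a univ \<Rightarrow> 'a univ" where "fcons r A = {r # the_elem A}"
definition fhd :: "'a univ \<Rightarrow> 'a" where "fhd A = hd (the_elem A)"
definition ftl :: "'a univ \<Rightarrow> 'a univ" where "ftl A = {tl (the_elem A)}"

primrec free_mod :: "('a, 'c) ring_scheme \<Rightarrow> nat \<Rightarrow> ('a, 'a univ) module" where
  "free_mod R 0 = \<lparr>carrier = {{[]}}, monoid.mult = undefined, one = undefined,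
     ring.zero = {[]}, add = (\<lambda>_ _. {[]}), smult = (\<lambda>_ _. {[]})\<rparr>"
| "free_mod R (Suc b) = \<lparr>carrier = (\<lambda>(r, A). fcons r A) ` (carrier R \<times> carrier (free_mod R b)),
     monoid.mult = undefined, one = undefined, ring.zero = fcons \<zero>\<^bsub>R\<^esub> \<zero>\<^bsub>free_mod R b\<^esub>,
     add = (\<lambda>A B. fcons (fhd A \<oplus>\<^bsub>R\<^esub> fhd B) (ftl A \<oplus>\<^bsub>free_mod R b\<^esub> ftl B)),
     smult = (\<lambda>r A. fcons (r \<otimes>\<^bsub>R\<^esub> fhd A) (r \<odot>\<^bsub>free_mod R b\<^esub> ftl A))\<rparr>"

lemma free_mod_singleton: "A \<in> carrier (free_mod R b) \<Longrightarrow> {the_elem A} = A"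
  by (cases b) (auto simp: fcons_def)

lemma fhd_fcons [simp]: "fhd (fcons r A) = r"
  by (simp add: fhd_def fcons_def)

lemma ftl_fcons [simp]: "A \<in> carrier (free_mod R b) \<Longrightarrow> ftl (fcons r A) = A"
  using free_mod_singleton by (fastforce simp: ftl_def fcons_def)

lemma free_mod_SucE:
  assumes "A \<in> carrier (free_mod R (Suc b))"
  obtains r B where "r \<in> carrier R" "B \<in> carrier (free_mod R b)" "A = fcons r B"
  using assms by auto

lemma free_mod_Suc_simps [simp]:
  "r \<in> carrier R \<Longrightarrow> A \<in> carrier (free_mod R b) \<Longrightarrow> fcons r A \<in> carrier (free_mod R (Suc b))"
  "\<zero>\<^bsub>free_mod R (Suc b)\<^esub> = fcons \<zero>\<^bsub>R\<^esub> \<zero>\<^bsub>free_mod R b\<^esub>"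
  "A \<in> carrier (free_mod R b) \<Longrightarrow> B \<in> carrier (free_mod R b) \<Longrightarrow>
    fcons r A \<oplus>\<^bsub>free_mod R (Suc b)\<^esub> fcons s B = fcons (r \<oplus>\<^bsub>R\<^esub> s) (A \<oplus>\<^bsub>free_mod R b\<^esub> B)"
  "A \<in> carrier (free_mod R b) \<Longrightarrow> s \<odot>\<^bsub>free_mod R (Suc b)\<^esub> fcons r A = fcons (s \<otimes>\<^bsub>R\<^esub> r) (s \<odot>\<^bsub>free_mod R b\<^esub> A)"
  by auto

declare free_mod.simps(2) [simp del]

context cring
begin

lemma module_free_mod [simp]: "module R (free_mod R b)"
proof (induction b)
  case 0
  show ?case by (rule moduleI[OF cring_axioms], rule abelian_groupI) auto
next
  case (Suc b)
  show ?case
  proof (rule moduleI[OF cring_axioms])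
    show "abelian_group (free_mod R (Suc b))"
    proof (rule abelian_groupI)
      fix A assume "A \<in> carrier (free_mod R (Suc b))"
      then obtain r A' where "r \<in> carrier R" "A' \<in> carrier (free_mod R b)" "A = fcons r A'"
        by (rule free_mod_SucE)
      then show "\<exists>B\<in>carrier (free_mod R (Suc b)). B \<oplus>\<^bsub>free_mod R (Suc b)\<^esub> A = \<zero>\<^bsub>free_mod R (Suc b)\<^esub>"
        using Suc by (intro bexI[of _ "fcons (\<ominus> r) (\<ominus>\<^bsub>free_mod R b\<^esub> A')"]) (simp_all add: l_neg)
    qed (use Suc in \<open>auto elim!: free_mod_SucE simp: module_ac[OF Suc] a_ac\<close>)
  qed (use Suc in \<open>auto elim!: free_mod_SucE simp: module_smult_add module_add_smult module_mult_smult
      l_distr r_distr m_assoc\<close>)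
qed

lemma free_mod_extend_hom:
  assumes N: "module R N" and x: "x \<in> carrier N" and f: "f \<in> mod_hom R (free_mod R b) N"
  shows "(\<lambda>A. fhd A \<odot>\<^bsub>N\<^esub> x \<oplus>\<^bsub>N\<^esub> f (ftl A)) \<in> mod_hom R (free_mod R (Suc b)) N"
  by (rule mod_homI)
    (use N x in \<open>auto elim!: free_mod_SucE simp: mod_hom_closed[OF f] mod_hom_add[OF f] mod_hom_smult[OF f]
      module_add_smult module_smult_add module_mult_smult module_ac[OF N] ftl_fcons[of _ R b]\<close>)

lemma fcons_zero_hom: "fcons \<zero> \<in> mod_hom R (free_mod R b) (free_mod R (Suc b))"
  by (rule mod_homI) auto

lemma fhd_hom: "fhd \<in> mod_hom R (free_mod R (Suc b)) (regular_module R)"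
  by (rule mod_homI) (auto elim!: free_mod_SucE)

lemma free_mod_hom_fcons:
  assumes f: "f \<in> mod_hom R (free_mod R (Suc b)) N" and r: "r \<in> carrier R" and A: "A \<in> carrier (free_mod R b)"
  shows "f (fcons r A) = r \<odot>\<^bsub>N\<^esub> f (fcons \<one> \<zero>\<^bsub>free_mod R b\<^esub>) \<oplus>\<^bsub>N\<^esub> f (fcons \<zero> A)"
proof -
  have "fcons r A = r \<odot>\<^bsub>free_mod R (Suc b)\<^esub> fcons \<one> \<zero>\<^bsub>free_mod R b\<^esub> \<oplus>\<^bsub>free_mod R (Suc b)\<^esub> fcons \<zero> A"
    using r A by simp
  then show ?thesis
    using r A mod_hom_add[OF f] mod_hom_smult[OF f] by (metis free_mod_Suc_simps(1) module_free_mod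
      module_smult_closed module_zero_closed one_closed zero_closed)
qed

text \<open>Values at the basis vectors are lifted one at a time. \<open>N\<close> and
  \<open>L\<close> may have any type, beyond the universe tested by
  \<open>projective_module\<close>; exactness of Hom(F, -) on the given sequence relies on
  this.\<close>

lemma free_mod_lift:
  assumes N: "module R N" and L: "module R L" and f: "f \<in> mod_hom R N L" "f ` carrier N = carrier L"
    and g: "g \<in> mod_hom R (free_mod R b) L"
  shows "\<exists>h\<in>mod_hom R (free_mod R b) N. \<forall>x\<in>carrier (free_mod R b). f (h x) = g x"
  using g
proof (induction b arbitrary: g)
  case 0
  have "g {[]} = \<zero>\<^bsub>L\<^esub>" using mod_hom_zero[OF 0 module_free_mod L] by simp
  then show ?case using mod_hom_const_zero[OF N] mod_hom_zero[OF f(1) N L]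
    by (intro bexI[of _ "\<lambda>x. \<zero>\<^bsub>N\<^esub>"]) auto
next
  case (Suc b)
  obtain h where h: "h \<in> mod_hom R (free_mod R b) N" "\<And>x. x \<in> carrier (free_mod R b) \<Longrightarrow> f (h x) = g (fcons \<zero> x)"
    using Suc.IH[OF mod_hom_comp[OF fcons_zero_hom Suc.prems]] by blast
  have "g (fcons \<one> \<zero>\<^bsub>free_mod R b\<^esub>) \<in> carrier L" by (rule mod_hom_closed[OF Suc.prems]) simp
  then have "g (fcons \<one> \<zero>\<^bsub>free_mod R b\<^esub>) \<in> f ` carrier N" using f(2) by simp
  then obtain n where n: "n \<in> carrier N" "f n = g (fcons \<one> \<zero>\<^bsub>free_mod R b\<^esub>)" by force
  show ?case
  proof (intro bexI[OF _ free_mod_extend_hom[OF N n(1) h(1)]] ballI)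
    fix x assume "x \<in> carrier (free_mod R (Suc b))"
    then obtain r A where x: "r \<in> carrier R" "A \<in> carrier (free_mod R b)" "x = fcons r A"
      by (rule free_mod_SucE)
    then show "f (fhd x \<odot>\<^bsub>N\<^esub> n \<oplus>\<^bsub>N\<^esub> h (ftl x)) = g x"
      using n N h(2)[OF x(2)] mod_hom_closed[OF h(1) x(2)] free_mod_hom_fcons[OF Suc.prems x(1,2)]
      by (simp add: mod_hom_add[OF f(1)] mod_hom_smult[OF f(1)])
  qed
qed

lemma projective_free_mod: "projective_module R (free_mod R b)"
  unfolding projective_module_def using free_mod_lift by auto

section \<open>The maximal condition on submodules\<close>

definition acc :: "('a, 'm) module \<Rightarrow> bool" where
  "acc N \<longleftrightarrow> module R N \<and> (\<forall>\<U>. \<U> \<noteq> {} \<and> (\<forall>U\<in>\<U>. submodule U R N) \<longrightarrow> (\<exists>V\<in>\<U>. \<forall>U\<in>\<U>. V \<subseteq> U \<longrightarrow> U = V))"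

lemma acc_module: "acc N \<Longrightarrow> module R N"
  by (simp add: acc_def)

text \<open>The family is indexed by \<open>q\<close> so that the condition can be applied to images
  or preimages of submodules while keeping hold of the member that attains the maximum.\<close>

lemma acc_max:
  assumes N: "acc N" and U0: "U0 \<in> \<U>" and sub: "\<And>U. U \<in> \<U> \<Longrightarrow> submodule (q U) R N"
  shows "\<exists>V\<in>\<U>. \<forall>U\<in>\<U>. q V \<subseteq> q U \<longrightarrow> q U = q V"
proof -
  have *: "\<exists>V\<in>\<V>. \<forall>U\<in>\<V>. V \<subseteq> U \<longrightarrow> U = V" if "\<V> \<noteq> {}" "\<forall>U\<in>\<V>. submodule U R N" for \<V>
    using N that unfolding acc_def by blast
  have "q ` \<U> \<noteq> {}" "\<forall>U\<in>q ` \<U>. submodule U R N" using U0 sub by auto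
  from *[OF this] show ?thesis by auto
qed

lemma submodule_image_sub:
  assumes "f \<in> mod_hom R M N" "module R M" "module R N" "submodule U R M"
  shows "submodule (f ` U) R N"
  using submodule_image[OF mod_hom_restrict_carrier[OF assms(1) submodule_subset[OF assms(4,2)]]
    submodule_module[OF assms(4,2)] assms(3)] by simp

lemma submodule_vimage:
  assumes f: "f \<in> mod_hom R M N" and M: "module R M" and N: "module R N" and U: "submodule U R N"
  shows "submodule {x \<in> carrier M. f x \<in> U} R M"
  by (rule submodule_intro[OF M])
    (use M submodule_zero[OF U N] submodule_add[OF U N] submodule_smult[OF U N]
      in \<open>auto simp: mod_hom_zero[OF f M N] mod_hom_add[OF f] mod_hom_smult[OF f]\<close>)

lemma acc_inj:
  assumes B: "acc B" and A: "module R A" and i: "i \<in> mod_hom R A B" "inj_on i (carrier A)"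
  shows "acc A"
  unfolding acc_def
proof (intro conjI allI impI A)
  fix \<U> assume U: "\<U> \<noteq> {} \<and> (\<forall>U\<in>\<U>. submodule U R A)"
  then obtain U0 where U0: "U0 \<in> \<U>" by blast
  have "submodule (i ` U) R B" if "U \<in> \<U>" for U
    using submodule_image_sub[OF i(1) A acc_module[OF B]] U that by blast
  from acc_max[OF B U0, of "image i", OF this]
  obtain V where V: "V \<in> \<U>" "\<forall>U\<in>\<U>. i ` V \<subseteq> i ` U \<longrightarrow> i ` U = i ` V" by blast
  have "U = V" if "U \<in> \<U>" "V \<subseteq> U" for U
  proof -
    have "i ` U = i ` V" using bspec[OF V(2) that(1)] that(2) by blast
    moreover have "U \<subseteq> carrier A" "V \<subseteq> carrier A" using U that V(1) submodule_subset[OF _ A] by blast+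
    ultimately show ?thesis using inj_on_image_eq_iff[OF i(2)] by blast
  qed
  then show "\<exists>V\<in>\<U>. \<forall>U\<in>\<U>. V \<subseteq> U \<longrightarrow> U = V" using V(1) by blast
qed

lemma acc_surj:
  assumes B: "acc B" and C: "module R C" and p: "p \<in> mod_hom R B C" "p ` carrier B = carrier C"
  shows "acc C"
  unfolding acc_def
proof (intro conjI allI impI C)
  fix \<U> assume U: "\<U> \<noteq> {} \<and> (\<forall>U\<in>\<U>. submodule U R C)"
  define q where "q U = {x \<in> carrier B. p x \<in> U}" for U
  have pq: "p ` q U = U" if "U \<in> \<U>" for U
  proof -
    have "U \<subseteq> p ` carrier B" using U that submodule_subset[OF _ C] p(2) by blast
    then show ?thesis by (auto simp: q_def)
  qed
  obtain U0 where U0: "U0 \<in> \<U>" using U by blast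
  have "submodule (q U) R B" if "U \<in> \<U>" for U
    unfolding q_def using submodule_vimage[OF p(1) acc_module[OF B] C] U that by blast
  from acc_max[OF B U0, of q, OF this]
  obtain V where V: "V \<in> \<U>" "\<forall>U\<in>\<U>. q V \<subseteq> q U \<longrightarrow> q U = q V" by blast
  have "U = V" if "U \<in> \<U>" "V \<subseteq> U" for U
  proof -
    have "q V \<subseteq> q U" using that(2) by (auto simp: q_def)
    then have "q U = q V" using bspec[OF V(2) that(1)] by blast
    then show ?thesis using pq[OF that(1)] pq[OF V(1)] by metis
  qed
  then show "\<exists>V\<in>\<U>. \<forall>U\<in>\<U>. V \<subseteq> U \<longrightarrow> U = V" using V(1) by blast
qed

text \<open>First the image in \<open>C\<close> is made maximal, then, among the members with that
  image, the preimage in \<open>A\<close>. Nested submodules with equal images and equal preimages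
  coincide.\<close>

lemma acc_ses:
  assumes s: "ses A i B p C" and A: "acc A" and C: "acc C"
  shows "acc B"
  unfolding acc_def
proof (intro conjI allI impI ses_modules(2)[OF s])
  note m = ses_modules[OF s] and ip = ses_homs[OF s]
  fix \<U> assume U: "\<U> \<noteq> {} \<and> (\<forall>U\<in>\<U>. submodule U R B)"
  then have sub: "submodule U R B" if "U \<in> \<U>" for U using that by blast
  obtain U0 where U0: "U0 \<in> \<U>" using U by blast
  have "submodule (p ` U) R C" if "U \<in> \<U>" for U
    by (rule submodule_image_sub[OF ip(2) m(2,3) sub[OF that]])
  from acc_max[OF C U0, of "image p", OF this]
  obtain U1 where U1: "U1 \<in> \<U>" "\<forall>U\<in>\<U>. p ` U1 \<subseteq> p ` U \<longrightarrow> p ` U = p ` U1" by blast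
  define W where "W = p ` U1"
  define \<U>' where "\<U>' = {U \<in> \<U>. p ` U = W}"
  define q where "q U = {x \<in> carrier A. i x \<in> U}" for U
  have U1': "U1 \<in> \<U>'" using U1(1) by (simp add: \<U>'_def W_def)
  have "submodule (q U) R A" if "U \<in> \<U>'" for U
    unfolding q_def using submodule_vimage[OF ip(1) m(1,2) sub] that by (simp add: \<U>'_def)
  from acc_max[OF A U1', of q, OF this]
  obtain V where V': "V \<in> \<U>'" "\<forall>U\<in>\<U>'. q V \<subseteq> q U \<longrightarrow> q U = q V" by blast
  from V'(1) have V: "V \<in> \<U>" "p ` V = W" by (auto simp: \<U>'_def)
  have "U = V" if UU: "U \<in> \<U>" "V \<subseteq> U" for U
  proof -
    have "p ` V \<subseteq> p ` U" using UU(2) by blast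
    then have pU: "p ` U = W" using bspec[OF U1(2) UU(1)] V(2) unfolding W_def by simp
    then have "U \<in> \<U>'" using UU(1) by (simp add: \<U>'_def)
    moreover have "q V \<subseteq> q U" using UU(2) by (auto simp: q_def)
    ultimately have qU: "q U = q V" using bspec[OF V'(2)] by blast
    have "u \<in> V" if u: "u \<in> U" for u
    proof -
      have "p u \<in> p ` V" using pU V(2) u by blast
      then obtain v where v: "v \<in> V" "p u = p v" by blast
      have uv: "u \<in> carrier B" "v \<in> carrier B" using submodule_subset[OF sub m(2)] UU u v V(1) by blast+
      have "p (u \<ominus>\<^bsub>B\<^esub> v) = \<zero>\<^bsub>C\<^esub>"
        using uv v(2) m by (simp add: mod_hom_minus[OF ip(2)] mod_hom_closed[OF ip(2)])
      then obtain a where a: "a \<in> carrier A" "i a = u \<ominus>\<^bsub>B\<^esub> v"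
        using ses_exact[OF s, of "u \<ominus>\<^bsub>B\<^esub> v"] uv m by auto
      have "u \<ominus>\<^bsub>B\<^esub> v \<in> U" using submodule_minus[OF sub[OF UU(1)] m(2)] u v UU(2) by blast
      then have "a \<in> q U" using a by (simp add: q_def)
      then have "a \<in> q V" unfolding qU .
      then have "u \<ominus>\<^bsub>B\<^esub> v \<in> V" using a(2) by (simp add: q_def)
      then have "(u \<ominus>\<^bsub>B\<^esub> v) \<oplus>\<^bsub>B\<^esub> v \<in> V" using submodule_add[OF sub[OF V(1)] m(2)] v(1) by blast
      then show ?thesis using uv m by simp
    qed
    then show ?thesis using UU(2) by blast
  qed
  then show "\<exists>V\<in>\<U>. \<forall>U\<in>\<U>. V \<subseteq> U \<longrightarrow> U = V" using V(1) by blast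
qed

lemma acc_submodule:
  assumes "acc N" "submodule U R N"
  shows "acc (N\<lparr>carrier := U\<rparr>)"
  using acc_inj[OF assms(1) submodule_module[OF assms(2) acc_module[OF assms(1)]]
    mod_hom_restrict_carrier[OF mod_hom_id submodule_subset[OF assms(2) acc_module[OF assms(1)]]]] by simp

lemma ideal_if_submodule:
  assumes "submodule U R (regular_module R)"
  shows "ideal U R"
proof (rule idealI[OF ring_axioms])
  show "subgroup U (add_monoid R)"
    using submodule_subset[OF assms module_regular] submodule_zero[OF assms module_regular]
      submodule_add[OF assms module_regular] submodule_smult[OF assms module_regular, of "\<ominus> \<one>"]
    by (intro add.subgroupI) (auto simp: l_minus subset_eq a_inv_def[symmetric])
  fix a x assume a: "a \<in> U" and x: "x \<in> carrier R"
  then show "x \<otimes> a \<in> U" using submodule_smult[OF assms module_regular x a] by simp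
  then show "a \<otimes> x \<in> U" using submodule_subset[OF assms module_regular] a x m_comm by (auto simp: subset_eq)
qed

text \<open>The union of a chain of ideals belongs to the chain, so Zorn's lemma yields maximal
  members.\<close>

lemma acc_regular:
  assumes "noetherian_ring R"
  shows "acc (regular_module R)"
  unfolding acc_def
proof (intro conjI allI impI module_regular)
  fix \<U> assume U: "\<U> \<noteq> {} \<and> (\<forall>U\<in>\<U>. submodule U R (regular_module R))"
  show "\<exists>V\<in>\<U>. \<forall>U\<in>\<U>. V \<subseteq> U \<longrightarrow> U = V"
  proof (rule subset_Zorn_nonempty)
    fix \<C> assume C: "\<C> \<noteq> {}" "subset.chain \<U> \<C>"
    then have "subset.chain {I. ideal I R} \<C>"
      using U ideal_if_submodule by (auto simp: pred_on.chain_def)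
    then have "\<Union>\<C> \<in> \<C>" by (rule noetherian_ring.ideal_chain_is_trivial[OF assms C(1)])
    then show "\<Union>\<C> \<in> \<U>" using C(2) by (auto simp: pred_on.chain_def)
  qed (use U in blast)
qed

lemma ses_free_mod: "ses (free_mod R b) (fcons \<zero>) (free_mod R (Suc b)) fhd (regular_module R)"
proof (rule sesI[OF module_free_mod module_free_mod module_regular fcons_zero_hom fhd_hom])
  show "A = \<zero>\<^bsub>free_mod R b\<^esub>" if "A \<in> carrier (free_mod R b)" "fcons \<zero> A = \<zero>\<^bsub>free_mod R (Suc b)\<^esub>" for A
    using that ftl_fcons[OF that(1)] ftl_fcons[of "\<zero>\<^bsub>free_mod R b\<^esub>" R b] by (metis free_mod_Suc_simps(2) module_free_mod module_zero_closed)
  show "\<exists>B\<in>carrier (free_mod R (Suc b)). fhd B = c" if "c \<in> carrier (regular_module R)" for c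
    using that by (intro bexI[of _ "fcons c \<zero>\<^bsub>free_mod R b\<^esub>"]) auto
qed (auto elim!: free_mod_SucE)

lemma acc_zero:
  assumes "module R N" "carrier N = {\<zero>\<^bsub>N\<^esub>}"
  shows "acc N"
  unfolding acc_def
proof (intro conjI allI impI assms(1))
  fix \<U> assume U: "\<U> \<noteq> {} \<and> (\<forall>U\<in>\<U>. submodule U R N)"
  have "U = {\<zero>\<^bsub>N\<^esub>}" if "U \<in> \<U>" for U
    using U that submodule_subset[OF _ assms(1)] submodule_zero[OF _ assms(1)] assms(2) by blast
  then show "\<exists>V\<in>\<U>. \<forall>U\<in>\<U>. V \<subseteq> U \<longrightarrow> U = V" using U by blast
qed

lemma acc_free_mod:
  assumes "acc (regular_module R)"
  shows "acc (free_mod R b)"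
proof (induction b)
  case 0
  show ?case by (rule acc_zero) (use module_free_mod[of 0] in simp_all)
next
  case (Suc b)
  then show ?case using acc_ses[OF ses_free_mod _ assms] by blast
qed

section \<open>Free covers of finite rank\<close>

lemma free_cover_extend:
  assumes N: "module R N" and f: "f \<in> mod_hom R (free_mod R b) N" and x: "x \<in> carrier N"
  shows "\<exists>g\<in>mod_hom R (free_mod R (Suc b)) N. \<forall>r\<in>carrier R. \<forall>y\<in>f ` carrier (free_mod R b).
    r \<odot>\<^bsub>N\<^esub> x \<oplus>\<^bsub>N\<^esub> y \<in> g ` carrier (free_mod R (Suc b))"
proof (intro bexI[OF _ free_mod_extend_hom[OF N x f]] ballI)
  fix r y assume r: "r \<in> carrier R" and "y \<in> f ` carrier (free_mod R b)"
  then obtain A where "A \<in> carrier (free_mod R b)" "y = f A" by blast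
  then show "r \<odot>\<^bsub>N\<^esub> x \<oplus>\<^bsub>N\<^esub> y \<in> (\<lambda>A. fhd A \<odot>\<^bsub>N\<^esub> x \<oplus>\<^bsub>N\<^esub> f (ftl A)) ` carrier (free_mod R (Suc b))"
    using r by (intro image_eqI[of _ _ "fcons r A"]) auto
qed

definition free_cover where
  "free_cover b f N \<longleftrightarrow> f \<in> mod_hom R (free_mod R b) N \<and> f ` carrier (free_mod R b) = carrier N"

text \<open>Among the images in \<open>N\<close> of free modules of finite rank there is a maximal
  one. Adjoining another element as a generator cannot enlarge it, so it contains every
  element.\<close>

lemma acc_ex_free_cover:
  assumes N: "acc N"
  shows "\<exists>b f. free_cover b f N"
proof -
  note m = acc_module[OF N]
  define \<U> where "\<U> = {f ` carrier (free_mod R b) | f b. f \<in> mod_hom R (free_mod R b) N}"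
  have U0: "(\<lambda>x. \<zero>\<^bsub>N\<^esub>) ` carrier (free_mod R 0) \<in> \<U>" using mod_hom_const_zero[OF m] unfolding \<U>_def by blast
  have "submodule U R N" if "U \<in> \<U>" for U
    using that submodule_image[OF _ module_free_mod m] unfolding \<U>_def by blast
  from acc_max[OF N U0, of "\<lambda>U. U", OF this]
  obtain V where V: "V \<in> \<U>" "\<forall>U\<in>\<U>. V \<subseteq> U \<longrightarrow> U = V" by blast
  from V(1) obtain f b where f: "V = f ` carrier (free_mod R b)" "f \<in> mod_hom R (free_mod R b) N"
    unfolding \<U>_def by blast
  have "x \<in> V" if x: "x \<in> carrier N" for x
  proof -
    obtain g where g: "g \<in> mod_hom R (free_mod R (Suc b)) N"
      "\<And>r y. r \<in> carrier R \<Longrightarrow> y \<in> V \<Longrightarrow> r \<odot>\<^bsub>N\<^esub> x \<oplus>\<^bsub>N\<^esub> y \<in> g ` carrier (free_mod R (Suc b))"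
      using free_cover_extend[OF m f(2) x] f(1) by blast
    have Vsub: "submodule V R N" using submodule_image[OF f(2) module_free_mod m] f(1) by simp
    have "V \<subseteq> g ` carrier (free_mod R (Suc b))"
    proof
      fix y assume y: "y \<in> V"
      then show "y \<in> g ` carrier (free_mod R (Suc b))"
        using g(2)[OF zero_closed y] x m submodule_subset[OF Vsub m] by (simp add: subset_eq)
    qed
    then have "g ` carrier (free_mod R (Suc b)) = V" using V(2) g(1) unfolding \<U>_def by blast
    then show ?thesis using g(2)[OF one_closed submodule_zero[OF Vsub m]] x m by simp
  qed
  then have "f ` carrier (free_mod R b) = carrier N"
    using f mod_hom_closed[OF f(2)] by blast
  then show ?thesis using f(2) unfolding free_cover_def by blast
qed

text \<open>Induction on the generating set builds a free module onto \<open>N\<close>, and the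
  maximal condition passes to its quotients.\<close>

lemma acc_fg_module:
  assumes R: "acc (regular_module R)" and N: "fg_module R N"
  shows "acc N"
proof -
  have m: "module R N" using N by (simp add: fg_module_def)
  interpret N: module R N by (rule m)
  obtain S where S: "finite S" "S \<subseteq> carrier N"
    "\<And>x. x \<in> carrier N \<Longrightarrow> \<exists>c\<in>S \<rightarrow> carrier R. x = (\<Oplus>\<^bsub>N\<^esub>s\<in>S. c s \<odot>\<^bsub>N\<^esub> s)"
    using N unfolding fg_module_def by blast
  have "\<exists>b. \<exists>f\<in>mod_hom R (free_mod R b) N. \<forall>c\<in>S \<rightarrow> carrier R. (\<Oplus>\<^bsub>N\<^esub>s\<in>S. c s \<odot>\<^bsub>N\<^esub> s) \<in> f ` carrier (free_mod R b)"
    using S(1,2)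
  proof (induction S)
    case empty
    show ?case using mod_hom_const_zero[OF m, of "free_mod R 0"] by (intro exI[of _ 0] bexI[of _ "\<lambda>x. \<zero>\<^bsub>N\<^esub>"]) auto
  next
    case (insert x S)
    then obtain b f where f: "f \<in> mod_hom R (free_mod R b) N"
      "\<And>c. c \<in> S \<rightarrow> carrier R \<Longrightarrow> (\<Oplus>\<^bsub>N\<^esub>s\<in>S. c s \<odot>\<^bsub>N\<^esub> s) \<in> f ` carrier (free_mod R b)" by auto
    obtain g where g: "g \<in> mod_hom R (free_mod R (Suc b)) N"
      "\<And>r y. r \<in> carrier R \<Longrightarrow> y \<in> f ` carrier (free_mod R b) \<Longrightarrow> r \<odot>\<^bsub>N\<^esub> x \<oplus>\<^bsub>N\<^esub> y \<in> g ` carrier (free_mod R (Suc b))"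
      using free_cover_extend[OF m f(1), of x] insert.prems by blast
    have "(\<Oplus>\<^bsub>N\<^esub>s\<in>insert x S. c s \<odot>\<^bsub>N\<^esub> s) \<in> g ` carrier (free_mod R (Suc b))"
      if c: "c \<in> insert x S \<rightarrow> carrier R" for c
    proof -
      have "(\<Oplus>\<^bsub>N\<^esub>s\<in>insert x S. c s \<odot>\<^bsub>N\<^esub> s) = c x \<odot>\<^bsub>N\<^esub> x \<oplus>\<^bsub>N\<^esub> (\<Oplus>\<^bsub>N\<^esub>s\<in>S. c s \<odot>\<^bsub>N\<^esub> s)"
        using insert.hyps insert.prems c by (intro N.finsum_insert) (auto simp: Pi_def)
      then show ?thesis using g(2)[of "c x"] f(2)[of c] c by auto
    qed
    then show ?case using g(1) by blast
  qed
  then obtain b f where f: "f \<in> mod_hom R (free_mod R b) N"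
    "\<forall>c\<in>S \<rightarrow> carrier R. (\<Oplus>\<^bsub>N\<^esub>s\<in>S. c s \<odot>\<^bsub>N\<^esub> s) \<in> f ` carrier (free_mod R b)" by blast
  have "carrier N \<subseteq> f ` carrier (free_mod R b)" using f(2) S(3) by fastforce
  then have "f ` carrier (free_mod R b) = carrier N" using mod_hom_closed[OF f(1)] by blast
  then show ?thesis using acc_surj[OF acc_free_mod[OF R] m f(1)] by blast
qed

section \<open>Minimal covers and minimal resolutions\<close>

text \<open>As \<open>k\<close> is killed by nonunits, some coordinate of \<open>v\<close> is a unit, so \<open>v\<close> can replace a basis vector.\<close>

lemma free_mod_exchange:
  assumes k: "module R k" "\<And>r x. r \<in> carrier R - Units R \<Longrightarrow> x \<in> carrier k \<Longrightarrow> r \<odot>\<^bsub>k\<^esub> x = \<zero>\<^bsub>k\<^esub>"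
    and "\<alpha> \<in> mod_hom R (free_mod R b) k" "v \<in> carrier (free_mod R b)" "\<alpha> v \<noteq> \<zero>\<^bsub>k\<^esub>"
  shows "\<exists>b' \<sigma>. b = Suc b' \<and> \<sigma> \<in> mod_hom R (free_mod R b') (free_mod R b) \<and>
    (\<forall>w\<in>carrier (free_mod R b). \<exists>u\<in>carrier (free_mod R b'). \<exists>c\<in>carrier R.
      w = \<sigma> u \<oplus>\<^bsub>free_mod R b\<^esub> c \<odot>\<^bsub>free_mod R b\<^esub> v)"
  using assms(3-)
proof (induction b arbitrary: \<alpha> v)
  case 0
  then show ?case using mod_hom_zero[OF 0(1) module_free_mod k(1)] by simp
next
  case (Suc b)
  obtain r w where v: "r \<in> carrier R" "w \<in> carrier (free_mod R b)" "v = fcons r w"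
    using Suc.prems(2) by (rule free_mod_SucE)
  show ?case
  proof (cases "r \<in> Units R")
    case True
    \<comment> \<open>As the first coordinate r of \<open>v\<close> is a unit, subtracting s/r times
      \<open>v\<close> clears the first coordinate s of any vector.\<close>
    have "\<exists>u\<in>carrier (free_mod R b). \<exists>c\<in>carrier R.
        y = fcons \<zero> u \<oplus>\<^bsub>free_mod R (Suc b)\<^esub> c \<odot>\<^bsub>free_mod R (Suc b)\<^esub> v"
      if yS: "y \<in> carrier (free_mod R (Suc b))" for y
    proof -
      obtain s z where y: "s \<in> carrier R" "z \<in> carrier (free_mod R b)" "y = fcons s z"
        using yS by (rule free_mod_SucE)
      define c where "c = s \<otimes> inv r"
      have c: "c \<in> carrier R" "c \<otimes> r = s" using True y v by (simp_all add: c_def m_assoc)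
      have "y = fcons \<zero> (z \<ominus>\<^bsub>free_mod R b\<^esub> c \<odot>\<^bsub>free_mod R b\<^esub> w) \<oplus>\<^bsub>free_mod R (Suc b)\<^esub> c \<odot>\<^bsub>free_mod R (Suc b)\<^esub> v"
        using y v c by simp
      then show ?thesis using y v c by (intro bexI[of _ "z \<ominus>\<^bsub>free_mod R b\<^esub> c \<odot>\<^bsub>free_mod R b\<^esub> w"] bexI[of _ c]) auto
    qed
    then show ?thesis using fcons_zero_hom by blast
  next
    case False
    \<comment> \<open>A nonunit first coordinate contributes nothing to \<open>\<alpha> v\<close>,
      so the tail of \<open>v\<close> has nonzero image and the induction hypothesis applies to
      it.\<close>
    have "\<alpha> v = \<alpha> (fcons \<zero> w)"
      using free_mod_hom_fcons[OF Suc.prems(1) v(1,2)] k(1) k(2)[of r] False v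
        mod_hom_closed[OF Suc.prems(1)] by simp
    then have "\<alpha> (fcons \<zero> w) \<noteq> \<zero>\<^bsub>k\<^esub>" using Suc.prems(3) by simp
    from Suc.IH[OF mod_hom_comp[OF fcons_zero_hom Suc.prems(1)] v(2) this]
    obtain b' \<sigma> where b': "b = Suc b'" and \<sigma>: "\<sigma> \<in> mod_hom R (free_mod R b') (free_mod R b)"
      "\<forall>y\<in>carrier (free_mod R b). \<exists>u\<in>carrier (free_mod R b'). \<exists>c\<in>carrier R.
        y = \<sigma> u \<oplus>\<^bsub>free_mod R b\<^esub> c \<odot>\<^bsub>free_mod R b\<^esub> w"
      by blast
    define \<tau> where "\<tau> A = fcons (fhd A) (\<sigma> (ftl A))" for A
    have \<tau>: "\<tau> \<in> mod_hom R (free_mod R b) (free_mod R (Suc b))"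
      unfolding b' by (rule mod_homI)
        (use mod_hom_closed[OF \<sigma>(1)] mod_hom_add[OF \<sigma>(1)] mod_hom_smult[OF \<sigma>(1)] in
          \<open>auto elim!: free_mod_SucE simp: \<tau>_def b' ftl_fcons[of _ R b']\<close>)
    have "\<exists>u\<in>carrier (free_mod R b). \<exists>c\<in>carrier R.
        y = \<tau> u \<oplus>\<^bsub>free_mod R (Suc b)\<^esub> c \<odot>\<^bsub>free_mod R (Suc b)\<^esub> v"
      if yS: "y \<in> carrier (free_mod R (Suc b))" for y
    proof -
      obtain s z where y: "s \<in> carrier R" "z \<in> carrier (free_mod R b)" "y = fcons s z"
        using yS by (rule free_mod_SucE)
      obtain u c where u: "u \<in> carrier (free_mod R b')" "c \<in> carrier R"
        "z = \<sigma> u \<oplus>\<^bsub>free_mod R b\<^esub> c \<odot>\<^bsub>free_mod R b\<^esub> w" using bspec[OF \<sigma>(2) y(2)] by blast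
      have e: "(s \<ominus> c \<otimes> r) \<oplus> c \<otimes> r = s" using y v u by (simp add: a_minus_def a_assoc l_neg)
      have "y = \<tau> (fcons (s \<ominus> c \<otimes> r) u) \<oplus>\<^bsub>free_mod R (Suc b)\<^esub> c \<odot>\<^bsub>free_mod R (Suc b)\<^esub> v"
        using y(1,3) v u e mod_hom_closed[OF \<sigma>(1) u(1)] by (simp add: \<tau>_def)
      moreover have "fcons (s \<ominus> c \<otimes> r) u \<in> carrier (free_mod R b)" unfolding b' using y v u by simp
      ultimately show ?thesis using u(2) by blast
    qed
    then show ?thesis using \<tau> by blast
  qed
qed

text \<open>Otherwise a basis vector could be exchanged for \<open>v\<close>, and since
  \<open>f v = 0\<close> a free module of rank b - 1 would still cover \<open>N\<close>. For the
  residue field k this is the usual condition that the kernel lies in the maximal ideal times the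
  free module, read off through maps to k.\<close>

lemma minimal_cover_kills:
  assumes f: "free_cover b f N" and N: "module R N" and min: "\<And>b' f'. free_cover b' f' N \<Longrightarrow> b \<le> b'"
    and k: "module R k" "\<And>r x. r \<in> carrier R - Units R \<Longrightarrow> x \<in> carrier k \<Longrightarrow> r \<odot>\<^bsub>k\<^esub> x = \<zero>\<^bsub>k\<^esub>"
    and \<alpha>: "\<alpha> \<in> mod_hom R (free_mod R b) k" and v: "v \<in> carrier (free_mod R b)" "f v = \<zero>\<^bsub>N\<^esub>"
  shows "\<alpha> v = \<zero>\<^bsub>k\<^esub>"
proof (rule ccontr)
  assume "\<alpha> v \<noteq> \<zero>\<^bsub>k\<^esub>"
  from free_mod_exchange[OF k \<alpha> v(1) this] obtain b' \<sigma> where b': "b = Suc b'"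
    and \<sigma>: "\<sigma> \<in> mod_hom R (free_mod R b') (free_mod R b)"
    "\<forall>w\<in>carrier (free_mod R b). \<exists>u\<in>carrier (free_mod R b'). \<exists>c\<in>carrier R.
      w = \<sigma> u \<oplus>\<^bsub>free_mod R b\<^esub> c \<odot>\<^bsub>free_mod R b\<^esub> v" by blast
  have fh: "f \<in> mod_hom R (free_mod R b) N" "f ` carrier (free_mod R b) = carrier N"
    using f by (auto simp: free_cover_def)
  have "x \<in> (\<lambda>u. f (\<sigma> u)) ` carrier (free_mod R b')" if x: "x \<in> carrier N" for x
  proof -
    obtain w where w: "w \<in> carrier (free_mod R b)" "x = f w" using fh(2) x by (metis imageE)
    obtain u c where u: "u \<in> carrier (free_mod R b')" "c \<in> carrier R"
      "w = \<sigma> u \<oplus>\<^bsub>free_mod R b\<^esub> c \<odot>\<^bsub>free_mod R b\<^esub> v" using bspec[OF \<sigma>(2) w(1)] by blast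
    have "x = f (\<sigma> u)"
      using u(2) v N mod_hom_closed[OF \<sigma>(1) u(1)] mod_hom_closed[OF fh(1)] unfolding w(2) u(3)
      by (simp add: mod_hom_add[OF fh(1)] mod_hom_smult[OF fh(1)])
    then show ?thesis using u(1) by blast
  qed
  then have "free_cover b' (\<lambda>u. f (\<sigma> u)) N"
    unfolding free_cover_def using mod_hom_comp[OF \<sigma>(1) fh(1)] mod_hom_closed[OF mod_hom_comp[OF \<sigma>(1) fh(1)]] by blast
  then show False using min b' by force
qed

lemma ex_minimal_cover:
  assumes "acc N"
  shows "\<exists>b f. free_cover b f N \<and> (\<forall>b' f'. free_cover b' f' N \<longrightarrow> b \<le> b')"
proof -
  have ex: "\<exists>b. \<exists>f. free_cover b f N" using acc_ex_free_cover[OF assms] .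
  show ?thesis
    using LeastI_ex[OF ex] Least_le[of "\<lambda>b. \<exists>f. free_cover b f N"] by blast
qed

text \<open>A cover of least rank is chosen for every syzygy. The last clause is minimality in the
  form Hom(F_i, k) \<subseteq> Z_i; the clause on \<open>b\<close> makes the resolution finite as
  soon as some rank is 0.\<close>

lemma ex_minimal_resolution:
  fixes k :: "('a, 'k) module" and N :: "('a, 'y) module"
  assumes R: "acc (regular_module R)" and N: "acc N"
    and mk: "module R k" and kill: "\<forall>r\<in>carrier R - Units R. \<forall>x\<in>carrier k. r \<odot>\<^bsub>k\<^esub> x = \<zero>\<^bsub>k\<^esub>"
  shows "\<exists>b d e. projective_resolution R N (\<lambda>i. free_mod R (b i)) d e \<and>
    (\<forall>i. b i = 0 \<longrightarrow> b (Suc i) = 0) \<and>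
    (\<forall>i. \<forall>\<alpha>\<in>mod_hom R (free_mod R (b i)) k. \<forall>x\<in>carrier (free_mod R (b (Suc i))). \<alpha> (d i x) = \<zero>\<^bsub>k\<^esub>)"
proof -
  have k: "module R k" "\<And>r x. r \<in> carrier R - Units R \<Longrightarrow> x \<in> carrier k \<Longrightarrow> r \<odot>\<^bsub>k\<^esub> x = \<zero>\<^bsub>k\<^esub>"
    using mk kill by blast+
  obtain b0 e where e: "free_cover b0 e N" and e_min: "\<And>b' f'. free_cover b' f' N \<Longrightarrow> b0 \<le> b'"
    using ex_minimal_cover[OF N] by blast
  note mN = acc_module[OF N]
  have eh: "e \<in> mod_hom R (free_mod R b0) N" "e ` carrier (free_mod R b0) = carrier N"
    using e by (auto simp: free_cover_def)
  define good where "good K c \<longleftrightarrow> free_cover (fst c) (snd c) K \<and> (\<forall>b' f'. free_cover b' f' K \<longrightarrow> fst c \<le> b')"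
    for K :: "('a, 'a univ) module" and c
  have "\<exists>c. \<forall>K. acc K \<longrightarrow> good K (c K)"
  proof (intro choice allI)
    fix K :: "('a, 'a univ) module"
    show "\<exists>c. acc K \<longrightarrow> good K c"
    proof (cases "acc K")
      case True
      from ex_minimal_cover[OF this] obtain b f where "free_cover b f K \<and> (\<forall>b' f'. free_cover b' f' K \<longrightarrow> b \<le> b')"
        by blast
      then have "good K (b, f)" by (simp add: good_def)
      then show ?thesis by blast
    qed simp
  qed
  then obtain c where c: "\<And>K. acc K \<Longrightarrow> good K (c K)" by blast
  define B f where "B K = fst (c K)" and "f K = snd (c K)" for K
  have cov: "free_cover (B K) (f K) K" and cov_min: "\<And>b' f'. free_cover b' f' K \<Longrightarrow> B K \<le> b'" if "acc K" for K
    using c[OF that] by (auto simp: good_def B_def f_def)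
  \<comment> \<open>\<open>K i\<close> is the kernel inside the free module of index i, and the free
    module of index i + 1 covers it.\<close>
  define K where "K = rec_nat (free_mod R b0\<lparr>carrier := a_kernel (free_mod R b0) N e\<rparr>)
    (\<lambda>_ K. free_mod R (B K)\<lparr>carrier := a_kernel (free_mod R (B K)) K (f K)\<rparr>)"
  have K: "K 0 = free_mod R b0\<lparr>carrier := a_kernel (free_mod R b0) N e\<rparr>"
    "K (Suc i) = free_mod R (B (K i))\<lparr>carrier := a_kernel (free_mod R (B (K i))) (K i) (f (K i))\<rparr>" for i
    by (simp_all add: K_def)
  have accK: "acc (K i)" for i
  proof (induction i)
    case 0
    show ?case unfolding K
      by (rule acc_submodule[OF acc_free_mod[OF R] submodule_kernel[OF eh(1) module_free_mod mN]])
  next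
    case (Suc i)
    have "f (K i) \<in> mod_hom R (free_mod R (B (K i))) (K i)" using cov[OF Suc] by (simp add: free_cover_def)
    then show ?case unfolding K
      by (rule acc_submodule[OF acc_free_mod[OF R] submodule_kernel[OF _ module_free_mod acc_module[OF Suc]]])
  qed
  define b where "b i = (case i of 0 \<Rightarrow> b0 | Suc j \<Rightarrow> B (K j))" for i
  define d where "d i = f (K i)" for i
  have b: "b 0 = b0" "b (Suc i) = B (K i)" for i by (simp_all add: b_def)
  have covd: "d i \<in> mod_hom R (free_mod R (b (Suc i))) (K i)" "d i ` carrier (free_mod R (b (Suc i))) = carrier (K i)" for i
    using cov[OF accK[of i]] by (auto simp: free_cover_def b d_def)
  have Ksub: "K i = free_mod R (b i)\<lparr>carrier := carrier (K i)\<rparr>" "carrier (K i) \<subseteq> carrier (free_mod R (b i))" for i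
    by (cases i; simp add: K b; auto simp: a_kernel_iff)+
  have zK: "\<zero>\<^bsub>K i\<^esub> = \<zero>\<^bsub>free_mod R (b i)\<^esub>" for i by (cases i) (simp_all add: K b)
  have dh: "d i \<in> mod_hom R (free_mod R (b (Suc i))) (free_mod R (b i))" for i
    using mod_hom_carrier_updateD[where f = "d i" and M = "free_mod R (b (Suc i))" and N = "free_mod R (b i)" and S = "carrier (K i)"]
      covd(1)[of i] Ksub[of i] by metis
  have "projective_resolution R N (\<lambda>i. free_mod R (b i)) d e"
    unfolding projective_resolution_def
  proof (intro conjI allI)
    show "d 0 ` carrier (free_mod R (b (Suc 0))) = a_kernel (free_mod R (b 0)) N e"
      using covd(2)[of 0] by (simp add: K b)
    show "d (Suc i) ` carrier (free_mod R (b (Suc (Suc i)))) = a_kernel (free_mod R (b (Suc i))) (free_mod R (b i)) (d i)" for i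
      using covd(2)[of "Suc i"] zK[of i] by (simp add: K b d_def a_kernel_def')
  qed (use projective_free_mod eh dh in \<open>simp_all add: b\<close>)
  moreover have "b (Suc i) = 0" if "b i = 0" for i
  proof -
    have "carrier (K i) = {\<zero>\<^bsub>K i\<^esub>}"
      using Ksub(2)[of i] that module_zero_closed[OF acc_module[OF accK[of i]]] by auto
    then have "free_cover 0 (\<lambda>x. \<zero>\<^bsub>K i\<^esub>) (K i)"
      using mod_hom_const_zero[OF acc_module[OF accK]] by (auto simp: free_cover_def)
    then show ?thesis using cov_min[OF accK] by (force simp: b)
  qed
  moreover have "\<alpha> (d i x) = \<zero>\<^bsub>k\<^esub>" if \<alpha>: "\<alpha> \<in> mod_hom R (free_mod R (b i)) k" and x: "x \<in> carrier (free_mod R (b (Suc i)))" for i \<alpha> x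
  proof -
    have dx: "d i x \<in> carrier (K i)" using covd(2) x by blast
    show ?thesis
    proof (cases i)
      case 0
      then show ?thesis
        using dx minimal_cover_kills[OF e mN e_min k, where \<alpha> = \<alpha> and v = "d i x"] \<alpha> by (simp add: K b a_kernel_iff)
    next
      case (Suc j)
      then show ?thesis
        using dx minimal_cover_kills[OF cov[OF accK[of j]] acc_module[OF accK] cov_min[OF accK] k, where \<alpha> = \<alpha> and v = "d i x"] \<alpha>
        by (simp add: K b a_kernel_iff)
    qed
  qed
  ultimately show ?thesis by blast
qed

section \<open>Hom from free modules\<close>

definition hom_incl where
  "hom_incl L b y = (\<lambda>A\<in>carrier (free_mod R (Suc b)). fhd A \<odot>\<^bsub>L\<^esub> y)"

definition hom_rest where
  "hom_rest b \<phi> = (\<lambda>A\<in>carrier (free_mod R b). \<phi> (fcons \<zero> A))"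

text \<open>Splitting off the first coordinate exhibits Hom(R^(b+1), L) as an extension of Hom(R^b,
  L) by \<open>L\<close>; conditions closed under extensions then pass from \<open>L\<close> to all
  Hom(R^b, L) by induction.\<close>

lemma ses_hom_free:
  assumes L: "module R L"
  shows "ses L (hom_incl L b) (hom_module R (free_mod R (Suc b)) L) (hom_rest b) (hom_module R (free_mod R b) L)"
proof -
  let ?F = "free_mod R (Suc b)" and ?F' = "free_mod R b"
  note ext = extensionalityI[where A = "carrier ?F"] and ext' = extensionalityI[where A = "carrier ?F'"]
  have incl: "hom_incl L b y \<in> mod_hom R ?F L" if "y \<in> carrier L" for y
    unfolding hom_incl_def
    by (rule mod_hom_restrict, rule mod_homI) (use that L in \<open>auto elim!: free_mod_SucE simp: module_add_smult module_mult_smult\<close>)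
  have rest: "hom_rest b \<phi> \<in> mod_hom R ?F' L" if "\<phi> \<in> mod_hom R ?F L" for \<phi>
    unfolding hom_rest_def by (rule mod_hom_restrict[OF mod_hom_comp[OF fcons_zero_hom that] module_free_mod])
  have z: "fcons \<zero> A \<in> carrier ?F" if "A \<in> carrier ?F'" for A using that by simp
  show ?thesis
  proof (rule sesI[OF L module_hom_module[OF module_free_mod L] module_hom_module[OF module_free_mod L]])
    show "hom_incl L b \<in> mod_hom R L (hom_module R ?F L)"
    proof (rule mod_homI)
      show "hom_incl L b y \<in> carrier (hom_module R ?F L)" if "y \<in> carrier L" for y
        using incl[OF that] by (simp add: hom_incl_def)
      show "hom_incl L b (x \<oplus>\<^bsub>L\<^esub> y) = hom_incl L b x \<oplus>\<^bsub>hom_module R ?F L\<^esub> hom_incl L b y"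
        if "x \<in> carrier L" "y \<in> carrier L" for x y
        using that L by (intro ext) (auto elim!: free_mod_SucE simp: hom_incl_def module_smult_add)
      show "hom_incl L b (r \<odot>\<^bsub>L\<^esub> x) = r \<odot>\<^bsub>hom_module R ?F L\<^esub> hom_incl L b x"
        if "r \<in> carrier R" "x \<in> carrier L" for r x
        using that L by (intro ext) (auto elim!: free_mod_SucE simp: hom_incl_def module_mult_smult[symmetric] m_comm)
    qed
    show "hom_rest b \<in> mod_hom R (hom_module R ?F L) (hom_module R ?F' L)"
    proof (rule mod_homI)
      show "hom_rest b \<phi> \<in> carrier (hom_module R ?F' L)" if "\<phi> \<in> carrier (hom_module R ?F L)" for \<phi>
        using rest[of \<phi>] that by (simp add: hom_rest_def)
    qed (auto simp: hom_rest_def)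
    show "y = \<zero>\<^bsub>L\<^esub>" if "y \<in> carrier L" "hom_incl L b y = \<zero>\<^bsub>hom_module R ?F L\<^esub>" for y
      using fun_cong[OF that(2), of "fcons \<one> \<zero>\<^bsub>?F'\<^esub>"] that(1) L by (simp add: hom_incl_def)
    show "hom_rest b (hom_incl L b y) = \<zero>\<^bsub>hom_module R ?F' L\<^esub>" if "y \<in> carrier L" for y
      using that L by (intro ext') (auto simp: hom_rest_def hom_incl_def)
    show "\<exists>y\<in>carrier L. hom_incl L b y = \<phi>"
      if \<phi>: "\<phi> \<in> carrier (hom_module R ?F L)" and van: "hom_rest b \<phi> = \<zero>\<^bsub>hom_module R ?F' L\<^esub>" for \<phi>
    proof (intro bexI[of _ "\<phi> (fcons \<one> \<zero>\<^bsub>?F'\<^esub>)"] ext)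
      have h: "\<phi> \<in> mod_hom R ?F L" using \<phi> by simp
      then show c: "\<phi> (fcons \<one> \<zero>\<^bsub>?F'\<^esub>) \<in> carrier L" by (rule mod_hom_closed) simp
      fix A assume "A \<in> carrier ?F"
      then obtain r B where A: "r \<in> carrier R" "B \<in> carrier ?F'" "A = fcons r B" by (rule free_mod_SucE)
      then have "\<phi> (fcons \<zero> B) = \<zero>\<^bsub>L\<^esub>" using fun_cong[OF van, of B] by (simp add: hom_rest_def)
      then show "hom_incl L b (\<phi> (fcons \<one> \<zero>\<^bsub>?F'\<^esub>)) A = \<phi> A"
        using free_mod_hom_fcons[OF h A(1,2)] A c L by (simp add: hom_incl_def)
    qed (use \<phi> in \<open>simp_all add: hom_incl_def\<close>)
    show "\<exists>\<phi>\<in>carrier (hom_module R ?F L). hom_rest b \<phi> = \<psi>" if \<psi>: "\<psi> \<in> carrier (hom_module R ?F' L)" for \<psi>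
    proof (intro bexI[of _ "restrict (\<lambda>A. fhd A \<odot>\<^bsub>L\<^esub> \<zero>\<^bsub>L\<^esub> \<oplus>\<^bsub>L\<^esub> \<psi> (ftl A)) (carrier ?F)"] ext')
      have h: "\<psi> \<in> mod_hom R ?F' L" using \<psi> by simp
      show "restrict (\<lambda>A. fhd A \<odot>\<^bsub>L\<^esub> \<zero>\<^bsub>L\<^esub> \<oplus>\<^bsub>L\<^esub> \<psi> (ftl A)) (carrier ?F) \<in> carrier (hom_module R ?F L)"
        using mod_hom_restrict[OF free_mod_extend_hom[OF L module_zero_closed[OF L] h] module_free_mod] by simp
      show "hom_rest b (restrict (\<lambda>A. fhd A \<odot>\<^bsub>L\<^esub> \<zero>\<^bsub>L\<^esub> \<oplus>\<^bsub>L\<^esub> \<psi> (ftl A)) (carrier ?F)) B = \<psi> B"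
        if "B \<in> carrier ?F'" for B
        using that L mod_hom_closed[OF h that] by (simp add: hom_rest_def)
    qed (use \<psi> in \<open>simp_all add: hom_rest_def\<close>)
  qed
qed

lemma carrier_hom_free_0:
  assumes L: "module R L"
  shows "carrier (hom_module R (free_mod R 0) L) = {\<zero>\<^bsub>hom_module R (free_mod R 0) L\<^esub>}"
proof -
  have "\<phi> = \<zero>\<^bsub>hom_module R (free_mod R 0) L\<^esub>" if "\<phi> \<in> carrier (hom_module R (free_mod R 0) L)" for \<phi>
    using that mod_hom_zero[OF _ module_free_mod L, of \<phi> 0]
    by (intro extensionalityI[where A = "carrier (free_mod R 0)"]) auto
  then show ?thesis using module_zero_closed[OF module_hom_module[OF module_free_mod L]] by blast
qed

lemma acc_hom_free:
  assumes "acc L"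
  shows "acc (hom_module R (free_mod R b) L)"
proof (induction b)
  case 0
  show ?case
    by (rule acc_zero[OF module_hom_module[OF module_free_mod acc_module[OF assms]] carrier_hom_free_0[OF acc_module[OF assms]]])
next
  case (Suc b)
  show ?case by (rule acc_ses[OF ses_hom_free[OF acc_module[OF assms]] assms Suc])
qed

text \<open>Precomposition with a free cover of \<open>K\<close> embeds this module into some
  Hom(R^b, L).\<close>

lemma acc_hom:
  assumes K: "acc K" and L: "acc L"
  shows "acc (hom_module R K L)"
proof -
  note m = acc_module[OF K] acc_module[OF L]
  obtain b f where f: "f \<in> mod_hom R (free_mod R b) K" "f ` carrier (free_mod R b) = carrier K"
    using acc_ex_free_cover[OF K] unfolding free_cover_def by blast
  let ?F = "free_mod R b"
  let ?i = "\<lambda>\<phi>. \<lambda>A\<in>carrier ?F. \<phi> (f A)"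
  have "?i \<in> mod_hom R (hom_module R K L) (hom_module R ?F L)"
  proof (rule mod_homI)
    show "?i \<phi> \<in> carrier (hom_module R ?F L)" if "\<phi> \<in> carrier (hom_module R K L)" for \<phi>
      using mod_hom_restrict[OF mod_hom_comp[OF f(1), of \<phi>] module_free_mod] that by simp
  qed (auto simp: mod_hom_closed[OF f(1)])
  moreover have "inj_on ?i (carrier (hom_module R K L))"
  proof (rule inj_onI)
    fix \<phi> \<psi> assume h: "\<phi> \<in> carrier (hom_module R K L)" "\<psi> \<in> carrier (hom_module R K L)" and eq: "?i \<phi> = ?i \<psi>"
    show "\<phi> = \<psi>"
    proof (rule extensionalityI[where A = "carrier K"])
      fix x assume "x \<in> carrier K"
      then obtain A where "A \<in> carrier ?F" "x = f A" using f(2) by (metis imageE)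
      then show "\<phi> x = \<psi> x" using fun_cong[OF eq, of A] by simp
    qed (use h in auto)
  qed
  ultimately show ?thesis
    by (rule acc_inj[OF acc_hom_free[OF L] module_hom_module[OF m]])
qed

end

section \<open>Noetherian presentations of cohomology\<close>

context coresolution
begin

lemma ext_zero_zero_module:
  assumes N: "module R N" and z: "carrier N = {\<zero>\<^bsub>N\<^esub>}"
  shows "ext_zero N j"
  unfolding ext_zero_def
proof (intro allI impI)
  fix f assume "cocycle N j f"
  then have "f x = \<zero>\<^bsub>J (Suc j)\<^esub>" if "x \<in> carrier N" for x
    using mod_hom_zero[OF cocycle_hom N J_module] that z by simp
  then show "coboundary N j f" by (rule coboundary_cong[OF coboundary_zero])
qed

lemma ext_zero_hom_free:
  assumes L: "module R L" and e: "ext_zero L (Suc j)"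
  shows "ext_zero (hom_module R (free_mod R b) L) (Suc j)"
proof (induction b)
  case 0
  show ?case by (rule ext_zero_zero_module[OF module_hom_module[OF module_free_mod L] carrier_hom_free_0[OF L]])
next
  case (Suc b)
  show ?case by (rule ext_zero_extension[OF ses_hom_free[OF L] e Suc])
qed

text \<open>In positive rank \<open>L\<close> is a direct summand of the Hom module, split by
  evaluation at the first basis vector.\<close>

lemma ext_zero_of_hom_free:
  assumes L: "module R L" and e: "ext_zero (hom_module R (free_mod R (Suc b)) L) j"
  shows "ext_zero L j"
proof (rule ext_zero_retract[OF e ses_homs(1)[OF ses_hom_free[OF L]]])
  show "(\<lambda>\<phi>. \<phi> (fcons \<one> \<zero>\<^bsub>free_mod R b\<^esub>)) \<in> mod_hom R (hom_module R (free_mod R (Suc b)) L) L"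
    by (rule mod_homI) (auto simp: mod_hom_closed)
qed (use L in \<open>simp add: hom_incl_def\<close>)

text \<open>A linear relation presenting the cohomology of \<open>Hom(N, J)\<close> in degree \<open>j\<close> as a quotient of a
  noetherian module. This replaces finite generation of Ext modules.\<close>

definition presents :: "('a, 't) module \<Rightarrow> ('t \<Rightarrow> ('n \<Rightarrow> 'a univ) \<Rightarrow> bool) \<Rightarrow> ('a, 'n) module \<Rightarrow> nat \<Rightarrow> bool" where
  "presents T \<Theta> N j \<longleftrightarrow> acc T \<and> (\<forall>t f. \<Theta> t f \<longrightarrow> t \<in> carrier T \<and> cocycle N j f)
    \<and> (\<forall>t\<in>carrier T. \<exists>f. \<Theta> t f) \<and> (\<forall>f. cocycle N j f \<longrightarrow> (\<exists>t. \<Theta> t f))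
    \<and> (\<forall>t f t' f'. \<Theta> t f \<and> \<Theta> t' f' \<longrightarrow> \<Theta> (t \<oplus>\<^bsub>T\<^esub> t') (\<lambda>x. f x \<oplus>\<^bsub>J (Suc j)\<^esub> f' x))
    \<and> (\<forall>t f. \<forall>r\<in>carrier R. \<Theta> t f \<longrightarrow> \<Theta> (r \<odot>\<^bsub>T\<^esub> t) (\<lambda>x. r \<odot>\<^bsub>J (Suc j)\<^esub> f x))
    \<and> (\<forall>f. \<Theta> \<zero>\<^bsub>T\<^esub> f \<longrightarrow> coboundary N j f)"

lemma
  assumes "presents T \<Theta> N j"
  shows presents_acc: "acc T"
    and presents_cocycle: "\<And>t f. \<Theta> t f \<Longrightarrow> cocycle N j f"
    and presents_carrier: "\<And>t f. \<Theta> t f \<Longrightarrow> t \<in> carrier T"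
    and presents_total: "\<And>t. t \<in> carrier T \<Longrightarrow> \<exists>f. \<Theta> t f"
    and presents_onto: "\<And>f. cocycle N j f \<Longrightarrow> \<exists>t. \<Theta> t f"
    and presents_plus: "\<And>t f t' f'. \<Theta> t f \<Longrightarrow> \<Theta> t' f' \<Longrightarrow> \<Theta> (t \<oplus>\<^bsub>T\<^esub> t') (\<lambda>x. f x \<oplus>\<^bsub>J (Suc j)\<^esub> f' x)"
    and presents_scale: "\<And>t f r. r \<in> carrier R \<Longrightarrow> \<Theta> t f \<Longrightarrow> \<Theta> (r \<odot>\<^bsub>T\<^esub> t) (\<lambda>x. r \<odot>\<^bsub>J (Suc j)\<^esub> f x)"
    and presents_zero: "\<And>f. \<Theta> \<zero>\<^bsub>T\<^esub> f \<Longrightarrow> coboundary N j f"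
  using assms unfolding presents_def by simp_all

text \<open>The kernel of the homomorphism from \<open>T\<close> to the cohomology that \<Theta>
  induces.\<close>

definition present_kernel where
  "present_kernel \<Theta> N j = {t. \<exists>f. \<Theta> t f \<and> coboundary N j f}"

lemma present_kernelI: "\<Theta> t f \<Longrightarrow> coboundary N j f \<Longrightarrow> t \<in> present_kernel \<Theta> N j"
  unfolding present_kernel_def by blast

text \<open>Two cocycles related to the same \<open>t\<close> differ by one related to 0, which is a
  coboundary; so the choice of the cocycle does not matter.\<close>

lemma presents_kernel_coboundary:
  assumes p: "presents T \<Theta> N j" and t: "t \<in> present_kernel \<Theta> N j" and f: "\<Theta> t f"
  shows "coboundary N j f"
proof -
  obtain g where g: "\<Theta> t g" "coboundary N j g" using t unfolding present_kernel_def by blast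
  have "\<Theta> (t \<oplus>\<^bsub>T\<^esub> (\<ominus> \<one>) \<odot>\<^bsub>T\<^esub> t) (\<lambda>x. f x \<oplus>\<^bsub>J (Suc j)\<^esub> (\<ominus> \<one>) \<odot>\<^bsub>J (Suc j)\<^esub> g x)"
    using presents_plus[OF p, OF f presents_scale[OF p, OF a_inv_closed[OF one_closed] g(1)]] .
  moreover have "t \<oplus>\<^bsub>T\<^esub> (\<ominus> \<one>) \<odot>\<^bsub>T\<^esub> t = \<zero>\<^bsub>T\<^esub>"
    using presents_carrier[OF p, OF f] acc_module[OF presents_acc[OF p]] by (simp add: module_neg_eq_smult[symmetric])
  ultimately have "coboundary N j (\<lambda>x. f x \<oplus>\<^bsub>J (Suc j)\<^esub> (\<ominus> \<one>) \<odot>\<^bsub>J (Suc j)\<^esub> g x)"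
    using presents_zero[OF p] by simp
  from coboundary_plus[OF this g(2)] show ?thesis
  proof (rule coboundary_cong)
    fix x assume x: "x \<in> carrier N"
    have "f x \<in> carrier (J (Suc j))" "g x \<in> carrier (J (Suc j))"
      using mod_hom_closed[OF cocycle_hom[OF presents_cocycle[OF p]] x] f g(1) by blast+
    then show "f x = (f x \<oplus>\<^bsub>J (Suc j)\<^esub> (\<ominus> \<one>) \<odot>\<^bsub>J (Suc j)\<^esub> g x) \<oplus>\<^bsub>J (Suc j)\<^esub> g x"
      by (simp add: module_minus_eq_smult[symmetric])
  qed
qed

lemma submodule_present_kernel:
  assumes p: "presents T \<Theta> N j"
  shows "submodule (present_kernel \<Theta> N j) R T"
proof (rule submodule_intro[OF acc_module[OF presents_acc[OF p]]])
  show "present_kernel \<Theta> N j \<subseteq> carrier T" using presents_carrier[OF p] unfolding present_kernel_def by blast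
  show "\<zero>\<^bsub>T\<^esub> \<in> present_kernel \<Theta> N j"
    using presents_total[OF p, OF module_zero_closed[OF acc_module[OF presents_acc[OF p]]]] presents_zero[OF p]
    unfolding present_kernel_def by blast
  fix x y r assume "x \<in> present_kernel \<Theta> N j"
  then obtain f where f: "\<Theta> x f" "coboundary N j f" unfolding present_kernel_def by blast
  show "r \<odot>\<^bsub>T\<^esub> x \<in> present_kernel \<Theta> N j" if "r \<in> carrier R"
    by (rule present_kernelI[of \<Theta>, OF presents_scale[OF p, OF that f(1)] coboundary_scale[OF f(2) that]])
  assume "y \<in> present_kernel \<Theta> N j"
  then obtain g where g: "\<Theta> y g" "coboundary N j g" unfolding present_kernel_def by blast
  show "x \<oplus>\<^bsub>T\<^esub> y \<in> present_kernel \<Theta> N j"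
    by (rule present_kernelI[of \<Theta>, OF presents_plus[OF p, OF f(1) g(1)] coboundary_plus[OF f(2) g(2)]])
qed

text \<open>\<Theta> is composed with the connecting relation. By \<open>H\<close> every class of
  \<open>C\<close> in the next degree dies in \<open>B\<close>, so the connecting map is
  onto.\<close>

lemma presents_shift:
  assumes p: "presents T \<Theta> A (Suc j)" and s: "ses A i B p' C"
    and H: "\<And>f'. cocycle C (Suc (Suc j)) f' \<Longrightarrow> coboundary B (Suc (Suc j)) (\<lambda>x. f' (p' x))"
  shows "presents T (\<lambda>t f'. \<exists>f. \<Theta> t f \<and> connect A i B p' (Suc j) f f' \<and> cocycle C (Suc (Suc j)) f') C (Suc (Suc j))"
    (is "presents T ?\<Theta> C _")
  unfolding presents_def
proof (intro conjI allI ballI impI)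
  show "\<exists>f'. ?\<Theta> t f'" if "t \<in> carrier T" for t
  proof -
    obtain f where f: "\<Theta> t f" using presents_total[OF p, OF \<open>t \<in> carrier T\<close>] by blast
    then show ?thesis using connect_exists[OF s presents_cocycle[OF p, OF f]] by blast
  qed
  show "\<exists>t. ?\<Theta> t f'" if f': "cocycle C (Suc (Suc j)) f'" for f'
  proof -
    obtain f where f: "cocycle A (Suc j) f" "connect A i B p' (Suc j) f f'" using connect_surj[OF s f' H[OF f']] by blast
    then show ?thesis using presents_onto[OF p, OF f(1)] f' by blast
  qed
  show "?\<Theta> (t \<oplus>\<^bsub>T\<^esub> t') (\<lambda>x. f x \<oplus>\<^bsub>J (Suc (Suc (Suc j)))\<^esub> f' x)" if tt: "?\<Theta> t f \<and> ?\<Theta> t' f'" for t f t' f'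
  proof -
    obtain g g' where g: "\<Theta> t g" "connect A i B p' (Suc j) g f" "\<Theta> t' g'" "connect A i B p' (Suc j) g' f'"
      "cocycle C (Suc (Suc j)) f" "cocycle C (Suc (Suc j)) f'" using tt by blast
    show ?thesis
      using presents_plus[OF p, OF g(1,3)] connect_plus[OF s g(2,4)] cocycle_plus[OF g(5,6)] by blast
  qed
  show "?\<Theta> (r \<odot>\<^bsub>T\<^esub> t) (\<lambda>x. r \<odot>\<^bsub>J (Suc (Suc (Suc j)))\<^esub> f x)" if r: "r \<in> carrier R" and tf: "?\<Theta> t f" for t f r
  proof -
    obtain g where g: "\<Theta> t g" "connect A i B p' (Suc j) g f" "cocycle C (Suc (Suc j)) f" using tf by blast
    show ?thesis
      using presents_scale[OF p, OF r g(1)] connect_scale[OF g(2) r] cocycle_scale[OF g(3) r] by blast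
  qed
  show "coboundary C (Suc (Suc j)) f" if "?\<Theta> \<zero>\<^bsub>T\<^esub> f" for f
    using that connect_coboundary_Suc[OF s] presents_zero[OF p] by blast
qed (use presents_acc[OF p] ses_modules(3)[OF s] presents_carrier[OF p] in auto)

text \<open>Ext^1(N, J 0) is a quotient of Hom(K, J 0), which is noetherian.\<close>

lemma presents_base:
  assumes s: "ses K i P p N" and P: "\<And>j. ext_zero P j" and K: "acc K" and J0: "acc (J 0)"
  shows "\<exists>\<Theta>. presents (hom_module R K (J 0)) \<Theta> N (Suc 0)"
proof -
  have cong: "connect K i P p 0 g f'" if "connect K i P p 0 f f'" "\<And>x. x \<in> carrier K \<Longrightarrow> g x = f x" for f g f'
    using that unfolding connect_def by metis
  note mK = acc_module[OF K]
  let ?T = "hom_module R K (J 0)"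
  \<comment> \<open>A map \<open>u\<close> into \<open>J 0\<close> is fed to \<open>connect\<close>
    as the degree 0 cocycle obtained by composing with \<open>\<delta> 0\<close>.\<close>
  define \<Theta> where "\<Theta> u f' \<longleftrightarrow> u \<in> carrier ?T \<and> connect K i P p 0 (\<lambda>x. \<delta> 0 (u x)) f' \<and> cocycle N (Suc 0) f'" for u f'
  have "presents ?T \<Theta> N (Suc 0)"
    unfolding presents_def
  proof (intro conjI allI ballI impI)
    show "acc ?T" by (rule acc_hom[OF K J0])
    show "\<exists>f'. \<Theta> u f'" if u: "u \<in> carrier ?T" for u
    proof -
      have h: "u \<in> mod_hom R K (J 0)" using u by simp
      then have "cocycle K 0 (\<lambda>x. \<delta> 0 (u x))"
        using mod_hom_comp[OF h \<delta>_hom] by (simp add: cocycle_def \<delta>_\<delta> mod_hom_closed[OF h])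
      from connect_exists[OF s this] show ?thesis using u by (auto simp: \<Theta>_def simp del: hom_module_simps)
    qed
    show "\<exists>u. \<Theta> u f'" if f': "cocycle N (Suc 0) f'" for f'
    proof -
      have "coboundary P (Suc 0) (\<lambda>x. f' (p x))"
        using P cocycle_comp[OF f' ses_homs(2)[OF s]] unfolding ext_zero_def by blast
      from connect_surj[OF s f' this] obtain f where f: "cocycle K 0 f" "connect K i P p 0 f f'" by blast
      from f(1) have "coboundary K 0 f" using ext_zero_0[OF mK] by (simp add: ext_zero_def)
      then obtain u where u: "u \<in> mod_hom R K (J 0)" "\<forall>x\<in>carrier K. f x = \<delta> 0 (u x)"
        unfolding coboundary_def by blast
      have "connect K i P p 0 (\<lambda>x. \<delta> 0 (restrict u (carrier K) x)) f'"
        by (rule cong[OF f(2)]) (simp add: u(2))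
      moreover have "restrict u (carrier K) \<in> carrier ?T" using mod_hom_restrict[OF u(1) mK] by simp
      ultimately show ?thesis using f' unfolding \<Theta>_def by blast
    qed
    show "\<Theta> (u \<oplus>\<^bsub>?T\<^esub> v) (\<lambda>x. f x \<oplus>\<^bsub>J (Suc (Suc 0))\<^esub> g x)" if uv: "\<Theta> u f \<and> \<Theta> v g" for u f v g
      unfolding \<Theta>_def
    proof (intro conjI)
      show "u \<oplus>\<^bsub>?T\<^esub> v \<in> carrier ?T"
        using uv[unfolded \<Theta>_def] module_add_closed[OF module_hom_module[OF mK J_module]] by blast
      show "connect K i P p 0 (\<lambda>x. \<delta> 0 ((u \<oplus>\<^bsub>?T\<^esub> v) x)) (\<lambda>x. f x \<oplus>\<^bsub>J (Suc (Suc 0))\<^esub> g x)"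
        by (rule cong[OF connect_plus[OF s, of 0 "\<lambda>x. \<delta> 0 (u x)" f "\<lambda>x. \<delta> 0 (v x)" g]])
          (use uv in \<open>auto simp: mod_hom_add[OF \<delta>_hom] mod_hom_closed[of _ K] \<Theta>_def\<close>)
      show "cocycle N (Suc 0) (\<lambda>x. f x \<oplus>\<^bsub>J (Suc (Suc 0))\<^esub> g x)" using uv unfolding \<Theta>_def by (intro cocycle_plus) auto
    qed
    show "\<Theta> (r \<odot>\<^bsub>?T\<^esub> u) (\<lambda>x. r \<odot>\<^bsub>J (Suc (Suc 0))\<^esub> f x)" if r: "r \<in> carrier R" and u: "\<Theta> u f" for u f r
      unfolding \<Theta>_def
    proof (intro conjI)
      show "r \<odot>\<^bsub>?T\<^esub> u \<in> carrier ?T"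
        using u[unfolded \<Theta>_def] r module_smult_closed[OF module_hom_module[OF mK J_module]] by blast
      show "connect K i P p 0 (\<lambda>x. \<delta> 0 ((r \<odot>\<^bsub>?T\<^esub> u) x)) (\<lambda>x. r \<odot>\<^bsub>J (Suc (Suc 0))\<^esub> f x)"
        by (rule cong[OF connect_scale[of K i P p 0 "\<lambda>x. \<delta> 0 (u x)" f r]])
          (use u r in \<open>auto simp: mod_hom_smult[OF \<delta>_hom] mod_hom_closed[of _ K] \<Theta>_def\<close>)
      show "cocycle N (Suc 0) (\<lambda>x. r \<odot>\<^bsub>J (Suc (Suc 0))\<^esub> f x)" using u r unfolding \<Theta>_def by (intro cocycle_scale) auto
    qed
    \<comment> \<open>\<open>J 0\<close> need not be injective, so the extension to \<open>P\<close>
      of the primitive is named explicitly: for u = 0 it is the zero map.\<close>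
    show "coboundary N (Suc 0) f" if "\<Theta> \<zero>\<^bsub>?T\<^esub> f" for f
      using that unfolding \<Theta>_def by (intro connect_coboundary[OF s, of 0 "\<lambda>x. \<delta> 0 (\<zero>\<^bsub>?T\<^esub> x)" f "\<lambda>x. \<zero>\<^bsub>J 0\<^esub>"] mod_hom_const_zero) auto
  qed (use ses_modules(3)[OF s] in \<open>auto simp: \<Theta>_def\<close>)
  then show ?thesis by blast
qed

lemma ext_zero_free_mod: "ext_zero (free_mod R b) j"
  by (rule ext_zero_projective[OF projective_free_mod])

lemma acc_cover_ses:
  assumes R: "acc (regular_module R)" and N: "acc N"
  obtains K b f where "acc K" "ses K (\<lambda>x. x) (free_mod R b) f N"
proof -
  obtain b f where f: "f \<in> mod_hom R (free_mod R b) N" "f ` carrier (free_mod R b) = carrier N"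
    using acc_ex_free_cover[OF N] unfolding free_cover_def by blast
  show ?thesis
    by (rule that[OF acc_submodule[OF acc_free_mod[OF R] submodule_kernel[OF f(1) module_free_mod acc_module[OF N]]]
      ses_kernel[OF module_free_mod acc_module[OF N] f]])
qed

text \<open>The induction replaces \<open>N\<close> by the kernel of a free cover, which lies in the
  universe; so it is run for modules in the universe. The module \<open>T\<close> is Hom(K, J 0) for
  the last syzygy reached, whence its type.\<close>

lemma ex_presents_univ:
  fixes N :: "('a, 'a univ) module"
  assumes R: "acc (regular_module R)" and J0: "acc (J 0)" and N: "acc N"
  shows "\<exists>(T :: ('a, 'a univ \<Rightarrow> 'a univ) module) \<Theta>. presents T \<Theta> N (Suc j)"
  using N
proof (induction j arbitrary: N)
  case 0
  obtain K b f where K: "acc K" "ses K (\<lambda>x. x) (free_mod R b) f N" by (rule acc_cover_ses[OF R 0])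
  show ?case using presents_base[OF K(2) ext_zero_free_mod K(1) J0] by blast
next
  case (Suc j)
  obtain K b f where K: "acc K" "ses K (\<lambda>x. x) (free_mod R b) f N" by (rule acc_cover_ses[OF R Suc.prems])
  obtain T :: "('a, 'a univ \<Rightarrow> 'a univ) module" and \<Theta> where T: "presents T \<Theta> K (Suc j)" using Suc.IH[OF K(1)] by blast
  have "coboundary (free_mod R b) (Suc (Suc j)) (\<lambda>x. f' (f x))" if "cocycle N (Suc (Suc j)) f'" for f'
    using cocycle_comp[OF that ses_homs(2)[OF K(2)]] ext_zero_free_mod unfolding ext_zero_def by blast
  from presents_shift[OF T K(2) this] show ?case by blast
qed

text \<open>A single syzygy leads from an arbitrary type into the universe.\<close>

lemma ex_presents:
  fixes N :: "('a, 'n) module"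
  assumes R: "acc (regular_module R)" and J0: "acc (J 0)" and N: "acc N"
  shows "\<exists>(T :: ('a, 'a univ \<Rightarrow> 'a univ) module) \<Theta>. presents T \<Theta> N (Suc j)"
proof -
  obtain K b f where K: "acc K" "ses K (\<lambda>x. x) (free_mod R b) f N" by (rule acc_cover_ses[OF R N])
  show ?thesis
  proof (cases j)
    case 0
    then show ?thesis using presents_base[OF K(2) ext_zero_free_mod K(1) J0] by blast
  next
    case (Suc i)
    obtain T :: "('a, 'a univ \<Rightarrow> 'a univ) module" and \<Theta> where T: "presents T \<Theta> K (Suc i)"
      using ex_presents_univ[OF R J0 K(1)] by blast
    have "coboundary (free_mod R b) (Suc (Suc i)) (\<lambda>x. f' (f x))" if "cocycle N (Suc (Suc i)) f'" for f'
      using cocycle_comp[OF that ses_homs(2)[OF K(2)]] ext_zero_free_mod unfolding ext_zero_def by blast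
    from presents_shift[OF T K(2) this] show ?thesis unfolding Suc by blast
  qed
qed

text \<open>The hypothesis on \<open>E s\<close> makes all connecting homomorphisms surjective. By the ascending chain
  condition they are eventually injective, and then the cohomology of the \<open>E s\<close> is zero.\<close>

lemma ext_zero_eventually:
  fixes N :: "nat \<Rightarrow> ('a, 'n) module" and E :: "nat \<Rightarrow> ('a, 'e) module"
  assumes T: "presents T \<Theta> (N 0) (Suc j0)" and s: "\<And>s. ses (N s) (i s) (E s) (p s) (N (Suc s))"
    and inj: "\<And>s j f. j \<ge> j0 \<Longrightarrow> cocycle (E s) (Suc j) f \<Longrightarrow> coboundary (N s) (Suc j) (\<lambda>x. f (i s x))
      \<Longrightarrow> coboundary (E s) (Suc j) f"
  shows "\<exists>s0. \<forall>s\<ge>s0. ext_zero (E s) (Suc (j0 + s))"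
proof -
  \<comment> \<open>\<open>\<Psi> s\<close> presents the cohomology of \<open>N s\<close> after s
    connecting maps; the degree rises with s while \<open>T\<close> stays the same.\<close>
  define \<Psi> where "\<Psi> = rec_nat \<Theta> (\<lambda>s \<Phi> t f'. \<exists>f. \<Phi> t f \<and> connect (N s) (i s) (E s) (p s) (Suc (j0 + s)) f f'
    \<and> cocycle (N (Suc s)) (Suc (Suc (j0 + s))) f')"
  have \<Psi>0: "\<Psi> 0 = \<Theta>"
    and \<Psi>S: "\<Psi> (Suc s) = (\<lambda>t f'. \<exists>f. \<Psi> s t f \<and> connect (N s) (i s) (E s) (p s) (Suc (j0 + s)) f f'
      \<and> cocycle (N (Suc s)) (Suc (Suc (j0 + s))) f')" for s
    by (simp_all add: \<Psi>_def)
  have pr: "presents T (\<Psi> n) (N n) (Suc (j0 + n))" for n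
  proof (induction n)
    case 0
    show ?case using T by (simp add: \<Psi>0)
  next
    case (Suc n)
    \<comment> \<open>A class pulled back from \<open>N (Suc n)\<close> restricts to 0 on
      \<open>N n\<close>, so by \<open>inj\<close> it is 0 on \<open>E n\<close>; this is
      surjectivity of the connecting map.\<close>
    have "coboundary (E n) (Suc (Suc (j0 + n))) (\<lambda>x. f' (p n x))" if f': "cocycle (N (Suc n)) (Suc (Suc (j0 + n))) f'" for f'
    proof (rule inj)
      show "cocycle (E n) (Suc (Suc (j0 + n))) (\<lambda>x. f' (p n x))" by (rule cocycle_comp[OF f' ses_homs(2)[OF s]])
      show "coboundary (N n) (Suc (Suc (j0 + n))) (\<lambda>x. f' (p n (i n x)))"
        by (rule coboundary_cong[OF coboundary_zero])
          (simp add: ses_comp[OF s] mod_hom_zero[OF cocycle_hom[OF f'] ses_modules(3)[OF s]])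
    qed simp
    from presents_shift[OF Suc s this] show ?case by (simp add: \<Psi>S)
  qed
  define U where "U n = present_kernel (\<Psi> n) (N n) (Suc (j0 + n))" for n
  have "U n \<subseteq> U (Suc n)" for n
  proof
    fix t assume "t \<in> U n"
    then obtain f where f: "\<Psi> n t f" "coboundary (N n) (Suc (j0 + n)) f" by (auto simp: U_def present_kernel_def)
    obtain f' where "cocycle (N (Suc n)) (Suc (Suc (j0 + n))) f'" "connect (N n) (i n) (E n) (p n) (Suc (j0 + n)) f f'"
      using connect_exists[OF s presents_cocycle[OF pr, OF f(1)]] by blast
    then show "t \<in> U (Suc n)"
      using connect_coboundary_Suc[OF s _ f(2)] f(1) unfolding U_def present_kernel_def \<Psi>S by auto
  qed
  then have mono: "U m \<subseteq> U n" if "m \<le> n" for m n using that by (rule lift_Suc_mono_le)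
  have "submodule (U n) R T" for n unfolding U_def by (rule submodule_present_kernel[OF pr])
  then have "\<exists>V\<in>range U. \<forall>W\<in>range U. V \<subseteq> W \<longrightarrow> W = V"
    using acc_max[OF presents_acc[OF T], of "U 0" "range U" "\<lambda>U. U"] by blast
  then obtain s0 where "\<forall>W\<in>range U. U s0 \<subseteq> W \<longrightarrow> W = U s0" by blast
  then have stable: "U n = U s0" if "n \<ge> s0" for n using mono[OF that] by blast
  have "ext_zero (E n) (Suc (j0 + n))" if n: "n \<ge> s0" for n
    unfolding ext_zero_def
  proof (intro allI impI)
    fix c assume c: "cocycle (E n) (Suc (j0 + n)) c"
    note cN = cocycle_comp[OF c ses_homs(1)[OF s[of n]]]
    obtain t where t: "\<Psi> n t (\<lambda>x. c (i n x))" using presents_onto[OF pr, OF cN] by blast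
    \<comment> \<open>A restriction from \<open>E n\<close> has connecting image 0, so
      \<open>t\<close> lies in the kernel at n + 1, which equals the kernel at n. Hence the
      restriction of \<open>c\<close> is a coboundary, and by \<open>inj\<close> so is
      \<open>c\<close>.\<close>
    have "\<Psi> (Suc n) t (\<lambda>x. \<zero>\<^bsub>J (Suc (Suc (Suc (j0 + n))))\<^esub>)"
      unfolding \<Psi>S using t connect_restriction[OF c] cocycle_zero by blast
    moreover have "coboundary (N (Suc n)) (Suc (j0 + Suc n)) (\<lambda>x. \<zero>\<^bsub>J (Suc (Suc (Suc (j0 + n))))\<^esub>)"
      using coboundary_zero[of "N (Suc n)" "Suc (j0 + Suc n)"] by simp
    ultimately have "t \<in> U (Suc n)" unfolding U_def by (rule present_kernelI)
    then have "t \<in> U n" using stable[of n] stable[of "Suc n"] n by simp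
    then have "coboundary (N n) (Suc (j0 + n)) (\<lambda>x. c (i n x))"
      using presents_kernel_coboundary[OF pr _ t] by (simp add: U_def)
    then show "coboundary (E n) (Suc (j0 + n)) c" using inj[OF _ c] by simp
  qed
  then show ?thesis by blast
qed

text \<open>Nakayama's lemma for the presented cohomology: a maximal proper submodule above the kernel
  would contain \<open>x T\<close>.\<close>

lemma ext_zero_nakayama:
  assumes p: "presents T \<Theta> N j" and x: "x \<in> carrier R" "\<And>r. r \<in> carrier R \<Longrightarrow> \<one> \<ominus> r \<otimes> x \<in> Units R"
    and div: "\<And>f. cocycle N j f \<Longrightarrow> \<exists>h. cocycle N j h \<and> (\<forall>z\<in>carrier N. f z = x \<odot>\<^bsub>J (Suc j)\<^esub> h z)"
  shows "ext_zero N j"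
proof -
  define U where "U = present_kernel \<Theta> N j"
  note aT = presents_acc[OF p] and mT = acc_module[OF presents_acc[OF p]]
  have U: "submodule U R T" unfolding U_def by (rule submodule_present_kernel[OF p])
  \<comment> \<open>Seen from \<open>T\<close>, divisibility of cocycles by \<open>x\<close> says T
    = U + x T.\<close>
  have dec: "\<exists>t'\<in>carrier T. t \<ominus>\<^bsub>T\<^esub> x \<odot>\<^bsub>T\<^esub> t' \<in> U" if t: "t \<in> carrier T" for t
  proof -
    obtain f where f: "\<Theta> t f" using presents_total[OF p, OF t] by blast
    obtain h where h: "cocycle N j h" "\<forall>z\<in>carrier N. f z = x \<odot>\<^bsub>J (Suc j)\<^esub> h z"
      using div[OF presents_cocycle[OF p, OF f]] by blast
    obtain t' where t': "\<Theta> t' h" using presents_onto[OF p, OF h(1)] by blast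
    have tc: "t' \<in> carrier T" by (rule presents_carrier[OF p, OF t'])
    have "\<Theta> (t \<oplus>\<^bsub>T\<^esub> (\<ominus> \<one>) \<odot>\<^bsub>T\<^esub> (x \<odot>\<^bsub>T\<^esub> t')) (\<lambda>z. f z \<oplus>\<^bsub>J (Suc j)\<^esub> (\<ominus> \<one>) \<odot>\<^bsub>J (Suc j)\<^esub> (x \<odot>\<^bsub>J (Suc j)\<^esub> h z))"
      using presents_plus[OF p, OF f presents_scale[OF p, OF a_inv_closed[OF one_closed] presents_scale[OF p, OF x(1) t']]] .
    moreover have "coboundary N j (\<lambda>z. f z \<oplus>\<^bsub>J (Suc j)\<^esub> (\<ominus> \<one>) \<odot>\<^bsub>J (Suc j)\<^esub> (x \<odot>\<^bsub>J (Suc j)\<^esub> h z))"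
    proof (rule coboundary_cong[OF coboundary_zero])
      fix z assume z: "z \<in> carrier N"
      then have "x \<odot>\<^bsub>J (Suc j)\<^esub> h z \<in> carrier (J (Suc j))"
        using mod_hom_closed[OF cocycle_hom[OF h(1)]] x(1) by simp
      then show "f z \<oplus>\<^bsub>J (Suc j)\<^esub> (\<ominus> \<one>) \<odot>\<^bsub>J (Suc j)\<^esub> (x \<odot>\<^bsub>J (Suc j)\<^esub> h z) = \<zero>\<^bsub>J (Suc j)\<^esub>"
        using h(2) z by (simp add: module_neg_eq_smult[symmetric])
    qed
    ultimately have "t \<oplus>\<^bsub>T\<^esub> (\<ominus> \<one>) \<odot>\<^bsub>T\<^esub> (x \<odot>\<^bsub>T\<^esub> t') \<in> U"
      unfolding U_def by (rule present_kernelI)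
    then have "t \<ominus>\<^bsub>T\<^esub> x \<odot>\<^bsub>T\<^esub> t' \<in> U"
      using t tc x(1) mT by (simp add: module_minus_eq_smult)
    then show ?thesis using tc by blast
  qed
  have "U = carrier T"
  proof (rule ccontr)
    assume ne: "U \<noteq> carrier T"
    define \<V> where "\<V> = {V. submodule V R T \<and> U \<subseteq> V \<and> V \<noteq> carrier T}"
    have "U \<in> \<V>" using U ne by (simp add: \<V>_def)
    moreover have "submodule V R T" if "V \<in> \<V>" for V using that by (simp add: \<V>_def)
    ultimately have "\<exists>V\<in>\<V>. \<forall>W\<in>\<V>. V \<subseteq> W \<longrightarrow> W = V" using acc_max[OF aT, of U \<V> "\<lambda>U. U"] by blast
    then obtain V where V: "V \<in> \<V>" "\<forall>W\<in>\<V>. V \<subseteq> W \<longrightarrow> W = V" by blast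
    then have Vs: "submodule V R T" "U \<subseteq> V" "V \<noteq> carrier T" by (auto simp: \<V>_def)
    have xt: "x \<odot>\<^bsub>T\<^esub> t \<in> V" if t: "t \<in> carrier T" for t
    proof (rule ccontr)
      assume xt: "x \<odot>\<^bsub>T\<^esub> t \<notin> V"
      define W where "W = {v \<oplus>\<^bsub>T\<^esub> r \<odot>\<^bsub>T\<^esub> (x \<odot>\<^bsub>T\<^esub> t) | v r. v \<in> V \<and> r \<in> carrier R}"
      have VT: "v \<in> carrier T" if "v \<in> V" for v using submodule_subset[OF Vs(1) mT] that by blast
      have WI: "w \<in> W" if "v \<in> V" "r \<in> carrier R" "w = v \<oplus>\<^bsub>T\<^esub> r \<odot>\<^bsub>T\<^esub> (x \<odot>\<^bsub>T\<^esub> t)" for v r w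
        using that unfolding W_def by blast
      have W: "submodule W R T"
      proof (rule submodule_intro[OF mT])
        show "W \<subseteq> carrier T" using VT t x(1) mT by (auto simp: W_def)
        show "\<zero>\<^bsub>T\<^esub> \<in> W"
          by (rule WI[OF submodule_zero[OF Vs(1) mT] zero_closed]) (use t x(1) mT in simp)
        fix a b r assume "a \<in> W"
        then obtain v c where a: "v \<in> V" "c \<in> carrier R" "a = v \<oplus>\<^bsub>T\<^esub> c \<odot>\<^bsub>T\<^esub> (x \<odot>\<^bsub>T\<^esub> t)" unfolding W_def by blast
        show "r \<odot>\<^bsub>T\<^esub> a \<in> W" if r: "r \<in> carrier R"
          by (rule WI[OF submodule_smult[OF Vs(1) mT r a(1)], of "r \<otimes> c"])
            (use a r t x(1) mT VT[OF a(1)] in \<open>simp_all add: module_smult_add module_mult_smult\<close>)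
        assume "b \<in> W"
        then obtain w d where b: "w \<in> V" "d \<in> carrier R" "b = w \<oplus>\<^bsub>T\<^esub> d \<odot>\<^bsub>T\<^esub> (x \<odot>\<^bsub>T\<^esub> t)" unfolding W_def by blast
        show "a \<oplus>\<^bsub>T\<^esub> b \<in> W"
          by (rule WI[OF submodule_add[OF Vs(1) mT a(1) b(1)], of "c \<oplus> d"])
            (use a b t x(1) mT VT[OF a(1)] VT[OF b(1)] in \<open>simp_all add: module_add_smult module_ac[OF mT]\<close>)
      qed
      have VW: "V \<subseteq> W"
      proof
        fix v assume v: "v \<in> V"
        show "v \<in> W" by (rule WI[OF v zero_closed]) (use VT[OF v] t x(1) mT in simp)
      qed
      have "x \<odot>\<^bsub>T\<^esub> t \<in> W"
        by (rule WI[OF submodule_zero[OF Vs(1) mT] one_closed]) (use t x(1) mT in simp)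
      then have "W \<noteq> V" using xt by blast
      then have "W \<notin> \<V>" using V(2) VW by blast
      then have "W = carrier T" using W VW Vs(2) by (auto simp: \<V>_def)
      then have "t \<in> W" using t by simp
      then obtain v r where v: "v \<in> V" "r \<in> carrier R" "t = v \<oplus>\<^bsub>T\<^esub> r \<odot>\<^bsub>T\<^esub> (x \<odot>\<^bsub>T\<^esub> t)" unfolding W_def by blast
      \<comment> \<open>From t = v + r x t follows (1 - r x) t = v, and cancelling the unit 1 - r x
        puts t, hence x t, into \<open>V\<close>.\<close>
      let ?u = "\<one> \<ominus> r \<otimes> x"
      have u: "?u \<in> Units R" "?u \<in> carrier R" using x v(2) by auto
      have "?u \<odot>\<^bsub>T\<^esub> t \<oplus>\<^bsub>T\<^esub> (r \<otimes> x) \<odot>\<^bsub>T\<^esub> t = (?u \<oplus> r \<otimes> x) \<odot>\<^bsub>T\<^esub> t"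
        using u v(2) x(1) t mT by (simp add: module_add_smult)
      also have "?u \<oplus> r \<otimes> x = \<one>" using v(2) x(1) by (simp add: a_minus_def a_assoc l_neg)
      also have "\<one> \<odot>\<^bsub>T\<^esub> t = v \<oplus>\<^bsub>T\<^esub> (r \<otimes> x) \<odot>\<^bsub>T\<^esub> t"
        using v t x(1) mT by (simp add: module_mult_smult)
      finally have "(?u \<odot>\<^bsub>T\<^esub> t \<oplus>\<^bsub>T\<^esub> (r \<otimes> x) \<odot>\<^bsub>T\<^esub> t) \<ominus>\<^bsub>T\<^esub> (r \<otimes> x) \<odot>\<^bsub>T\<^esub> t
          = (v \<oplus>\<^bsub>T\<^esub> (r \<otimes> x) \<odot>\<^bsub>T\<^esub> t) \<ominus>\<^bsub>T\<^esub> (r \<otimes> x) \<odot>\<^bsub>T\<^esub> t" by simp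
      then have "?u \<odot>\<^bsub>T\<^esub> t = v"
        using u(2) v(2) VT[OF v(1)] x(1) t mT by (simp add: module_minus_cancel)
      then have "inv ?u \<odot>\<^bsub>T\<^esub> (?u \<odot>\<^bsub>T\<^esub> t) \<in> V"
        using submodule_smult[OF Vs(1) mT, of "inv ?u" v] v(1) u by simp
      moreover have "inv ?u \<odot>\<^bsub>T\<^esub> (?u \<odot>\<^bsub>T\<^esub> t) = t"
        using u t mT by (simp add: module_mult_smult[symmetric])
      ultimately show False using submodule_smult[OF Vs(1) mT x(1)] xt by simp
    qed
    have "t \<in> V" if t: "t \<in> carrier T" for t
    proof -
      obtain t' where t': "t' \<in> carrier T" "t \<ominus>\<^bsub>T\<^esub> x \<odot>\<^bsub>T\<^esub> t' \<in> U" using dec[OF t] by blast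
      then have "(t \<ominus>\<^bsub>T\<^esub> x \<odot>\<^bsub>T\<^esub> t') \<oplus>\<^bsub>T\<^esub> x \<odot>\<^bsub>T\<^esub> t' \<in> V"
        using submodule_add[OF Vs(1) mT _ xt[OF t'(1)]] Vs(2) by blast
      then show ?thesis using t t' x(1) mT by simp
    qed
    then show False using Vs(3) submodule_subset[OF Vs(1) mT] by blast
  qed
  then show ?thesis
    unfolding ext_zero_def using presents_onto[OF p] presents_carrier[OF p] presents_kernel_coboundary[OF p]
    by (metis U_def)
qed

end

section \<open>Local rings\<close>

context cring
begin

lemma submodule_if_ideal:
  assumes "ideal I R"
  shows "submodule I R (regular_module R)"
proof -
  interpret ideal I R by fact
  show ?thesis
    by (rule submodule_intro[OF module_regular]) (use Icarr I_l_closed in auto)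
qed

end

locale noetherian_local = cring R for R (structure) +
  assumes local_noetherian: "noetherian_local_ring R"
begin

lemma acc_R: "acc (regular_module R)"
  using local_noetherian acc_regular by (simp add: noetherian_local_ring_def)

lemma maximalideal_max_ideal: "maximalideal (max_ideal R) R"
  using local_noetherian theI'[of "\<lambda>\<mm>. maximalideal \<mm> R"]
  by (simp add: noetherian_local_ring_def max_ideal_def)

lemma max_ideal_eq: "maximalideal I R \<Longrightarrow> I = max_ideal R"
  using local_noetherian maximalideal_max_ideal unfolding noetherian_local_ring_def by blast

lemma submodule_max_ideal: "submodule (max_ideal R) R (regular_module R)"
  using submodule_if_ideal maximalideal.axioms(1)[OF maximalideal_max_ideal] by blast

lemma max_ideal_proper: "max_ideal R \<noteq> carrier R"
  using maximalideal.I_notcarr[OF maximalideal_max_ideal] by simp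

lemma one_notin_max_ideal: "\<one> \<notin> max_ideal R"
proof
  assume 1: "\<one> \<in> max_ideal R"
  have "r \<in> max_ideal R" if "r \<in> carrier R" for r
    using submodule_smult[OF submodule_max_ideal module_regular that 1] that by simp
  then show False using max_ideal_proper submodule_subset[OF submodule_max_ideal module_regular] by auto
qed

text \<open>The maximal condition gives a maximal ideal above \<open>V\<close>, and by locality
  there is only one.\<close>

lemma proper_submodule_subset:
  assumes V: "submodule V R (regular_module R)" "V \<noteq> carrier R"
  shows "V \<subseteq> max_ideal R"
proof -
  define \<W> where "\<W> = {W. submodule W R (regular_module R) \<and> V \<subseteq> W \<and> W \<noteq> carrier R}"
  have "V \<in> \<W>" using V by (simp add: \<W>_def)
  moreover have "submodule W R (regular_module R)" if "W \<in> \<W>" for W using that by (simp add: \<W>_def)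
  ultimately have "\<exists>W\<in>\<W>. \<forall>U\<in>\<W>. W \<subseteq> U \<longrightarrow> U = W" using acc_max[OF acc_R, of V \<W> "\<lambda>U. U"] by blast
  then obtain W where W: "W \<in> \<W>" "\<forall>U\<in>\<W>. W \<subseteq> U \<longrightarrow> U = W" by blast
  have "maximalideal W R"
  proof (rule maximalidealI)
    show "ideal W R" using W(1) ideal_if_submodule by (simp add: \<W>_def)
    show "carrier R \<noteq> W" using W(1) by (auto simp: \<W>_def)
    show "I = W \<or> I = carrier R" if "ideal I R" "W \<subseteq> I" "I \<subseteq> carrier R" for I
      using W that submodule_if_ideal[OF that(1)] by (auto simp: \<W>_def)
  qed
  then show ?thesis using max_ideal_eq W(1) by (auto simp: \<W>_def)
qed

lemma nonunit_in_max_ideal: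
  assumes "r \<in> carrier R - Units R"
  shows "r \<in> max_ideal R"
proof -
  define V where "V = (\<lambda>s. s \<otimes> r) ` carrier R"
  have "(\<lambda>s. s \<otimes> r) \<in> mod_hom R (regular_module R) (regular_module R)"
    by (rule mod_homI) (use assms in \<open>auto simp: l_distr m_assoc\<close>)
  from submodule_image[OF this module_regular module_regular]
  have V: "submodule V R (regular_module R)" by (simp add: V_def)
  have "\<one> \<notin> V"
  proof
    assume "\<one> \<in> V"
    then obtain s where "s \<in> carrier R" "s \<otimes> r = \<one>" by (auto simp: V_def)
    then have "r \<in> Units R" using assms m_comm unfolding Units_def by auto
    then show False using assms by simp
  qed
  then have "V \<subseteq> max_ideal R" using proper_submodule_subset[OF V] by auto
  moreover have "r \<in> V" unfolding V_def using assms by (intro image_eqI[of _ _ \<one>]) auto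
  ultimately show ?thesis by blast
qed

lemma one_minus_unit:
  assumes x: "x \<in> max_ideal R" and r: "r \<in> carrier R"
  shows "\<one> \<ominus> r \<otimes> x \<in> Units R"
proof (rule ccontr)
  assume nu: "\<one> \<ominus> r \<otimes> x \<notin> Units R"
  have xR: "x \<in> carrier R" using submodule_subset[OF submodule_max_ideal module_regular] x by auto
  have "\<one> \<ominus> r \<otimes> x \<in> max_ideal R" using nonunit_in_max_ideal nu r xR by simp
  moreover have "r \<otimes> x \<in> max_ideal R"
    using submodule_smult[OF submodule_max_ideal module_regular r x] by simp
  ultimately have "(\<one> \<ominus> r \<otimes> x) \<oplus> r \<otimes> x \<in> max_ideal R"
    using submodule_add[OF submodule_max_ideal module_regular] by simp
  then show False using one_notin_max_ideal r xR by (simp add: a_minus_def a_assoc l_neg)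
qed

text \<open>\<open>factor_module\<close> consists of cosets with raw set operations. Once the coset
  map is seen to respect them, the module axioms descend from R by
  \<open>module_surj_image\<close>.\<close>

lemma residue_field:
  "module R (residue_field_module R)"
  "\<exists>q. ses (regular_module R\<lparr>carrier := max_ideal R\<rparr>) (\<lambda>x. x) (regular_module R) q (residue_field_module R)"
  "\<And>r z. r \<in> max_ideal R \<Longrightarrow> z \<in> carrier (residue_field_module R) \<Longrightarrow>
    r \<odot>\<^bsub>residue_field_module R\<^esub> z = \<zero>\<^bsub>residue_field_module R\<^esub>"
proof -
  let ?m = "max_ideal R" and ?k = "residue_field_module R"
  have idl: "ideal ?m R" by (rule maximalideal.axioms(1)[OF maximalideal_max_ideal])
  interpret m: abelian_subgroup ?m R
    by (rule abelian_subgroupI3[OF ideal.axioms(1)[OF idl] abelian_group_axioms])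
  have mR: "?m \<subseteq> carrier R" using submodule_subset[OF submodule_max_ideal module_regular] by simp
  have cos: "?m +>\<^bsub>regular_module R\<^esub> r = ?m +> r" for r by (simp add: a_r_coset_def')
  have eq: "?m +> r = ?m +> s" if "r \<in> carrier R" "s \<in> carrier R" "r \<ominus> s \<in> ?m" for r s
    using a_repr_independence[OF m.a_rcos_module_rev[of s r] that(2) m.a_subgroup] that by (simp add: a_minus_def)
  have k: "carrier ?k = (\<lambda>r. ?m +> r) ` carrier R" "\<zero>\<^bsub>?k\<^esub> = ?m"
    "A \<oplus>\<^bsub>?k\<^esub> B = A <+> B" "r \<odot>\<^bsub>?k\<^esub> A = (\<Union>x\<in>A. ?m +> (r \<otimes> x))" for A B r
    by (auto simp: residue_field_module_def factor_module_def A_RCOSETS_def' cos set_add_def')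
  let ?q = "\<lambda>r. ?m +> r"
  \<comment> \<open>The scalar action is a union over a coset. It collapses to a single coset,
    because r times an element of the maximal ideal is again in that ideal.\<close>
  have sm: "?q (r \<otimes> x) = r \<odot>\<^bsub>?k\<^esub> ?q x" if r: "r \<in> carrier R" and x: "x \<in> carrier R" for r x
  proof -
    have "?m +> (r \<otimes> y) = ?m +> (r \<otimes> x)" if y: "y \<in> ?m +> x" for y
    proof -
      obtain h where h: "h \<in> ?m" "y = h \<oplus> x" using y by (auto simp: a_r_coset_def')
      then have hR: "h \<in> carrier R" using mR by blast
      have "r \<otimes> y \<ominus> r \<otimes> x = r \<otimes> h" using h r x hR by (simp add: r_distr a_minus_def a_assoc r_neg)
      moreover have "r \<otimes> h \<in> ?m" using submodule_smult[OF submodule_max_ideal module_regular r h(1)] by simp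
      ultimately show ?thesis using eq[of "r \<otimes> y" "r \<otimes> x"] h r x hR by simp
    qed
    moreover have "x \<in> ?m +> x" using m.a_rcos_self x by simp
    ultimately show ?thesis unfolding k(4) by blast
  qed
  have ad: "?q (x \<oplus> y) = ?q x \<oplus>\<^bsub>?k\<^esub> ?q y" if "x \<in> carrier R" "y \<in> carrier R" for x y
    unfolding k(3) using m.a_rcos_sum that by simp
  have z: "?q x = \<zero>\<^bsub>?k\<^esub> \<longleftrightarrow> x \<in> ?m" if "x \<in> carrier R" for x
    unfolding k(2) using m.a_rcos_const m.a_rcos_self[OF that] by auto
  show mk: "module R ?k"
    by (rule module_surj_image[OF module_regular, where p = ?q]) (use ad sm z[of \<zero>] m.zero_closed k(1) in auto)
  have q: "?q \<in> mod_hom R (regular_module R) ?k"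
    by (rule mod_homI) (use ad sm k(1) in auto)
  have "ses (regular_module R\<lparr>carrier := ?m\<rparr>) (\<lambda>x. x) (regular_module R) ?q ?k"
    by (rule sesI[OF submodule_module[OF submodule_max_ideal module_regular] module_regular mk _ q])
      (use mR z k(1) in \<open>auto intro!: mod_homI\<close>)
  then show "\<exists>q. ses (regular_module R\<lparr>carrier := ?m\<rparr>) (\<lambda>x. x) (regular_module R) q ?k" by blast
  show "r \<odot>\<^bsub>?k\<^esub> A = \<zero>\<^bsub>?k\<^esub>" if r: "r \<in> ?m" and A: "A \<in> carrier ?k" for r A
  proof -
    obtain x where x: "x \<in> carrier R" "A = ?q x" using A k(1) by auto
    have "r \<otimes> x \<in> ?m"
      using submodule_smult[OF submodule_max_ideal module_regular x(1) r] r mR x(1) m_comm by auto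
    then show ?thesis using sm[of r x] z[of "r \<otimes> x"] x r mR by auto
  qed
qed

end

section \<open>Vanishing of Ext for cyclic modules and the Gorenstein property\<close>

context coresolution
begin

text \<open>The identity of \<open>B\<close> induces mutually inverse maps between two cokernels of
  \<open>i\<close>. This links quotients built on representatives with
  \<open>residue_field_module\<close>, which is built on cosets.\<close>

lemma ext_zero_cokernel_unique:
  assumes s: "ses A i B p C" and s': "ses A i B p' C'" and e: "ext_zero C' j"
  shows "ext_zero C j"
proof -
  obtain u where u: "u \<in> mod_hom R C C'" "\<forall>b\<in>carrier B. u (p b) = p' b"
    using ses_descend[OF s ses_homs(2)[OF s'] ses_modules(3)[OF s'] ses_comp[OF s']] by blast
  obtain v where v: "v \<in> mod_hom R C' C" "\<forall>b\<in>carrier B. v (p' b) = p b"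
    using ses_descend[OF s' ses_homs(2)[OF s] ses_modules(3)[OF s] ses_comp[OF s]] by blast
  have "v (u x) = x" if x: "x \<in> carrier C" for x
  proof -
    obtain b where "b \<in> carrier B" "p b = x" using ses_surj[OF s x] by blast
    then show ?thesis using u(2) v(2) by force
  qed
  then show ?thesis by (rule ext_zero_retract[OF e u(1) v(1)])
qed

text \<open>Noetherian induction. For a maximal counterexample \<aa> with Q = R/\<aa>, take x in the
  maximal ideal outside \<aa>. If x is a zero divisor on \<open>Q\<close>, then \<open>x Q\<close>
  and \<open>Q / x Q\<close> are cyclic with strictly larger annihilators and \<open>Q\<close> is an
  extension of them. Otherwise multiplication by x is injective on \<open>Q\<close> and Nakayama's
  lemma applies.\<close>

lemma ext_zero_cyclic:
  fixes Q :: "('a, 'a) module"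
  assumes "noetherian_local R" and J0: "acc (J 0)"
    and k: "\<And>j. j \<ge> n \<Longrightarrow> ext_zero (residue_field_module R) (Suc j)"
    and a: "submodule \<aa> R (regular_module R)" and cyc: "ses (regular_module R\<lparr>carrier := \<aa>\<rparr>) (\<lambda>x. x) (regular_module R) p Q"
    and j: "j \<ge> n"
  shows "ext_zero Q (Suc j)"
proof -
  interpret noetherian_local R by fact
  let ?R = "regular_module R"
  let ?cyc = "\<lambda>\<aa> p (Q :: ('a, 'a) module). ses (?R\<lparr>carrier := \<aa>\<rparr>) (\<lambda>x. x) ?R p Q"
  \<comment> \<open>An ideal is bad if vanishing fails in some degree beyond the bound; so good
    ideals vanish in all these degrees at once, and the Nakayama case uses the next degree
    up.\<close>
  define \<A> where "\<A> = {\<aa>. submodule \<aa> R ?R \<and> (\<exists>p Q. ?cyc \<aa> p Q \<and> (\<exists>j\<ge>n. \<not> ext_zero Q (Suc j)))}"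
  have good: "ext_zero Q (Suc j)" if "\<aa> \<notin> \<A>" "submodule \<aa> R ?R" "?cyc \<aa> p Q" "j \<ge> n" for \<aa> p Q j
    using that unfolding \<A>_def by blast
  have "\<A> = {}"
  proof (rule ccontr)
    assume "\<A> \<noteq> {}"
    then obtain a0 where "a0 \<in> \<A>" by blast
    moreover have "submodule \<aa> R ?R" if "\<aa> \<in> \<A>" for \<aa> using that by (simp add: \<A>_def)
    ultimately have "\<exists>\<aa>\<in>\<A>. \<forall>\<bb>\<in>\<A>. \<aa> \<subseteq> \<bb> \<longrightarrow> \<bb> = \<aa>" using acc_max[OF acc_R, of a0 \<A> "\<lambda>U. U"] by blast
    then obtain \<aa> where a: "\<aa> \<in> \<A>" and max: "\<forall>\<bb>\<in>\<A>. \<aa> \<subseteq> \<bb> \<longrightarrow> \<bb> = \<aa>" by blast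
    then obtain p Q j where asub: "submodule \<aa> R ?R" and s: "?cyc \<aa> p Q" and j: "j \<ge> n" and bad: "\<not> ext_zero Q (Suc j)"
      unfolding \<A>_def by blast
    note mQ = ses_modules(3)[OF s] and ph = ses_homs(2)[OF s]
    have aR: "\<aa> \<subseteq> carrier R" using submodule_subset[OF asub module_regular] by simp
    have pz: "p r = \<zero>\<^bsub>Q\<^esub> \<longleftrightarrow> r \<in> \<aa>" if "r \<in> carrier R" for r
      using ses_exact[OF s, of r] ses_comp[OF s, of r] that by auto
    have psurj: "\<exists>r\<in>carrier R. p r = z" if "z \<in> carrier Q" for z using ses_surj[OF s that] by simp
    have pc: "p r \<in> carrier Q" if "r \<in> carrier R" for r using mod_hom_closed[OF ph] that by simp
    have psm: "p (r \<otimes> s) = r \<odot>\<^bsub>Q\<^esub> p s" if "r \<in> carrier R" "s \<in> carrier R" for r s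
      using mod_hom_smult[OF ph, of r s] that by simp
    have pad: "p (r \<oplus> s) = p r \<oplus>\<^bsub>Q\<^esub> p s" if "r \<in> carrier R" "s \<in> carrier R" for r s
      using mod_hom_add[OF ph, of r s] that by simp
    have "\<aa> \<noteq> carrier R"
    proof
      assume "\<aa> = carrier R"
      then have "carrier Q = {\<zero>\<^bsub>Q\<^esub>}" using psurj pz module_zero_closed[OF mQ] by blast
      then show False using ext_zero_zero_module[OF mQ] bad by blast
    qed
    moreover have "\<aa> \<noteq> max_ideal R"
    proof
      assume "\<aa> = max_ideal R"
      then obtain q where "ses (?R\<lparr>carrier := \<aa>\<rparr>) (\<lambda>x. x) ?R q (residue_field_module R)" using residue_field(2) by blast
      from ext_zero_cokernel_unique[OF s this k[OF j]] show False using bad by simp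
    qed
    ultimately have "\<not> max_ideal R \<subseteq> \<aa>"
      using maximalideal.I_maximal[OF maximalideal_max_ideal ideal_if_submodule[OF asub]] aR by blast
    then obtain x where x: "x \<in> max_ideal R" "x \<notin> \<aa>" by blast
    then have xR: "x \<in> carrier R" using submodule_subset[OF submodule_max_ideal module_regular] by auto
    define \<mu> where "\<mu> z = x \<odot>\<^bsub>Q\<^esub> z" for z
    have \<mu>: "\<mu> \<in> mod_hom R Q Q" unfolding \<mu>_def by (rule mod_hom_scale[OF mod_hom_id xR mQ])
    have pm: "\<mu> (p r) = p (x \<otimes> r)" if "r \<in> carrier R" for r using psm[OF xR that] by (simp add: \<mu>_def)
    define D where "D = \<mu> ` carrier Q"
    have D: "submodule D R Q" unfolding D_def by (rule submodule_image[OF \<mu> mQ mQ])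
    obtain q and Q' :: "('a, 'a) module" where s': "ses (Q\<lparr>carrier := D\<rparr>) (\<lambda>x. x) Q q Q'"
      using ses_submodule[OF mQ D] by blast
    note mQ' = ses_modules(3)[OF s'] and qh = ses_homs(2)[OF s']
    have qz: "q z = \<zero>\<^bsub>Q'\<^esub> \<longleftrightarrow> z \<in> D" if "z \<in> carrier Q" for z
      using ses_exact[OF s', of z] ses_comp[OF s', of z] that by auto
    \<comment> \<open>The ideal generated by \<aa> and x, obtained as the preimage of
      \<open>x Q\<close>; it presents \<open>Q / x Q\<close>.\<close>
    define \<cc> where "\<cc> = {r \<in> carrier R. p r \<in> D}"
    have csub: "submodule \<cc> R ?R" using submodule_vimage[OF ph module_regular mQ D] by (simp add: \<cc>_def)
    have "p x \<in> D"
    proof -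
      have "p x = \<mu> (p \<one>)" using psm[OF xR one_closed] xR by (simp add: \<mu>_def)
      then show ?thesis using pc[OF one_closed] by (simp add: D_def)
    qed
    then have xc: "x \<in> \<cc>" using xR by (simp add: \<cc>_def)
    have "p r \<in> D" if "r \<in> \<aa>" for r
    proof -
      have "p r = \<zero>\<^bsub>Q\<^esub>" using pz that aR by blast
      then show ?thesis using submodule_zero[OF D mQ] by simp
    qed
    then have ac: "\<aa> \<subseteq> \<cc>" using aR by (auto simp: \<cc>_def)
    have "?cyc \<cc> (\<lambda>r. q (p r)) Q'"
    proof (rule sesI[OF submodule_module[OF csub module_regular] module_regular mQ' _ mod_hom_comp[OF ph qh]])
      show "\<exists>r\<in>carrier ?R. q (p r) = c" if "c \<in> carrier Q'" for c
        using ses_surj[OF s' that] psurj by force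
    qed (use qz pc in \<open>auto simp: \<cc>_def intro!: mod_homI\<close>)
    moreover have "\<cc> \<notin> \<A>" using max ac x(2) xc by blast
    ultimately have Q': "ext_zero Q' (Suc i)" if "i \<ge> n" for i using good[of \<cc> _ Q'] csub that by blast
    \<comment> \<open>The colon ideal (\<aa> : x), which is the annihilator of \<open>x Q\<close>.
      It equals \<aa> exactly when x is a nonzerodivisor on \<open>Q\<close>.\<close>
    define \<bb> where "\<bb> = {r \<in> carrier R. x \<otimes> r \<in> \<aa>}"
    have "(\<lambda>r. x \<otimes> r) \<in> mod_hom R ?R ?R"
      by (rule mod_homI) (use xR in \<open>auto simp: r_distr m_lcomm\<close>)
    from submodule_vimage[OF this module_regular module_regular asub]
    have bsub: "submodule \<bb> R ?R" by (simp add: \<bb>_def)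
    have ab: "\<aa> \<subseteq> \<bb>" using aR submodule_smult[OF asub module_regular xR] by (auto simp: \<bb>_def)
    show False
    proof (cases "\<bb> = \<aa>")
      case False
      have mD: "module R (Q\<lparr>carrier := D\<rparr>)" by (rule submodule_module[OF D mQ])
      have "?cyc \<bb> (\<lambda>r. \<mu> (p r)) (Q\<lparr>carrier := D\<rparr>)"
      proof (rule sesI[OF submodule_module[OF bsub module_regular] module_regular mD])
        show "(\<lambda>r. \<mu> (p r)) \<in> mod_hom R ?R (Q\<lparr>carrier := D\<rparr>)"
          by (rule mod_hom_carrier_update[OF mod_hom_comp[OF ph \<mu>]]) (use pc in \<open>auto simp: D_def\<close>)
        show "\<exists>r\<in>carrier ?R. \<mu> (p r) = c" if "c \<in> carrier (Q\<lparr>carrier := D\<rparr>)" for c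
          using that psurj by (force simp: D_def)
      qed (use pz pm xR in \<open>auto simp: \<bb>_def intro!: mod_homI\<close>)
      moreover have "\<bb> \<notin> \<A>" using max ab False by blast
      ultimately have "ext_zero (Q\<lparr>carrier := D\<rparr>) (Suc j)" using good[OF _ bsub] j by blast
      then show False using ext_zero_extension[OF s' _ Q'[OF j]] bad by blast
    next
      case True
      have sm: "ses Q \<mu> Q q Q'"
      proof (rule sesI[OF mQ mQ mQ' \<mu> qh])
        show "z = \<zero>\<^bsub>Q\<^esub>" if z: "z \<in> carrier Q" "\<mu> z = \<zero>\<^bsub>Q\<^esub>" for z
        proof -
          obtain r where r: "r \<in> carrier R" "p r = z" using psurj[OF z(1)] by blast
          then have "p (x \<otimes> r) = \<zero>\<^bsub>Q\<^esub>" using z(2) psm[OF xR r(1)] by (simp add: \<mu>_def)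
          then have "r \<in> \<bb>" using pz r xR by (simp add: \<bb>_def)
          then have "p r = \<zero>\<^bsub>Q\<^esub>" using True pz[OF r(1)] by simp
          then show ?thesis using r(2) by simp
        qed
        show "\<exists>a\<in>carrier Q. \<mu> a = b" if "b \<in> carrier Q" "q b = \<zero>\<^bsub>Q'\<^esub>" for b
          using qz[OF that(1)] that(2) by (auto simp: D_def)
        show "q (\<mu> a) = \<zero>\<^bsub>Q'\<^esub>" if "a \<in> carrier Q" for a
          using qz mod_hom_closed[OF \<mu> that] that by (simp add: D_def)
      qed (rule ses_surj[OF s'])
      have "p ` carrier ?R = carrier Q" using psurj pc by force
      then have "acc Q" by (rule acc_surj[OF acc_R mQ ph])
      then obtain T :: "('a, 'a univ \<Rightarrow> 'a univ) module" and \<Theta> where T: "presents T \<Theta> Q (Suc j)"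
        using ex_presents[OF acc_R J0] by blast
      have "ext_zero Q (Suc j)"
      proof (rule ext_zero_nakayama[OF T xR one_minus_unit[OF x(1)]])
        fix f assume f: "cocycle Q (Suc j) f"
        \<comment> \<open>Vanishing for \<open>Q'\<close> one degree higher lets \<open>f\<close>
          extend along multiplication by x to a cocycle \<open>h\<close>, and then f = x h by
          linearity.\<close>
        have "ext_zero Q' (Suc (Suc j))" using Q' j by simp
        from cocycle_extend[OF sm this f]
        obtain h where h: "cocycle Q (Suc j) h" "\<forall>z\<in>carrier Q. h (\<mu> z) = f z" by blast
        show "\<exists>h. cocycle Q (Suc j) h \<and> (\<forall>z\<in>carrier Q. f z = x \<odot>\<^bsub>J (Suc (Suc j))\<^esub> h z)"
          using mod_hom_smult[OF cocycle_hom[OF h(1)] xR] h unfolding \<mu>_def by (intro exI[of _ h]) auto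
      qed
      then show False using bad by blast
    qed
  qed
  then show ?thesis using good[OF _ a cyc j] by blast
qed

text \<open>The n-th cosyzygy \<open>K\<close> satisfies Baer's criterion, since the obstruction to
  extending a map from an ideal lies in Ext^(n+1) of the cyclic quotient; the coresolution can then
  be cut off at \<open>K\<close>. The isomorphism \<theta> appears because \<open>J 0\<close> is a
  copy of R in the universe.\<close>

lemma finite_inj_dim_regular:
  assumes \<theta>: "\<theta> \<in> mod_hom R (regular_module R) (J 0)" "inj_on \<theta> (carrier R)" "\<theta> ` carrier R = carrier (J 0)"
    and van: "\<And>\<aa> p (Q :: ('a, 'a) module). submodule \<aa> R (regular_module R) \<Longrightarrow>
      ses (regular_module R\<lparr>carrier := \<aa>\<rparr>) (\<lambda>x. x) (regular_module R) p Q \<Longrightarrow> ext_zero Q (Suc n)"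
  shows "finite_inj_dim R (regular_module R)"
proof -
  let ?R = "regular_module R" and ?Z = "free_mod R 0"
  define kr where "kr = a_kernel (J (Suc n)) (J (Suc (Suc n))) (\<delta> (Suc n))"
  define K where "K = J (Suc n)\<lparr>carrier := kr\<rparr>"
  have krsub: "submodule kr R (J (Suc n))"
    unfolding kr_def by (rule submodule_kernel[OF \<delta>_hom J_module J_module])
  have mK: "module R K" unfolding K_def by (rule submodule_module[OF krsub J_module])
  have krJ: "y \<in> carrier (J (Suc n))" "\<delta> (Suc n) y = \<zero>\<^bsub>J (Suc (Suc n))\<^esub>" if "y \<in> kr" for y
    using that by (auto simp: kr_def a_kernel_iff)
  have bK: "baer K"
    unfolding baer_def
  proof (intro conjI allI impI mK)
    fix \<aa> f assume "submodule \<aa> R ?R \<and> f \<in> mod_hom R (?R\<lparr>carrier := \<aa>\<rparr>) K"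
    then have a: "submodule \<aa> R ?R" and f: "f \<in> mod_hom R (?R\<lparr>carrier := \<aa>\<rparr>) K" by auto
    have aR: "\<aa> \<subseteq> carrier R" using submodule_subset[OF a module_regular] by simp
    have fJ: "f \<in> mod_hom R (?R\<lparr>carrier := \<aa>\<rparr>) (J (Suc n))"
      using mod_hom_carrier_updateD[OF f[unfolded K_def] submodule_subset[OF krsub J_module]] .
    then obtain y0 where y0: "y0 \<in> carrier (J (Suc n))" "\<forall>r\<in>\<aa>. f r = r \<odot>\<^bsub>J (Suc n)\<^esub> y0"
      using J_baer[of n] a unfolding baer_def by blast
    define u where "u r = r \<odot>\<^bsub>J (Suc n)\<^esub> y0" for r
    have u: "u \<in> mod_hom R ?R (J (Suc n))"
      by (rule mod_homI) (use y0(1) in \<open>simp_all add: u_def module_add_smult module_mult_smult\<close>)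
    obtain p and Q :: "('a, 'a) module" where s: "ses (?R\<lparr>carrier := \<aa>\<rparr>) (\<lambda>x. x) ?R p Q"
      using ses_submodule[OF module_regular a] by blast
    have fk: "f r \<in> kr" if "r \<in> \<aa>" for r using mod_hom_closed[OF f] that by (simp add: K_def)
    have v0: "\<delta> (Suc n) (u r) = \<zero>\<^bsub>J (Suc (Suc n))\<^esub>" if "r \<in> carrier (?R\<lparr>carrier := \<aa>\<rparr>)" for r
      using that y0(2) krJ(2)[OF fk] by (simp add: u_def)
    \<comment> \<open>\<open>u\<close> extends \<open>f\<close> to \<open>R\<close> with values in
      the injective \<open>J (Suc n)\<close>. The cocycle \<open>h\<close> on the quotient measures
      how far \<open>u\<close> leaves the kernel.\<close>
    from ses_descend[OF s mod_hom_comp[OF u \<delta>_hom] J_module v0]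
    obtain h where h: "h \<in> mod_hom R Q (J (Suc (Suc n)))" "\<forall>r\<in>carrier ?R. h (p r) = \<delta> (Suc n) (u r)" by blast
    have "\<delta> (Suc (Suc n)) (h z) = \<zero>\<^bsub>J (Suc (Suc (Suc n)))\<^esub>" if z: "z \<in> carrier Q" for z
    proof -
      obtain r where "r \<in> carrier ?R" "p r = z" using ses_surj[OF s z] by blast
      then show ?thesis using h(2) \<delta>_\<delta>[OF mod_hom_closed[OF u]] by force
    qed
    then have "cocycle Q (Suc n) h" using h(1) by (simp add: cocycle_def)
    then have "coboundary Q (Suc n) h" using van[OF a s] by (simp add: ext_zero_def)
    then obtain g where g: "g \<in> mod_hom R Q (J (Suc n))" "\<forall>z\<in>carrier Q. h z = \<delta> (Suc n) (g z)"
      unfolding coboundary_def by blast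
    note gp = mod_hom_comp[OF ses_homs(2)[OF s] g(1)]
    \<comment> \<open>Correcting by a primitive of \<open>h\<close> moves the extension into the
      kernel without changing it on \<aa>, where \<open>p\<close> vanishes.\<close>
    let ?w = "\<lambda>r. u r \<ominus>\<^bsub>J (Suc n)\<^esub> g (p r)"
    have w: "?w \<in> mod_hom R ?R (J (Suc n))" by (rule mod_hom_diff[OF u gp module_regular J_module])
    have wk: "?w r \<in> kr" if "r \<in> carrier R" for r
    proof -
      have "\<delta> (Suc n) (u r) = h (p r)" using h(2) that by simp
      also have "\<dots> = \<delta> (Suc n) (g (p r))"
        using g(2) that mod_hom_closed[OF ses_homs(2)[OF s], of r] by simp
      finally have "\<delta> (Suc n) (u r) = \<delta> (Suc n) (g (p r))" .
      then show ?thesis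
        using mod_hom_closed[OF u, of r] mod_hom_closed[OF gp, of r] mod_hom_closed[OF \<delta>_hom] that
        by (simp add: kr_def a_kernel_iff mod_hom_minus[OF \<delta>_hom])
    qed
    have "f r = r \<odot>\<^bsub>K\<^esub> ?w \<one>" if r: "r \<in> \<aa>" for r
    proof -
      have rR: "r \<in> carrier R" using r aR by blast
      have "r \<odot>\<^bsub>J (Suc n)\<^esub> ?w \<one> = ?w r" using mod_hom_smult[OF w rR, of \<one>] rR by simp
      also have "\<dots> = u r"
        using ses_comp[OF s, of r] r mod_hom_zero[OF g(1) ses_modules(3)[OF s] J_module] mod_hom_closed[OF u, of r] rR
        by simp
      finally show ?thesis using y0(2) r by (simp add: K_def u_def)
    qed
    then show "\<exists>y\<in>carrier K. \<forall>r\<in>\<aa>. f r = r \<odot>\<^bsub>K\<^esub> y" using wk[OF one_closed] by (auto simp: K_def)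
  qed
  have bZ: "baer ?Z"
    unfolding baer_def
  proof (intro conjI allI impI module_free_mod)
    fix \<aa> f assume "submodule \<aa> R ?R \<and> f \<in> mod_hom R (?R\<lparr>carrier := \<aa>\<rparr>) ?Z"
    then show "\<exists>y\<in>carrier ?Z. \<forall>r\<in>\<aa>. f r = r \<odot>\<^bsub>?Z\<^esub> y"
      using mod_hom_closed[of f "?R\<lparr>carrier := \<aa>\<rparr>" ?Z] by auto
  qed
  \<comment> \<open>The injectives start at \<open>J (Suc 0)\<close>, hence the shift by one;
    \<open>K\<close> closes the resolution in degree n and zero modules follow.\<close>
  define I where "I i = (if i < n then J (Suc i) else if i = n then K else ?Z)" for i
  define d where "d i = (if i < n then \<delta> (Suc i) else (\<lambda>x. \<zero>\<^bsub>?Z\<^esub>))" for i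
  have zI: "\<zero>\<^bsub>I i\<^esub> = \<zero>\<^bsub>J (Suc i)\<^esub>" if "i \<le> n" for i using that by (auto simp: I_def K_def)
  have ker: "a_kernel (I i) (I (Suc i)) (d i) = \<delta> i ` carrier (J i)" if "i \<le> n" for i
  proof (cases "i = n")
    case True
    have "a_kernel (I i) (I (Suc i)) (d i) = kr" using True by (auto simp: a_kernel_def' I_def d_def K_def)
    then show ?thesis using True by (simp add: kr_def \<delta>_exact)
  next
    case False
    then show ?thesis using that zI[of "Suc i"] by (simp add: a_kernel_def' I_def d_def \<delta>_exact)
  qed
  have "injective_resolution R ?R I d (\<lambda>r. \<delta> 0 (\<theta> r))"
    unfolding injective_resolution_def
  proof (intro conjI allI)
    show "injective_module R (I i)" for i
      using injective_module_if_baer J_baer bK bZ by (simp add: I_def)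
    show "d i \<in> mod_hom R (I i) (I (Suc i))" for i
    proof -
      consider "Suc i < n" | "Suc i = n" | "n \<le> i" by linarith
      then show ?thesis
      proof cases
        case 1
        then show ?thesis using \<delta>_hom by (simp add: I_def d_def)
      next
        case 2
        have "\<delta> (Suc i) ` carrier (J (Suc i)) \<subseteq> kr" unfolding \<delta>_exact kr_def using 2 by simp
        then show ?thesis using mod_hom_carrier_update[OF \<delta>_hom[of "Suc i"]] 2 by (auto simp: I_def d_def K_def)
      next
        case 3
        then have "d i = (\<lambda>x. \<zero>\<^bsub>?Z\<^esub>)" "I (Suc i) = ?Z" by (simp_all add: d_def I_def)
        then show ?thesis using mod_hom_const_zero[OF module_free_mod] by metis
      qed
    qed
    have im0: "(\<lambda>r. \<delta> 0 (\<theta> r)) ` carrier ?R = \<delta> 0 ` carrier (J 0)" using \<theta>(3) by (simp add: image_image[symmetric])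
    then show "(\<lambda>r. \<delta> 0 (\<theta> r)) ` carrier ?R = a_kernel (I 0) (I (Suc 0)) (d 0)" using ker[of 0] by simp
    show "(\<lambda>r. \<delta> 0 (\<theta> r)) \<in> mod_hom R ?R (I 0)"
    proof (cases "n = 0")
      case True
      have "(\<lambda>r. \<delta> 0 (\<theta> r)) ` carrier ?R \<subseteq> kr" unfolding im0 \<delta>_exact kr_def using True by simp
      then show ?thesis using mod_hom_carrier_update[OF mod_hom_comp[OF \<theta>(1) \<delta>_hom]] True by (simp add: I_def K_def)
    qed (use mod_hom_comp[OF \<theta>(1) \<delta>_hom] in \<open>simp add: I_def\<close>)
    show "inj_on (\<lambda>r. \<delta> 0 (\<theta> r)) (carrier ?R)"
      using comp_inj_on[OF \<theta>(2)] \<delta>_inj \<theta>(3) by (simp add: comp_def)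
    show "d i ` carrier (I i) = a_kernel (I (Suc i)) (I (Suc (Suc i))) (d (Suc i))" for i
    proof (cases "i < n")
      case True
      then show ?thesis using ker[of "Suc i"] by (simp add: I_def d_def)
    next
      case False
      have "module R (I i)" using mK module_free_mod[of 0] unfolding I_def by (simp del: free_mod.simps)
      then have "carrier (I i) \<noteq> {}" using module_zero_closed by blast
      then have "d i ` carrier (I i) = {\<zero>\<^bsub>?Z\<^esub>}" using False by (auto simp: d_def)
      then show ?thesis using False by (auto simp: a_kernel_def' I_def d_def)
    qed
  qed
  moreover have "zero_module (I i)" if "i > n" for i using that by (simp add: I_def zero_module_def)
  ultimately show ?thesis unfolding finite_inj_dim_def by blast
qed

end

section \<open>Change of resolution and exact sequences of Hom modules\<close>

context cring
begin

lemma hom_exact_retract: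
  assumes h: "hom_exact R P d L' j" and u: "u \<in> mod_hom R L L'" and v: "v \<in> mod_hom R L' L"
    and vu: "\<And>x. x \<in> carrier L \<Longrightarrow> v (u x) = x" and L: "module R L" "module R L'"
  shows "hom_exact R P d L j"
  unfolding hom_exact_def
proof (intro ballI impI)
  fix f assume f: "f \<in> mod_hom R (P (Suc j)) L" and van: "\<forall>x\<in>carrier (P (Suc (Suc j))). f (d (Suc j) x) = \<zero>\<^bsub>L\<^esub>"
  have "\<exists>g\<in>mod_hom R (P j) L'. \<forall>x\<in>carrier (P (Suc j)). u (f x) = g (d j x)"
    using h[unfolded hom_exact_def, rule_format, OF mod_hom_comp[OF f u]] van mod_hom_zero[OF u L] by simp
  then obtain g where g: "g \<in> mod_hom R (P j) L'" "\<forall>x\<in>carrier (P (Suc j)). u (f x) = g (d j x)" by blast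
  have "f x = v (g (d j x))" if "x \<in> carrier (P (Suc j))" for x
    using g(2) vu[OF mod_hom_closed[OF f that]] that by metis
  then show "\<exists>g\<in>mod_hom R (P j) L. \<forall>x\<in>carrier (P (Suc j)). f x = g (d j x)"
    by (intro bexI[OF _ mod_hom_comp[OF g(1) v]]) blast
qed

text \<open>Choosing preimages under a free cover of finite rank injects the module into the
  universe.\<close>

lemma ex_univ_copy:
  fixes N :: "('a, 'n) module"
  assumes N: "acc N"
  shows "\<exists>(N' :: ('a, 'a univ) module) u v. module R N' \<and> u \<in> mod_hom R N N' \<and> v \<in> mod_hom R N' N \<and>
    inj_on u (carrier N) \<and> u ` carrier N = carrier N' \<and>
    (\<forall>x\<in>carrier N. v (u x) = x) \<and> (\<forall>x\<in>carrier N'. u (v x) = x)"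
proof -
  note m = acc_module[OF N]
  obtain b f where f: "f \<in> mod_hom R (free_mod R b) N" "f ` carrier (free_mod R b) = carrier N"
    using acc_ex_free_cover[OF N] unfolding free_cover_def by blast
  define u where "u = inv_into (carrier (free_mod R b)) f"
  have inj: "inj_on u (carrier N)"
    using inj_on_inv_into[of "carrier N" f "carrier (free_mod R b)"] f(2) by (simp add: u_def)
  from ex_module_copy[OF m inj] obtain N' :: "('a, 'a univ) module" where u: "module R N'" "u \<in> mod_hom R N N'"
    "u ` carrier N = carrier N'" by blast
  note u = u inj
  note v = mod_hom_inverse[OF u(2,4,3) m]
  have "inv_into (carrier N) u (u x) = x" if "x \<in> carrier N" for x using inv_into_f_f[OF u(4) that] .
  moreover have "u (inv_into (carrier N) u x) = x" if "x \<in> carrier N'" for x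
    using f_inv_into_f[of x u "carrier N"] u(3) that by simp
  ultimately show ?thesis using u v by blast
qed

text \<open>\<open>Ext\<close> uses an unspecified resolution, while the argument needs the minimal
  one. For either, exactness is equivalent to the same vanishing over a coresolution of a copy of
  \<open>L\<close>, so no chain map between the two is constructed.\<close>

lemma hom_exact_comparison:
  fixes L :: "('a, 'l) module"
  assumes L: "acc L" and Y: "module R Y"
    and P: "projective_resolution R Y P d e" and P': "projective_resolution R Y P' d' e'"
    and h: "hom_exact R P d L (Suc j)"
  shows "hom_exact R P' d' L (Suc j)"
proof -
  obtain L' :: "('a, 'a univ) module" and u v where L': "module R L'" "u \<in> mod_hom R L L'" "v \<in> mod_hom R L' L"
    "\<And>x. x \<in> carrier L \<Longrightarrow> v (u x) = x" "\<And>x. x \<in> carrier L' \<Longrightarrow> u (v x) = x"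
    using ex_univ_copy[OF L] by metis
  obtain J \<delta> where J: "coresolution R J \<delta>" "J 0 = L'" using ex_coresolution[OF L'(1)] by blast
  interpret coresolution R J \<delta> by (rule J(1))
  have "hom_exact R P d L' (Suc j)"
    by (rule hom_exact_retract[OF h L'(3,2,5,1) acc_module[OF L]])
  then have "hom_exact R P' d' L' (Suc j)"
    using hom_exact_iff_ext_zero[OF P Y] hom_exact_iff_ext_zero[OF P' Y] unfolding J(2) by blast
  then show ?thesis
    by (rule hom_exact_retract[OF _ L'(2,3,4) acc_module[OF L] L'(1)])
qed

text \<open>Surjectivity is the lifting property of the free module. In the middle, a map into the
  kernel of \<open>g\<close> is regarded as a map into the image of \<open>f\<close> and lifted
  along \<open>f\<close>.\<close>

lemma ses_hom_post:
  assumes s: "ses K f M g G"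
  shows "ses (hom_module R (free_mod R b) K) (\<lambda>\<alpha>. \<lambda>x\<in>carrier (free_mod R b). f (\<alpha> x)) (hom_module R (free_mod R b) M)
    (\<lambda>\<phi>. \<lambda>x\<in>carrier (free_mod R b). g (\<phi> x)) (hom_module R (free_mod R b) G)"
proof -
  let ?F = "free_mod R b"
  note m = ses_modules[OF s] and fg = ses_homs[OF s]
  have post: "(\<lambda>\<alpha>. \<lambda>x\<in>carrier ?F. h (\<alpha> x)) \<in> mod_hom R (hom_module R ?F A) (hom_module R ?F B)"
    if h: "h \<in> mod_hom R A B" and AB: "module R A" for h :: "'p \<Rightarrow> 'q" and A B
  proof (rule mod_homI)
    show "(\<lambda>x\<in>carrier ?F. h (\<alpha> x)) \<in> carrier (hom_module R ?F B)" if "\<alpha> \<in> carrier (hom_module R ?F A)" for \<alpha>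
      using that mod_hom_restrict[OF mod_hom_comp[OF _ h] module_free_mod] by simp
  qed (auto intro!: restrict_ext simp: mod_hom_closed[of _ ?F A] mod_hom_add[OF h] mod_hom_smult[OF h])
  show ?thesis
  proof (rule sesI[OF module_hom_module[OF module_free_mod m(1)] module_hom_module[OF module_free_mod m(2)]
        module_hom_module[OF module_free_mod m(3)] post[OF fg(1) m(1)] post[OF fg(2) m(2)]])
    show "\<alpha> = \<zero>\<^bsub>hom_module R ?F K\<^esub>"
      if a: "\<alpha> \<in> carrier (hom_module R ?F K)" and z: "(\<lambda>x\<in>carrier ?F. f (\<alpha> x)) = \<zero>\<^bsub>hom_module R ?F M\<^esub>" for \<alpha>
    proof (rule extensionalityI[where A = "carrier ?F"])
      fix x assume x: "x \<in> carrier ?F"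
      have "\<alpha> x \<in> carrier K" using a x by (auto intro: mod_hom_closed)
      moreover have "f (\<alpha> x) = f \<zero>\<^bsub>K\<^esub>"
        using fun_cong[OF z, of x] x mod_hom_zero[OF fg(1) m(1,2)] by simp
      ultimately show "\<alpha> x = \<zero>\<^bsub>hom_module R ?F K\<^esub> x"
        using inj_onD[OF ses_inj[OF s]] m(1) x by simp
    qed (use a in auto)
    show "(\<lambda>x\<in>carrier ?F. g ((\<lambda>x\<in>carrier ?F. f (\<alpha> x)) x)) = \<zero>\<^bsub>hom_module R ?F G\<^esub>"
      if "\<alpha> \<in> carrier (hom_module R ?F K)" for \<alpha>
      using that ses_comp[OF s] by (auto intro!: restrict_ext simp: mod_hom_closed[of _ ?F K])
    show "\<exists>\<alpha>\<in>carrier (hom_module R ?F K). (\<lambda>x\<in>carrier ?F. f (\<alpha> x)) = \<phi>"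
      if p: "\<phi> \<in> carrier (hom_module R ?F M)" and z: "(\<lambda>x\<in>carrier ?F. g (\<phi> x)) = \<zero>\<^bsub>hom_module R ?F G\<^esub>" for \<phi>
    proof -
      have ph: "\<phi> \<in> mod_hom R ?F M" using p by simp
      let ?I = "M\<lparr>carrier := f ` carrier K\<rparr>"
      have "\<phi> x \<in> f ` carrier K" if x: "x \<in> carrier ?F" for x
      proof -
        have "g (\<phi> x) = \<zero>\<^bsub>G\<^esub>" using fun_cong[OF z, of x] x by simp
        then obtain a where a: "a \<in> carrier K" "f a = \<phi> x" using ses_exact[OF s mod_hom_closed[OF ph x]] by blast
        show ?thesis unfolding a(2)[symmetric] using a(1) by (rule imageI)
      qed
      then have im: "\<phi> \<in> mod_hom R ?F ?I" by (intro mod_hom_carrier_update[OF ph]) blast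
      have fI: "f \<in> mod_hom R K ?I" by (rule mod_hom_carrier_update[OF fg(1)]) simp
      obtain \<alpha> where \<alpha>: "\<alpha> \<in> mod_hom R ?F K" "\<forall>x\<in>carrier ?F. f (\<alpha> x) = \<phi> x"
        using free_mod_lift[OF m(1) submodule_module[OF submodule_image[OF fg(1) m(1,2)] m(2)] fI _ im] by auto
      have "(\<lambda>x\<in>carrier ?F. f (restrict \<alpha> (carrier ?F) x)) = \<phi>"
        by (rule extensionalityI[where A = "carrier ?F"]) (use \<alpha>(2) p in auto)
      then show ?thesis using mod_hom_restrict[OF \<alpha>(1) module_free_mod] by (intro bexI[of _ "restrict \<alpha> (carrier ?F)"]) auto
    qed
    show "\<exists>\<phi>\<in>carrier (hom_module R ?F M). (\<lambda>x\<in>carrier ?F. g (\<phi> x)) = \<psi>"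
      if p: "\<psi> \<in> carrier (hom_module R ?F G)" for \<psi>
    proof -
      have "g ` carrier M = carrier G" using ses_surj[OF s] mod_hom_closed[OF fg(2)] by force
      moreover have "\<psi> \<in> mod_hom R ?F G" using p by simp
      ultimately obtain \<phi> where \<phi>: "\<phi> \<in> mod_hom R ?F M" "\<forall>x\<in>carrier ?F. g (\<phi> x) = \<psi> x"
        using free_mod_lift[OF m(2,3) fg(2)] by blast
      have "(\<lambda>x\<in>carrier ?F. g (restrict \<phi> (carrier ?F) x)) = \<psi>"
        by (rule extensionalityI[where A = "carrier ?F"]) (use \<phi>(2) p in auto)
      then show ?thesis using mod_hom_restrict[OF \<phi>(1) module_free_mod] by (intro bexI[of _ "restrict \<phi> (carrier ?F)"]) auto
    qed
  qed
qed

lemma submodule_ext_cocycles: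
  assumes P: "module R (P i)" and M: "module R M" and d: "d i \<in> mod_hom R (P (Suc i)) (P i)"
  shows "submodule (ext_cocycles R P d M i) R (hom_module R (P i) M)"
proof (rule submodule_intro[OF module_hom_module[OF P M]])
  show "\<zero>\<^bsub>hom_module R (P i) M\<^esub> \<in> ext_cocycles R P d M i"
    using module_zero_closed[OF module_hom_module[OF P M]] mod_hom_closed[OF d] by (simp add: ext_cocycles_def)
  fix f g r assume f: "f \<in> ext_cocycles R P d M i"
  show "r \<odot>\<^bsub>hom_module R (P i) M\<^esub> f \<in> ext_cocycles R P d M i" if "r \<in> carrier R"
    using f that module_smult_closed[OF module_hom_module[OF P M], of r f] mod_hom_closed[OF d] M
    by (simp add: ext_cocycles_def)
  assume "g \<in> ext_cocycles R P d M i"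
  then show "f \<oplus>\<^bsub>hom_module R (P i) M\<^esub> g \<in> ext_cocycles R P d M i"
    using f module_add_closed[OF module_hom_module[OF P M], of f g] mod_hom_closed[OF d] M
    by (simp add: ext_cocycles_def)
qed (auto simp: ext_cocycles_def)

text \<open>Z_i is by definition the kernel of precomposition with \<open>d i\<close>, and
  \<open>hom_exact\<close> makes the image of that map all of Z_(i+1).\<close>

lemma ses_ext_cocycles:
  assumes P: "\<And>i. module R (P i)" and M: "module R M" and d: "\<And>i. d i \<in> mod_hom R (P (Suc i)) (P i)"
    and dd: "\<And>i x. x \<in> carrier (P (Suc (Suc i))) \<Longrightarrow> d i (d (Suc i) x) = \<zero>\<^bsub>P i\<^esub>"
    and h: "hom_exact R P d M i"
  shows "ses (hom_module R (P i) M\<lparr>carrier := ext_cocycles R P d M i\<rparr>) (\<lambda>f. f) (hom_module R (P i) M)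
    (\<lambda>f. \<lambda>x\<in>carrier (P (Suc i)). f (d i x))
    (hom_module R (P (Suc i)) M\<lparr>carrier := ext_cocycles R P d M (Suc i)\<rparr>)"
proof -
  note sub = submodule_ext_cocycles[where P = P and M = M and d = d, OF P M d] and mh = module_hom_module[OF P M]
  let ?p = "\<lambda>f. \<lambda>x\<in>carrier (P (Suc i)). f (d i x)"
  show ?thesis
  proof (rule sesI[OF submodule_module[OF sub mh] mh submodule_module[OF sub mh]])
    show "(\<lambda>f. f) \<in> mod_hom R (hom_module R (P i) M\<lparr>carrier := ext_cocycles R P d M i\<rparr>) (hom_module R (P i) M)"
      by (rule mod_hom_restrict_carrier[OF mod_hom_id submodule_subset[OF sub mh]])
    have "?p \<in> mod_hom R (hom_module R (P i) M) (hom_module R (P (Suc i)) M)"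
    proof (rule mod_homI)
      show "?p f \<in> carrier (hom_module R (P (Suc i)) M)" if "f \<in> carrier (hom_module R (P i) M)" for f
        using that mod_hom_restrict[OF mod_hom_comp[OF d[of i], where g = f and N = M] P] by simp
    qed (auto simp: mod_hom_closed[OF d])
    then show "?p \<in> mod_hom R (hom_module R (P i) M) (hom_module R (P (Suc i)) M\<lparr>carrier := ext_cocycles R P d M (Suc i)\<rparr>)"
    proof (rule mod_hom_carrier_update)
      show "?p ` carrier (hom_module R (P i) M) \<subseteq> ext_cocycles R P d M (Suc i)"
      proof
        fix y assume "y \<in> ?p ` carrier (hom_module R (P i) M)"
        then obtain f where f: "f \<in> mod_hom R (P i) M" "y = ?p f" by auto
        have "y \<in> mod_hom R (P (Suc i)) M \<inter> extensional (carrier (P (Suc i)))"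
          using mod_hom_restrict[OF mod_hom_comp[OF d f(1)] P] f(2) by simp
        moreover have "y (d (Suc i) x) = \<zero>\<^bsub>M\<^esub>" if "x \<in> carrier (P (Suc (Suc i)))" for x
          using f(2) mod_hom_closed[OF d that] dd[OF that] mod_hom_zero[OF f(1) P M] by simp
        ultimately show "y \<in> ext_cocycles R P d M (Suc i)" by (simp add: ext_cocycles_def)
      qed
    qed
    show "?p a = \<zero>\<^bsub>hom_module R (P (Suc i)) M\<lparr>carrier := ext_cocycles R P d M (Suc i)\<rparr>\<^esub>"
      if "a \<in> carrier (hom_module R (P i) M\<lparr>carrier := ext_cocycles R P d M i\<rparr>)" for a
      using that by (auto intro!: restrict_ext simp: ext_cocycles_def)
    show "\<exists>a\<in>carrier (hom_module R (P i) M\<lparr>carrier := ext_cocycles R P d M i\<rparr>). a = f"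
      if "f \<in> carrier (hom_module R (P i) M)"
        and z: "?p f = \<zero>\<^bsub>hom_module R (P (Suc i)) M\<lparr>carrier := ext_cocycles R P d M (Suc i)\<rparr>\<^esub>" for f
    proof -
      have "f (d i x) = \<zero>\<^bsub>M\<^esub>" if "x \<in> carrier (P (Suc i))" for x using fun_cong[OF z, of x] that by simp
      then show ?thesis using that(1) by (simp add: ext_cocycles_def)
    qed
    show "\<exists>g\<in>carrier (hom_module R (P i) M). ?p g = f"
      if "f \<in> carrier (hom_module R (P (Suc i)) M\<lparr>carrier := ext_cocycles R P d M (Suc i)\<rparr>)" for f
    proof -
      have f: "f \<in> mod_hom R (P (Suc i)) M" "f \<in> extensional (carrier (P (Suc i)))"
        "\<forall>x\<in>carrier (P (Suc (Suc i))). f (d (Suc i) x) = \<zero>\<^bsub>M\<^esub>" using that by (auto simp: ext_cocycles_def)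
      obtain g where g: "g \<in> mod_hom R (P i) M" "\<forall>x\<in>carrier (P (Suc i)). f x = g (d i x)"
        using h f(1,3) unfolding hom_exact_def by blast
      have "?p (restrict g (carrier (P i))) = f"
        by (rule extensionalityI[where A = "carrier (P (Suc i))"]) (use f(2) g(2) mod_hom_closed[OF d] in auto)
      then show ?thesis using mod_hom_restrict[OF g(1) P] by (intro bexI[of _ "restrict g (carrier (P i))"]) auto
    qed
  qed auto
qed

end

section \<open>Infinite projective dimension of Y forces R to be Gorenstein\<close>

theorem proposition4p7:
  fixes R :: "('a, 'c) ring_scheme" and M :: "('a, 'm) module"
  assumes "noetherian_local_ring R"
    and "\<not> gorenstein_local_ring R"
    and "fg_module R M"
    and "\<exists>(G :: ('a, 'g) module) f g. fg_module R G \<and>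
           short_exact R (residue_field_module R) f M g G \<and>
           Ext_eventually_zero R G (regular_module R)"
  shows "M \<in> EP TYPE('y) R"
proof -
  have "cring R" using assms(1) by (simp add: noetherian_local_ring_def)
  then interpret noetherian_local R by (intro noetherian_local.intro noetherian_local_axioms.intro assms(1))
  let ?k = "residue_field_module R" and ?R = "regular_module R"
  have kill: "\<forall>r\<in>carrier R - Units R. \<forall>x\<in>carrier ?k. r \<odot>\<^bsub>?k\<^esub> x = \<zero>\<^bsub>?k\<^esub>"
    using residue_field(3)[OF nonunit_in_max_ideal] by blast
  note aM = acc_fg_module[OF acc_R assms(3)] and mk = residue_field(1)
  note mM = acc_module[OF aM]
  obtain G :: "('a, 'g) module" and f g where G: "fg_module R G" "short_exact R ?k f M g G"
    "Ext_eventually_zero R G ?R" using assms(4) by blast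
  note aG = acc_fg_module[OF acc_R G(1)]
  note mG = acc_module[OF aG]
  have s: "ses ?k f M g G" using G(2) mk mM mG by (simp add: ses_def)
  have "finite_proj_dim R Y" if Y: "fg_module R Y" "Ext_eventually_zero R Y M" for Y :: "('a, 'y) module"
  proof (rule ccontr)
    assume inf: "\<not> finite_proj_dim R Y"
    note aY = acc_fg_module[OF acc_R Y(1)]
    note mY = acc_module[OF aY]
    obtain b d e where res: "projective_resolution R Y (\<lambda>i. free_mod R (b i)) d e"
      and b0: "\<forall>i. b i = 0 \<longrightarrow> b (Suc i) = 0"
      and min: "\<forall>i. \<forall>\<alpha>\<in>mod_hom R (free_mod R (b i)) ?k. \<forall>x\<in>carrier (free_mod R (b (Suc i))). \<alpha> (d i x) = \<zero>\<^bsub>?k\<^esub>"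
      using ex_minimal_resolution[OF acc_R aY mk kill] by (elim exE conjE) (rule that)
    define F where "F i = free_mod R (b i)" for i
    have resF: "projective_resolution R Y F d e" using res by (simp add: F_def[abs_def])
    have mF: "module R (F i)" for i by (simp add: F_def)
    have d: "d i \<in> mod_hom R (F (Suc i)) (F i)" for i using resF by (simp add: projective_resolution_def)
    have dd: "d i (d (Suc i) x) = \<zero>\<^bsub>F i\<^esub>" if "x \<in> carrier (F (Suc (Suc i)))" for i x
    proof -
      have "d (Suc i) x \<in> a_kernel (F (Suc i)) (F i) (d i)"
        using resF that unfolding projective_resolution_def by blast
      then show ?thesis by (simp add: a_kernel_iff)
    qed
    \<comment> \<open>One vanishing rank makes all later modules zero, and then \<open>F\<close>
      would witness finite projective dimension.\<close>
    have b: "b i \<noteq> 0" for i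
    proof
      assume i: "b i = 0"
      have "b (i + n) = 0" for n
      proof (induction n)
        case (Suc n)
        then show ?case using b0 by simp
      qed (simp add: i)
      note bz = this
      have "zero_module (F n)" if "n > i" for n
      proof -
        have "b n = 0" using bz[of "n - i"] that by simp
        then show ?thesis by (simp add: F_def zero_module_def)
      qed
      then show False using inf resF unfolding finite_proj_dim_def by blast
    qed
    \<comment> \<open>Exactness is known for the resolution chosen in \<open>Ext\<close> and is
      carried over to the minimal one. The bound grows by 1 because the comparison starts in degree
      \<open>Suc\<close>.\<close>
    obtain n where n: "\<And>j. j \<ge> n \<Longrightarrow> hom_exact R F d M j"
    proof -
      obtain P d' e' n where P: "projective_resolution R Y P d' e'" "\<forall>j\<ge>n. hom_exact R P d' M j"
        using hom_exact_Ext[OF Y(2) mM] resF by blast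
      have "hom_exact R F d M j" if j: "j \<ge> Suc n" for j
      proof -
        obtain i where i: "j = Suc i" using j by (cases j) auto
        then have "hom_exact R P d' M (Suc i)" using P(2) j by simp
        from hom_exact_comparison[OF aM mY P(1) resF this] show ?thesis by (simp add: i)
      qed
      then show ?thesis by (rule that)
    qed
    \<comment> \<open>Coresolutions start from a module in the universe, so the regular module is
      replaced by a copy.\<close>
    obtain R' :: "('a, 'a univ) module" and u v where R': "module R R'" "u \<in> mod_hom R ?R R'" "v \<in> mod_hom R R' ?R"
      "inj_on u (carrier ?R)" "u ` carrier ?R = carrier R'" "\<forall>x\<in>carrier ?R. v (u x) = x" "\<forall>x\<in>carrier R'. u (v x) = x"
      using ex_univ_copy[OF acc_R] by (elim exE conjE) (rule that)
    obtain J \<delta> where J: "coresolution R J \<delta>" "J 0 = R'" using ex_coresolution[OF R'(1)] by blast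
    interpret coresolution R J \<delta> by (rule J(1))
    have J0: "acc (J 0)" unfolding J(2) by (rule acc_surj[OF acc_R R'(1,2,5)])
    obtain j0 where G0: "\<And>j. j \<ge> j0 \<Longrightarrow> ext_zero G (Suc j)"
    proof -
      have "\<exists>P d e. projective_resolution R G P d e"
        using ex_minimal_resolution[OF acc_R aG mk kill] by (elim exE conjE) (intro exI)
      then obtain P d' e' n' where P: "projective_resolution R G P d' e'" "\<forall>j\<ge>n'. hom_exact R P d' ?R j"
        using hom_exact_Ext[OF G(3) module_regular] by blast
      have "ext_zero G (Suc j)" if j: "j \<ge> Suc n'" for j
      proof -
        obtain i where i: "j = Suc i" using j by (cases j) auto
        then have "hom_exact R P d' ?R (Suc i)" using P(2) j by simp
        then have "hom_exact R P d' (J 0) (Suc i)"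
          unfolding J(2) by (rule hom_exact_retract[OF _ R'(3,2) _ R'(1) module_regular]) (use R'(7) in blast)
        then show ?thesis using hom_exact_iff_ext_zero[OF P(1) mG] i by simp
      qed
      then show ?thesis by (rule that)
    qed
    \<comment> \<open>\<open>?N s\<close> is Z_(n+s). Starting at index n makes every sequence in
      \<open>chain\<close> exact.\<close>
    let ?E = "\<lambda>s. hom_module R (F (n + s)) M"
    let ?N = "\<lambda>s. ?E s\<lparr>carrier := ext_cocycles R F d M (n + s)\<rparr>"
    have chain: "ses (?N s) (\<lambda>f. f) (?E s) (\<lambda>f. \<lambda>x\<in>carrier (F (Suc (n + s))). f (d (n + s) x)) (?N (Suc s))" for s
      using ses_ext_cocycles[where P = F and M = M and d = d, OF mF mM d dd n[of "n + s"]] by simp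
    \<comment> \<open>A cocycle that becomes a coboundary on Z_(n+s) does so on the smaller Hom(F,
      k); since the cohomology of Hom(F, G) vanishes, \<open>coboundary_from_sub\<close> applies to
      this smaller submodule.\<close>
    have inj: "coboundary (?E s) (Suc j) c"
      if j: "j \<ge> j0" and c: "cocycle (?E s) (Suc j) c" and cN: "coboundary (?N s) (Suc j) (\<lambda>x. c x)" for s j c
    proof -
      let ?i = "\<lambda>\<alpha>. \<lambda>x\<in>carrier (F (n + s)). f (\<alpha> x)"
      have sF: "ses (hom_module R (F (n + s)) ?k) ?i (?E s)
        (\<lambda>\<phi>. \<lambda>x\<in>carrier (F (n + s)). g (\<phi> x)) (hom_module R (F (n + s)) G)"
        unfolding F_def by (rule ses_hom_post[OF \<open>ses ?k f M g G\<close>])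
      \<comment> \<open>Minimality enters here: \<alpha> kills the image of the next differential,
        hence so does its composite with \<open>f\<close>.\<close>
      have "?i \<alpha> \<in> ext_cocycles R F d M (n + s)" if \<alpha>: "\<alpha> \<in> carrier (hom_module R (F (n + s)) ?k)" for \<alpha>
      proof -
        have "\<alpha> (d (n + s) x) = \<zero>\<^bsub>?k\<^esub>" if "x \<in> carrier (F (Suc (n + s)))" for x
          using min \<alpha> that by (simp add: F_def)
        then show ?thesis
          using mod_hom_closed[OF ses_homs(1)[OF sF] \<alpha>] mod_hom_closed[OF d] mod_hom_zero[OF ses_homs(1)[OF \<open>ses ?k f M g G\<close>] mk mM]
          by (simp add: ext_cocycles_def)
      qed
      then have "?i \<in> mod_hom R (hom_module R (F (n + s)) ?k) (?N s)"
        by (intro mod_hom_carrier_update[OF ses_homs(1)[OF sF]]) blast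
      from coboundary_comp[OF cN this]
      have "coboundary (hom_module R (F (n + s)) ?k) (Suc j) (\<lambda>\<alpha>. c (?i \<alpha>))" .
      moreover have "ext_zero (hom_module R (F (n + s)) G) (Suc j)"
        unfolding F_def by (rule ext_zero_hom_free[OF mG G0[OF j]])
      ultimately show ?thesis using coboundary_from_sub[OF sF _ c] by blast
    qed
    have "acc (?N 0)"
      by (rule acc_submodule[OF _ submodule_ext_cocycles[where P = F and M = M and d = d, OF mF mM d]]) (simp add: F_def acc_hom_free[OF aM])
    then obtain T :: "('a, 'a univ \<Rightarrow> 'a univ) module" and \<Theta> where T: "presents T \<Theta> (?N 0) (Suc j0)"
      using ex_presents[OF acc_R J0] by blast
    obtain s0 where s0: "\<And>s. s \<ge> s0 \<Longrightarrow> ext_zero (?E s) (Suc (j0 + s))"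
      using ext_zero_eventually[of T \<Theta> ?N j0 "\<lambda>s f. f" ?E, OF T chain inj] by blast
    have ek: "ext_zero ?k (Suc j)" if j: "j \<ge> j0 + s0" for j
    proof -
      \<comment> \<open>Vanishing is known along a diagonal only: in degree \<open>Suc j\<close> it
        concerns the module of index \<open>n + (j - j0)\<close>. Its rank is positive, so the
        result passes to \<open>M\<close>.\<close>
      define s where "s = j - j0"
      have js: "j = j0 + s" "s \<ge> s0" using j by (auto simp: s_def)
      obtain b' where b': "b (n + s) = Suc b'" using b[of "n + s"] not0_implies_Suc by blast
      have "ext_zero (hom_module R (free_mod R (Suc b')) M) (Suc j)"
        using s0[OF js(2)] unfolding js(1) F_def b' .
      then have eM: "ext_zero M (Suc j)" by (rule ext_zero_of_hom_free[OF mM])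
      show ?thesis
        unfolding ext_zero_def
      proof (intro allI impI)
        fix c assume c: "cocycle ?k (Suc j) c"
        \<comment> \<open>Vanishing for \<open>G\<close> one degree higher extends the cocycle from
          k to \<open>M\<close>, where it is a coboundary.\<close>
        have "ext_zero G (Suc (Suc j))" using G0 j by simp
        from cocycle_extend[OF \<open>ses ?k f M g G\<close> this c]
        obtain h where h: "cocycle M (Suc j) h" "\<forall>a\<in>carrier ?k. h (f a) = c a" by blast
        from h(1) have "coboundary M (Suc j) h" using eM by (simp add: ext_zero_def)
        from coboundary_comp[OF this ses_homs(1)[OF \<open>ses ?k f M g G\<close>]]
        show "coboundary ?k (Suc j) c" by (rule coboundary_cong) (simp add: h(2))
      qed
    qed
    have "finite_inj_dim R ?R"
      by (rule finite_inj_dim_regular[of u "j0 + s0"])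
        (use R' J(2) ext_zero_cyclic[OF noetherian_local_axioms J0 ek] in auto)
    then show False using assms(1,2) by (simp add: gorenstein_local_ring_def)
  qed
  then show ?thesis using assms(3) by (simp add: EP_def)
qed

end
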